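(* Let $$L\phi(x)=\sum_{j=1}^d b_j(x)\frac{\partial\phi}{\partial x_j}(x),\qquad x\in\mathbb{R}^d,$$ with all $b_j\in C^1(\mathbb{R}^d)$, and let $T_t$ be the semigroup generated by $L$. Then, on smooth functions $g$ decaying quickly enough at infinity, the Pareto dual generator is given by $$L^{D(f)}g(x)=(-1)^d\sum_{j=1}^d\int_{\check z_j\ge\check x_j}b_j(\check z_j,x_j)\,\frac{\partial^d g}{\partial z_1\cdots\partial z_d}(\check z_j,x_j)\,d\check z_j,$$ and the solution to the Cauchy problem of the equation $\dot g=L^{D(f)}g$ is given by $T_t^{D(f)}g=F\circ T_t'\circ F^{-1}g$. Moreover, if each $b_j$ depends only on the coordinate $x_j$, then $$L^{D(f)}g(x)=-\sum_{j=1}^d b_j(x_j)\frac{\partial g}{\partial x_j}(x),$$ that is, $L^{D(f)}$ coincides with $L$ up to a sign, and the dual process exists and is the deterministic motion in the opposite direction to the original one.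
   Context: $C^1(\mathbb{R}^d)$ is the space of bounded continuous functions with bounded continuous first derivatives. $\ge$ is the Pareto (coordinatewise) order on $\mathbb{R}^d$. Pareto duality is duality with respect to $f(x,y)=\mathbf{1}_{\{x\ge y\}}$: operators $T,T^{D(f)}$ are dual if $(T^{D(f)}f(x,\cdot))(y)=(Tf(\cdot,y))(x)$ for all $x,y$; Markov processes $X_t^x$, $Y_t^y$ (superscripts denote initial points) are dual if $\mathbf{P}(X_t^x\ge y)=\mathbf{P}(Y_t^y\le x)$ for all $x,y$ and $t\ge0$. For a bounded signed measure $Q$ on $\mathbb{R}^d$, $(FQ)(y)=\int_{x\ge y}Q(dx)$. If $Q$ has a density $q$, then $g=FQ$ gives $q=F^{-1}g=(-1)^d\frac{\partial^d g}{\partial y_1\cdots\partial y_d}$. $T_t'$ and $L'$ are the standard duals, acting on measures, respectively on densities by $L'q(x)=-\sum_j\frac{\partial}{\partial x_j}[b_j(x)q(x)]$. The semigroup $T_t$ is $T_t\phi(x)=\phi(X^t(x))$, where $X^t(x)$ solves $\dot x=b(x)$ with initial point $x$ (the deterministic Markov process generated by $L$). The generator of the semigroup $T_t^{D(f)}=F\circ T_t'\circ F^{-1}$ is $L^{D(f)}=F\circ L'\circ F^{-1}$. $\check x_i\in\mathbb{R}^{d-1}$ is $x$ with the coordinate $x_i$ deleted; $g(\check z_i,x_i)$ is the value of $g$ at the vector whose $i$th coordinate is $x_i$ and whose other coordinates are those of $z$; $d\check z_j=\prod_{k\ne j}dz_k$. "Decaying quickly enough" means that boundary terms at infinity in integrations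 by parts vanish. *)

theory Defs
  imports "HOL-Probability.Probability"
begin

text \<open>
  Points of \<open>\<real>\<^sup>d\<close> are \<open>real ^ 'n\<close> with \<open>d = CARD('n)\<close>; the library order \<open>x \<le> y\<close> on this type is the
  coordinatewise (Pareto) order. The index type is linearly ordered only in order to fix the
  order of differentiation in the mixed derivative \<open>\<partial>\<^sup>d g / \<partial>z\<^sub>1 \<dots> \<partial>z\<^sub>d\<close>.
\<close>

section \<open>Partial derivatives and function classes\<close>

definition partially_differentiable :: "'n::finite \<Rightarrow> (real^'n \<Rightarrow> real) \<Rightarrow> bool" where
  "partially_differentiable j f \<longleftrightarrow>
     (\<forall>x. (\<lambda>s. f (x + s *\<^sub>R axis j 1)) field_differentiable (at 0))"

definition partial_deriv :: "'n::finite \<Rightarrow> (real^'n \<Rightarrow> real) \<Rightarrow> real^'n \<Rightarrow> real" where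
  "partial_deriv j f x = deriv (\<lambda>s. f (x + s *\<^sub>R axis j 1)) 0"

definition iter_partial :: "'n::finite list \<Rightarrow> (real^'n \<Rightarrow> real) \<Rightarrow> real^'n \<Rightarrow> real" where
  "iter_partial js f = foldr partial_deriv js f"

definition mixed_deriv :: "(real^'n::{finite,wellorder} \<Rightarrow> real) \<Rightarrow> real^'n::_ \<Rightarrow> real" where
  "mixed_deriv f = iter_partial (sorted_list_of_set UNIV) f"

definition C1_bounded :: "(real^'n::finite \<Rightarrow> real) \<Rightarrow> bool" where
  "C1_bounded f \<longleftrightarrow>
     continuous_on UNIV f \<and> bounded (range f) \<and>
     (\<forall>j. partially_differentiable j f \<and>
          continuous_on UNIV (partial_deriv j f) \<and> bounded (range (partial_deriv j f)))"

definition smooth_fun :: "(real^'n::finite \<Rightarrow> real) \<Rightarrow> bool" where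
  "smooth_fun f \<longleftrightarrow> (\<forall>js x. iter_partial js f differentiable (at x))"

text \<open>
  The boundary terms arising when \<open>\<partial>\<^sup>d g / \<partial>z\<^sub>1 \<dots> \<partial>z\<^sub>d\<close> is integrated over an orthant \<open>{z. x \<le> z}\<close> in any
  number of coordinates, in any order, exist and vanish. Only limits at \<open>+\<infinity>\<close> occur: a function
  \<open>g = F Q\<close> need not decay at \<open>-\<infinity>\<close>.
\<close>
definition vanishing_boundary_terms :: "(real^'n::finite \<Rightarrow> real) \<Rightarrow> bool" where
  "vanishing_boundary_terms g \<longleftrightarrow>
     (\<forall>js i. distinct js \<and> i \<notin> set js \<longrightarrow>
        partially_differentiable i (iter_partial js g) \<and>
        (\<forall>x. ((\<lambda>s. iter_partial js g (x + s *\<^sub>R axis i 1)) \<longlongrightarrow> 0) at_top))"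

text \<open>
  Smooth functions decaying quickly enough. The power \<open>p > d\<close> makes the density
  \<open>(-1)\<^sup>d \<partial>\<^sup>d g / \<partial>z\<^sub>1 \<dots> \<partial>z\<^sub>d\<close> of \<open>F\<inverse> g\<close> and its first derivatives integrable, on the whole space and on
  hyperplanes.
\<close>
definition quickly_decaying :: "(real^'n::{finite,wellorder} \<Rightarrow> real) \<Rightarrow> bool" where
  "quickly_decaying g \<longleftrightarrow>
     smooth_fun g \<and> vanishing_boundary_terms g \<and>
     (\<exists>C. \<exists>p > real CARD('n). \<forall>x.
        \<bar>mixed_deriv g x\<bar> \<le> C * (1 + norm x) powr (- p) \<and>
        (\<forall>j. \<bar>partial_deriv j (mixed_deriv g) x\<bar> \<le> C * (1 + norm x) powr (- p)))"

section \<open>Bounded signed measures\<close>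

text \<open>
  Real-valued countably additive set functions on the Borel sets (hence bounded), set to zero
  on all other sets so that equality of signed measures is equality of functions.
\<close>
definition signed_measure :: "('a::topological_space set \<Rightarrow> real) \<Rightarrow> bool" where
  "signed_measure Q \<longleftrightarrow>
     (\<forall>A. A \<notin> sets borel \<longrightarrow> Q A = 0) \<and>
     (\<forall>A :: nat \<Rightarrow> 'a set. range A \<subseteq> sets borel \<longrightarrow> disjoint_family A \<longrightarrow>
        (\<lambda>n. Q (A n)) sums Q (\<Union>n. A n))"

text \<open>
  The integral of a bounded Borel function; its value does not depend on the chosen
  representation of \<open>Q\<close> as a difference of finite measures.
\<close>
definition signed_integral :: "('a::topological_space set \<Rightarrow> real) \<Rightarrow> ('a \<Rightarrow> real) \<Rightarrow> real" where
  "signed_integral Q f =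
     (THE r. \<exists>M N. finite_measure M \<and> finite_measure N \<and>
        sets M = sets borel \<and> sets N = sets borel \<and>
        (\<forall>A \<in> sets borel. Q A = measure M A - measure N A) \<and>
        r = (LINT x|M. f x) - (LINT x|N. f x))"

definition with_density :: "('a::euclidean_space \<Rightarrow> real) \<Rightarrow> 'a set \<Rightarrow> real" where
  "with_density q A = (if A \<in> sets borel then LINT x:A|lborel. q x else 0)"

text \<open>The continuous density of a signed measure (unique if it exists).\<close>
definition density_of :: "('a::euclidean_space set \<Rightarrow> real) \<Rightarrow> 'a \<Rightarrow> real" where
  "density_of Q = (THE q. continuous_on UNIV q \<and> integrable lborel q \<and> with_density q = Q)"

definition pareto_F :: "((real^'n::finite) set \<Rightarrow> real) \<Rightarrow> real^'n \<Rightarrow> real" where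
  "pareto_F Q y = Q {x. y \<le> x}"

definition pareto_F_inv :: "(real^'n::finite \<Rightarrow> real) \<Rightarrow> (real^'n) set \<Rightarrow> real" where
  "pareto_F_inv = the_inv_into {Q. signed_measure Q} pareto_F"

text \<open>
  The dual \<open>T'\<close> of an operator \<open>T\<close> on bounded functions: \<open>\<integral> \<phi> d(T' Q) = \<integral> T \<phi> dQ\<close>, written for \<open>\<phi> = 1\<^sub>A\<close>.
\<close>
definition dual_operator ::
  "(('a::topological_space \<Rightarrow> real) \<Rightarrow> ('a \<Rightarrow> real)) \<Rightarrow> ('a set \<Rightarrow> real) \<Rightarrow> 'a set \<Rightarrow> real" where
  "dual_operator T Q A = (if A \<in> sets borel then signed_integral Q (T (indicator A)) else 0)"

section \<open>The operator, its semigroup, and their Pareto duals\<close>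

definition drift_operator :: "(real^'n::finite \<Rightarrow> real^'n) \<Rightarrow> (real^'n \<Rightarrow> real) \<Rightarrow> real^'n \<Rightarrow> real" where
  "drift_operator b \<phi> x = (\<Sum>j\<in>UNIV. b x $ j * partial_deriv j \<phi> x)"

definition flow_of :: "('a::real_normed_vector \<Rightarrow> 'a) \<Rightarrow> (real \<Rightarrow> 'a \<Rightarrow> 'a) \<Rightarrow> bool" where
  "flow_of b X \<longleftrightarrow>
     (\<forall>x. X 0 x = x \<and>
        (\<forall>t\<ge>0. ((\<lambda>s. X s x) has_vector_derivative b (X t x)) (at t within {0..})))"

definition flow_semigroup :: "(real \<Rightarrow> 'a \<Rightarrow> 'a) \<Rightarrow> real \<Rightarrow> ('a \<Rightarrow> real) \<Rightarrow> 'a \<Rightarrow> real" where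
  "flow_semigroup X t \<phi> x = \<phi> (X t x)"

text \<open>\<open>L'\<close> on densities, and on signed measures with a density.\<close>
definition dual_drift_density ::
  "(real^'n::finite \<Rightarrow> real^'n) \<Rightarrow> (real^'n \<Rightarrow> real) \<Rightarrow> real^'n \<Rightarrow> real" where
  "dual_drift_density b q x = - (\<Sum>j\<in>UNIV. partial_deriv j (\<lambda>y. b y $ j * q y) x)"

definition dual_drift_operator ::
  "(real^'n::finite \<Rightarrow> real^'n) \<Rightarrow> ((real^'n) set \<Rightarrow> real) \<Rightarrow> (real^'n) set \<Rightarrow> real" where
  "dual_drift_operator b Q = with_density (dual_drift_density b (density_of Q))"

definition pareto_dual_generator ::
  "(real^'n::finite \<Rightarrow> real^'n) \<Rightarrow> (real^'n \<Rightarrow> real) \<Rightarrow> real^'n \<Rightarrow> real" where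
  "pareto_dual_generator b = pareto_F \<circ> dual_drift_operator b \<circ> pareto_F_inv"

definition pareto_dual_semigroup ::
  "(real \<Rightarrow> real^'n::finite \<Rightarrow> real^'n) \<Rightarrow> real \<Rightarrow> (real^'n \<Rightarrow> real) \<Rightarrow> real^'n \<Rightarrow> real" where
  "pareto_dual_semigroup X t = pareto_F \<circ> dual_operator (flow_semigroup X t) \<circ> pareto_F_inv"

section \<open>The integral form of the dual generator and its Cauchy problem\<close>

text \<open>
  \<open>glue j z x\<close> has \<open>j\<close>th coordinate \<open>x\<^sub>j\<close> and all other coordinates from \<open>z\<close>. The vector of the
  other coordinates is a function on \<open>-{j}\<close>, carrying the product Lebesgue measure.
\<close>
definition glue :: "'n::finite \<Rightarrow> ('n \<Rightarrow> real) \<Rightarrow> real^'n \<Rightarrow> real^'n" where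
  "glue j z x = (\<chi> k. if k = j then x $ j else z k)"

definition dual_integral_operator ::
  "(real^'n::{finite,wellorder} \<Rightarrow> real^'n::_) \<Rightarrow> (real^'n::_ \<Rightarrow> real) \<Rightarrow> real^'n::_ \<Rightarrow> real" where
  "dual_integral_operator b g x =
     (-1) ^ CARD('n) *
     (\<Sum>j\<in>UNIV. LINT z : {z. \<forall>k\<in>-{j}. x $ k \<le> z k} | PiM (-{j}) (\<lambda>_. lborel).
        b (glue j z x) $ j * mixed_deriv g (glue j z x))"

text \<open>
  Classical solutions on \<open>[0,\<infinity>)\<close>, with the decay of the density locally uniform in time. If \<open>b\<close> is
  no better than \<open>C\<^sup>1\<close>, the density \<open>F\<inverse> (u t)\<close> of the solution is in general continuous but not
  differentiable for \<open>t > 0\<close>, so \<open>L' (F\<inverse> (u t))\<close> need not be a function; the equation is therefore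
  written with the integral form of the generator, which does not differentiate the density.
\<close>
definition dual_cauchy_solution ::
  "(real^'n::{finite,wellorder} \<Rightarrow> real^'n::_) \<Rightarrow> (real^'n::_ \<Rightarrow> real) \<Rightarrow> (real \<Rightarrow> real^'n::_ \<Rightarrow> real) \<Rightarrow> bool" where
  "dual_cauchy_solution b g u \<longleftrightarrow>
     u 0 = g \<and>
     (\<forall>t\<ge>0. vanishing_boundary_terms (u t)) \<and>
     continuous_on ({0..} \<times> UNIV) (\<lambda>(t, x). mixed_deriv (u t) x) \<and>
     (\<forall>T\<ge>0. \<exists>C. \<exists>p > real CARD('n). \<forall>t\<in>{0..T}. \<forall>x.
        \<bar>mixed_deriv (u t) x\<bar> \<le> C * (1 + norm x) powr (- p)) \<and>
     (\<forall>t\<ge>0. \<forall>x. ((\<lambda>s. u s x) has_real_derivative dual_integral_operator b (u t) x)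
        (at t within {0..}))"

section \<open>Markov processes and Pareto duality\<close>

text \<open>
  A time-homogeneous Markov process is given by the laws \<open>P t x\<close> of its position at time \<open>t\<close> when
  started at \<open>x\<close>.
\<close>
definition markov_transition :: "(real \<Rightarrow> 'a::topological_space \<Rightarrow> 'a measure) \<Rightarrow> bool" where
  "markov_transition P \<longleftrightarrow>
     (\<forall>t\<ge>0. P t \<in> borel \<rightarrow>\<^sub>M prob_algebra borel) \<and>
     (\<forall>x. P 0 x = return borel x) \<and>
     (\<forall>s\<ge>0. \<forall>t\<ge>0. \<forall>x. P (s + t) x = P s x \<bind> P t)"

definition deterministic_process :: "(real \<Rightarrow> 'a \<Rightarrow> 'a) \<Rightarrow> real \<Rightarrow> 'a::topological_space \<Rightarrow> 'a measure" where
  "deterministic_process X t x = return borel (X t x)"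

definition pareto_dual_processes ::
  "(real \<Rightarrow> real^'n::finite \<Rightarrow> (real^'n) measure) \<Rightarrow> (real \<Rightarrow> real^'n \<Rightarrow> (real^'n) measure) \<Rightarrow> bool" where
  "pareto_dual_processes P R \<longleftrightarrow>
     (\<forall>t\<ge>0. \<forall>x y. measure (P t x) {z. y \<le> z} = measure (R t y) {z. z \<le> x})"

end

theory Submission
  imports Defs
begin

text \<open>
  A signed measure is determined by its values on orthants, because these form a \<open>\<pi>\<close>-system. Hence
  \<open>F\<close> is injective, and if \<open>g\<close> has vanishing boundary terms, then \<open>F\<inverse> g\<close> has the density
  \<open>q = (-1)\<^sup>d \<partial>\<^sup>d g / \<partial>z\<^sub>1 \<dots> \<partial>z\<^sub>d\<close>. Integrating \<open>-\<partial>\<^sub>j (b\<^sub>j q)\<close> over an orthant in the variable \<open>z\<^sub>j\<close> leaves the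
  integral of \<open>b\<^sub>j q\<close> over the face \<open>z\<^sub>j = x\<^sub>j\<close>; this is the formula for the dual generator.

  With \<open>Y\<^sub>t\<close> inverse to \<open>X\<^sub>t\<close>, the measure \<open>q dx\<close> is transported by the flow to
  \<open>q\<^sub>t(X\<^sub>t z) = q(z) exp (- \<integral>\<^sub>0\<^sup>t div b(X\<^sub>s z) ds)\<close>. Since \<open>b\<close> is only \<open>C\<^sup>1\<close>, this Liouville formula is obtained from
  the change of variables under the Euler maps \<open>z + h b(z)\<close>, whose Jacobian is \<open>1 + h div b + O(h\<^sup>2)\<close>, and
  not from the variational equation. The density \<open>q\<^sub>t\<close> need not be differentiable, so the equation
  \<open>d/dt F q\<^sub>t = \<Sum>\<^sub>j \<integral> b\<^sub>j q\<^sub>t\<close> (integrals over the faces of the orthant) is verified in a form that is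
  integrated in time and tested against products of functions of one variable.

  For uniqueness, the density \<open>r\<^sub>t\<close> of a solution solves the continuity equation weakly. Mollify \<open>r\<^sub>t\<close> at
  scale \<open>\<epsilon>\<close> around the moving point \<open>X\<^sub>t w\<close> and multiply by \<open>exp (\<integral> div b)\<close>: the time derivative is a
  commutator, which tends to zero with \<open>\<epsilon>\<close> because \<open>\<integral> y\<^sub>i \<partial>\<^sub>j\<rho> dy = - \<delta>\<^sub>i\<^sub>j \<integral> \<rho> dy\<close>. So \<open>r\<^sub>t\<close> obeys the same
  formula as \<open>q\<^sub>t\<close>.

  If \<open>b\<^sub>j\<close> depends on \<open>x\<^sub>j\<close> only, it leaves the integral over the face, and the flows \<open>X\<^sub>t\<close> and \<open>Y\<^sub>t\<close> are
  monotone, so that \<open>y \<le> X\<^sub>t x\<close> if and only if \<open>Y\<^sub>t y \<le> x\<close>. The laws of the dual process are unique since they are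
  determined on the sets \<open>{z. z \<le> x}\<close>.
\<close>

section \<open>Iterated tail integrals\<close>

text \<open>Two obstacles shape the argument. The flow is given for nonnegative times only, so
  backward motion has to be constructed: for small h the displacement X_h - id is a contraction,
  which makes X_h and then every X_t bijective, and the inverse turns out to be the flow of -b with
  the same constants. Moreover, no spatial derivative of the flow or of a transported density is
  ever taken. Jacobians come from Euler maps, whose derivative 1 + h Db is explicit; with h = t/n,
  the product of n determinants differs from the exponential of the integrated divergence by n
  errors of size o(h). For the equation, a tail integral is an iterated integral, so that testing it
  against a product of functions of one variable turns each integrated coordinate into an
  antiderivative. Continuous functions are determined by such tests. A bump is itself the
  antiderivative of a compactly supported function, so the mollifier of the uniqueness proof is one
  of the antiderivative products to which the weak equation applies. Its mass is not normalised; it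
  stays as a factor and cancels at the end.\<close>

lemma Basis_cart: "(Basis :: (real^'n::finite) set) = range (\<lambda>i. axis i 1)"
  by (auto simp: Basis_vec_def)

interpretation lborel_PiM: product_sigma_finite "\<lambda>_. lborel :: real measure" ..

lemma measurable_vec_lambda:
  "(vec_lambda :: ('n::finite \<Rightarrow> real) \<Rightarrow> real^'n) \<in> borel_measurable (PiM UNIV (\<lambda>_. lborel))"
  by (rule borel_measurable_euclidean_space[THEN iffD2]) (auto simp: Basis_vec_def inner_axis)

text \<open>Both measures give a box the product of its side lengths. The product form allows the
  coordinates to be split into any index set and its complement, which is how faces of orthants are
  integrated over.\<close>

lemma lborel_vec: "(lborel :: (real^'n::finite) measure) = distr (PiM UNIV (\<lambda>_. lborel)) borel vec_lambda"
proof (rule lborel_eqI)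
  fix l u :: "real^'n" assume le: "\<And>b. b \<in> Basis \<Longrightarrow> l \<bullet> b \<le> u \<bullet> b"
  have le': "l $ i \<le> u $ i" for i using le[of "axis i 1"] by (simp add: inner_axis)
  have "emeasure (distr (PiM UNIV (\<lambda>_. lborel)) borel vec_lambda) (box l u)
      = emeasure (PiM UNIV (\<lambda>_. lborel)) (Pi\<^sub>E UNIV (\<lambda>i. {l$i<..<u$i}))"
    by (subst emeasure_distr[OF measurable_vec_lambda])
       (auto intro!: arg_cong2[where f=emeasure] simp: mem_box_cart space_PiM PiE_def Pi_def)
  also have "\<dots> = (\<Prod>i\<in>UNIV. ennreal (u$i - l$i))"
    by (subst lborel_PiM.emeasure_PiM) (auto simp: le')
  also have "\<dots> = ennreal (\<Prod>i\<in>UNIV. u$i - l$i)"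
    by (rule prod_ennreal) (simp add: le')
  also have "(\<Prod>i\<in>UNIV. u$i - l$i) = (\<Prod>b\<in>Basis. (u - l) \<bullet> b)"
    unfolding Basis_cart by (subst prod.reindex) (auto simp: inner_axis inj_on_def axis_eq_axis)
  finally show "emeasure (distr (PiM UNIV (\<lambda>_. lborel)) borel vec_lambda) (box l u) = (\<Prod>b\<in>Basis. (u - l) \<bullet> b)" .
qed simp

lemma integral_lborel_vec:
  fixes f :: "real^'n::finite \<Rightarrow> real"
  assumes "f \<in> borel_measurable borel"
  shows "integral\<^sup>L lborel f = (\<integral>z. f (vec_lambda z) \<partial>PiM UNIV (\<lambda>_. lborel))"
  unfolding lborel_vec by (rule integral_distr[OF measurable_vec_lambda assms])

lemma integrable_lborel_vec:
  fixes f :: "real^'n::finite \<Rightarrow> real"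
  assumes "f \<in> borel_measurable borel"
  shows "integrable lborel f \<longleftrightarrow> integrable (PiM UNIV (\<lambda>_. lborel)) (\<lambda>z. f (vec_lambda z))"
  unfolding lborel_vec by (rule integrable_distr_eq[OF measurable_vec_lambda assms])

section \<open>Integrable power weights of one variable\<close>

definition weight :: "real \<Rightarrow> real \<Rightarrow> real" where
  "weight a s = (1 + \<bar>s\<bar>) powr (- a)"

lemma weight_pos [simp]: "0 < weight a s" "0 \<le> weight a s"
  by (auto simp: weight_def)

lemma weight_le_1: "0 \<le> a \<Longrightarrow> weight a s \<le> 1"
  using powr_mono[of "- a" 0 "1 + \<bar>s\<bar>"] by (simp add: weight_def add_pos_nonneg less_imp_neq[symmetric] split: if_splits)

lemma weight_measurable [measurable]: "weight a \<in> borel_measurable borel"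
  unfolding weight_def by measurable

lemma weight_integrable:
  assumes a: "1 < a" shows "integrable lborel (weight a)"
proof -
  \<comment> \<open>An antiderivative of the weight on the right half-line; it vanishes at infinity
    because \<open>1 < a\<close>.\<close>
  let ?F = "\<lambda>x. (1 + x) powr (1 - a) / (1 - a)"
  have lim: "(?F \<longlongrightarrow> 0) at_top" using a by real_asymp
  have "(\<integral>\<^sup>+x. ennreal (weight a x) * indicator {0..} x \<partial>lborel) = ennreal (0 - ?F 0)"
    using a by (intro nn_integral_FTC_atLeast lim)
      (auto simp: weight_def intro!: derivative_eq_intros)
  then have fin: "(\<integral>\<^sup>+x. ennreal (norm (weight a x * indicator {0..} x)) \<partial>lborel) < \<infinity>"
    by (subst (asm) nn_integral_cong[of _ _ "\<lambda>x. ennreal (norm (weight a x * indicator {0..} x))"])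
       (auto simp: indicator_def)
  have I: "integrable lborel (\<lambda>x. weight a x * indicator {0..} x)"
    using fin by (intro integrableI_bounded) auto
  \<comment> \<open>The left half-line follows by the reflection s to -s, since the weight is
    even.\<close>
  have I': "integrable lborel (\<lambda>x. weight a (0 + (-1) * x) * indicator {0..} (0 + (-1) * x))"
    by (rule lborel_integrable_real_affine[OF I, of "-1" 0]) simp
  show ?thesis
    by (rule Bochner_Integration.integrable_bound[OF Bochner_Integration.integrable_add[OF I I']])
       (auto simp: weight_def indicator_def)
qed

lemma prod_weight_integrable:
  fixes J :: "'n::finite set"
  assumes "1 < a"
  shows "integrable (PiM J (\<lambda>_. lborel)) (\<lambda>z. \<Prod>k\<in>J. weight a (z k))"
  by (rule lborel_PiM.product_integrable_prod) (auto intro: weight_integrable assms)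

section \<open>Integrals over orthants in some of the coordinates\<close>

definition overwrite :: "'n set \<Rightarrow> ('n \<Rightarrow> real) \<Rightarrow> real^'n \<Rightarrow> real^'n::finite" where
  "overwrite J z x = (\<chi> k. if k \<in> J then z k else x $ k)"

definition orthant :: "'n set \<Rightarrow> real^'n \<Rightarrow> ('n::finite \<Rightarrow> real) set" where
  "orthant J x = {z. \<forall>k\<in>J. x $ k \<le> z k}"

text \<open>
  The integral over the coordinates in \<open>J\<close> only, the others being fixed: \<open>tail UNIV q = F (q dx)\<close>, and \<open>tail (-{j}) q\<close>
  integrates over a face of the orthant.
\<close>

definition tail :: "'n set \<Rightarrow> (real^'n \<Rightarrow> real) \<Rightarrow> real^'n::finite \<Rightarrow> real" where
  "tail J q x = (LINT z:orthant J x|PiM J (\<lambda>_. lborel). q (overwrite J z x))"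

definition upd :: "real^'n \<Rightarrow> 'n \<Rightarrow> real \<Rightarrow> real^'n::finite" where
  "upd x i s = (\<chi> k. if k = i then s else x $ k)"

lemma upd_nth [simp]: "upd x i s $ k = (if k = i then s else x $ k)"
  by (simp add: upd_def)

lemma upd_same [simp]: "upd x i (x $ i) = x"
  by (simp add: upd_def vec_eq_iff)

lemma upd_upd [simp]: "upd (upd x i s) i t = upd x i t"
  by (simp add: upd_def vec_eq_iff)

lemma add_axis_upd: "x + s *\<^sub>R axis i 1 = upd x i (x $ i + s)"
  by (simp add: upd_def vec_eq_iff axis_def)

lemma overwrite_nth [simp]: "overwrite J z x $ k = (if k \<in> J then z k else x $ k)"
  by (simp add: overwrite_def)

lemma overwrite_UNIV [simp]: "overwrite UNIV z x = vec_lambda z"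
  by (simp add: overwrite_def)

lemma continuous_upd [continuous_intros]: "continuous_on S g \<Longrightarrow> continuous_on S f \<Longrightarrow> continuous_on S (\<lambda>s. upd (g s) i (f s))"
  unfolding upd_def by (intro continuous_on_vec_lambda, case_tac "k = i") (auto intro: continuous_intros)

lemma overwrite_measurable [measurable]:
  fixes J :: "'n::finite set"
  shows "(\<lambda>z. overwrite J z x) \<in> borel_measurable (PiM J (\<lambda>_. lborel))"
proof -
  have "(\<lambda>z. if k \<in> J then z k else x $ k) \<in> borel_measurable (PiM J (\<lambda>_. lborel))" for k
    by (cases "k \<in> J") auto
  then show ?thesis
    by (intro borel_measurable_euclidean_space[THEN iffD2]) (auto simp: Basis_vec_def inner_axis)
qed

lemma orthant_measurable [measurable]:
  fixes J :: "'n::finite set"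
  shows "(\<lambda>z. indicator (orthant J x) z :: real) \<in> borel_measurable (PiM J (\<lambda>_. lborel))"
  unfolding orthant_def by measurable

text \<open>The set is a box with one side reduced to a point. It is the exceptional set on which
  the indicator of a moving orthant may fail to converge.\<close>

lemma AE_PiM_component_neq:
  fixes J :: "'n::finite set"
  assumes "k \<in> J"
  shows "AE z in PiM J (\<lambda>_. lborel). z k \<noteq> (c::real)"
proof (rule AE_I)
  let ?A = "Pi\<^sub>E J (\<lambda>i. if i = k then {c} else UNIV)"
  show "{z \<in> space (PiM J (\<lambda>_. lborel)). \<not> z k \<noteq> c} \<subseteq> ?A"
    using assms by (auto simp: space_PiM PiE_def)
  have "emeasure (PiM J (\<lambda>_. lborel)) ?A = (\<Prod>i\<in>J. emeasure lborel (if i = k then {c} else UNIV))"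
    by (rule lborel_PiM.emeasure_PiM) auto
  also have "\<dots> = 0" using assms by (intro prod_zero) auto
  finally show "emeasure (PiM J (\<lambda>_. lborel)) ?A = 0" .
  show "?A \<in> sets (PiM J (\<lambda>_. lborel))" by (rule sets_PiM_I_finite) auto
qed

lemma orthant_indicator_eventually:
  fixes x :: "nat \<Rightarrow> real^'n::finite"
  assumes x: "x \<longlonglongrightarrow> l" and ne: "\<forall>k\<in>J. z k \<noteq> l $ k"
  shows "\<forall>\<^sub>F n in sequentially. (indicator (orthant J (x n)) z :: real) = indicator (orthant J l) z"
proof -
  have "\<forall>\<^sub>F n in sequentially. \<forall>k\<in>J. (x n $ k \<le> z k) = (l $ k \<le> z k)"
  proof (rule eventually_ball_finite)
    show "\<forall>k\<in>J. \<forall>\<^sub>F n in sequentially. (x n $ k \<le> z k) = (l $ k \<le> z k)"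
    proof
      fix k assume "k \<in> J"
      have t: "(\<lambda>n. x n $ k) \<longlonglongrightarrow> l $ k" by (rule tendsto_vec_nth[OF x])
      consider "l $ k < z k" | "z k < l $ k" using ne \<open>k \<in> J\<close> by fastforce
      then show "\<forall>\<^sub>F n in sequentially. (x n $ k \<le> z k) = (l $ k \<le> z k)"
      proof cases
        case 1 from order_tendstoD(2)[OF t 1] show ?thesis using 1 by (auto elim!: eventually_mono)
      next
        case 2 from order_tendstoD(1)[OF t 2] show ?thesis using 2 by (auto elim!: eventually_mono)
      qed
    qed
  qed simp
  then show ?thesis by (auto elim!: eventually_mono simp: orthant_def indicator_def)
qed

text \<open>Dominated convergence with the orthant and the integrand both moving: indicators
  converge off the null hyperplanes \<open>z k = l $ k\<close>, and the product of weights
  dominates. Continuity of \<open>tail\<close> in space and of \<open>flux\<close> in space and time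
  both rest on this.\<close>

lemma orthant_integral_tendsto:
  fixes x :: "nat \<Rightarrow> real^'n::finite" and f :: "nat \<Rightarrow> ('n \<Rightarrow> real) \<Rightarrow> real"
  assumes x: "x \<longlonglongrightarrow> l" and a: "1 < a"
    and f: "\<And>n. f n \<in> borel_measurable (PiM J (\<lambda>_. lborel))"
    and bd: "\<And>n z. \<bar>f n z\<bar> \<le> C * (\<Prod>k\<in>J. weight a (z k))"
    and lim: "\<And>z. (\<lambda>n. f n z) \<longlonglongrightarrow> f' z"
  shows "(\<lambda>n. LINT z:orthant J (x n)|PiM J (\<lambda>_. lborel). f n z)
     \<longlonglongrightarrow> (LINT z:orthant J l|PiM J (\<lambda>_. lborel). f' z)"
  unfolding set_lebesgue_integral_def
proof (rule integral_dominated_convergence[where w="\<lambda>z. C * (\<Prod>k\<in>J. weight a (z k))"])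
  note f[measurable]
  have [measurable]: "f' \<in> borel_measurable (PiM J (\<lambda>_. lborel))"
    by (rule borel_measurable_LIMSEQ_real[OF lim f])
  show "(\<lambda>z. indicator (orthant J l) z *\<^sub>R f' z) \<in> borel_measurable (PiM J (\<lambda>_. lborel))" by measurable
  show "(\<lambda>z. indicator (orthant J (x n)) z *\<^sub>R f n z) \<in> borel_measurable (PiM J (\<lambda>_. lborel))" for n by measurable
  show "integrable (PiM J (\<lambda>_. lborel)) (\<lambda>z. C * (\<Prod>k\<in>J. weight a (z k)))"
    by (intro integrable_mult_right prod_weight_integrable a)
  have "AE z in PiM J (\<lambda>_. lborel). \<forall>k\<in>J. z k \<noteq> l $ k"
    by (intro AE_finite_allI AE_PiM_component_neq) auto
  then show "AE z in PiM J (\<lambda>_. lborel). (\<lambda>n. indicator (orthant J (x n)) z *\<^sub>R f n z) \<longlonglongrightarrow> indicator (orthant J l) z *\<^sub>R f' z"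
  proof eventually_elim
    case (elim z)
    have "(\<lambda>n. indicator (orthant J (x n)) z :: real) \<longlonglongrightarrow> indicator (orthant J l) z"
      by (rule tendsto_eventually[OF orthant_indicator_eventually[OF x elim]])
    then show ?case by (intro tendsto_scaleR lim)
  qed
  show "AE z in PiM J (\<lambda>_. lborel). norm (indicator (orthant J (x n)) z *\<^sub>R f n z) \<le> C * (\<Prod>k\<in>J. weight a (z k))" for n
  proof (rule AE_I2)
    fix z 
    have "0 \<le> C * (\<Prod>k\<in>J. weight a (z k))" using bd[of n z] by linarith
    then show "norm (indicator (orthant J (x n)) z *\<^sub>R f n z) \<le> C * (\<Prod>k\<in>J. weight a (z k))"
      using bd[of n z] by (auto simp: indicator_def)
  qed
qed

text \<open>
  A bound by a product of integrable functions of one variable, unlike one by a power of the norm,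
  passes to every face by setting weights equal to their bound 1, and to integrals over the remaining coordinates.
\<close>

definition weight_bounded :: "real \<Rightarrow> real \<Rightarrow> (real^'n::finite \<Rightarrow> real) \<Rightarrow> bool" where
  "weight_bounded a C q \<longleftrightarrow> 1 < a \<and> (\<forall>x. \<bar>q x\<bar> \<le> C * (\<Prod>k\<in>UNIV. weight a (x $ k)))"

lemma powr_eq_prod_powr:
  fixes r :: real
  assumes "0 < r" shows "r powr (- p) = (\<Prod>k\<in>(UNIV::'n::finite set). r powr (- (p / real CARD('n))))"
  using assms by (simp add: powr_realpow[symmetric] powr_powr)

text \<open>Each \<open>1 + \<bar>x $ k\<bar>\<close> is at most \<open>1 + norm x\<close>, and d
  weights of exponent p/d multiply to the exponent p. The condition p > d is exactly integrability
  of the single weight.\<close>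

lemma powr_decay_weight_bounded:
  fixes q :: "real^'n::finite \<Rightarrow> real"
  assumes p: "real CARD('n) < p" and q: "\<And>x. \<bar>q x\<bar> \<le> C * (1 + norm x) powr (- p)"
  shows "weight_bounded (p / real CARD('n)) C q"
  unfolding weight_bounded_def
proof (intro conjI allI)
  let ?d = "real CARD('n)" let ?a = "p / ?d"
  have d: "?d > 0" by simp
  show "1 < ?a" using p d by (simp add: less_divide_eq)
  fix x :: "real^'n"
  have "0 \<le> C" using q[of 0] by auto
  have "(1 + norm x) powr (- p) = (\<Prod>k\<in>(UNIV::'n set). (1 + norm x) powr (- ?a))"
    by (rule powr_eq_prod_powr) (use norm_ge_zero[of x] in linarith)
  also have "\<dots> \<le> (\<Prod>k\<in>UNIV. weight ?a (x $ k))"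
    unfolding weight_def using component_le_norm_cart[of x] p d
    by (intro prod_mono conjI powr_mono2') (auto simp: divide_nonneg_pos intro: add_pos_nonneg)
  finally show "\<bar>q x\<bar> \<le> C * (\<Prod>k\<in>UNIV. weight ?a (x $ k))"
    using q[of x] mult_left_mono[OF _ \<open>0 \<le> C\<close>] by (meson order_trans)
qed

lemma weight_boundedD:
  fixes q :: "real^'a::finite \<Rightarrow> real"
  assumes "weight_bounded a C q" shows "1 < a" "0 \<le> C" "\<bar>q x\<bar> \<le> C * (\<Prod>k\<in>UNIV. weight a (x $ k))"
proof -
  show "1 < a" "\<bar>q x\<bar> \<le> C * (\<Prod>k\<in>UNIV. weight a (x $ k))" using assms by (auto simp: weight_bounded_def)
  \<comment> \<open>All weights are 1 at the origin, so the bound there fixes the sign of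
    \<open>C\<close>.\<close>
  have "\<bar>q 0\<bar> \<le> C * (\<Prod>k\<in>UNIV. weight a ((0::real^'a) $ k))" using assms unfolding weight_bounded_def by blast
  then show "0 \<le> C" by (simp add: weight_def)
qed

lemma weight_bounded_overwrite:
  fixes q :: "real^'n::finite \<Rightarrow> real"
  assumes "weight_bounded a C q"
  shows "\<bar>q (overwrite J z x)\<bar> \<le> C * (\<Prod>k\<in>-J. weight a (x $ k)) * (\<Prod>k\<in>J. weight a (z k))"
proof -
  have "(\<Prod>k\<in>UNIV. weight a (overwrite J z x $ k)) = (\<Prod>k\<in>-J. weight a (overwrite J z x $ k)) * (\<Prod>k\<in>J. weight a (overwrite J z x $ k))"
    by (subst prod.union_disjoint[symmetric]) (auto intro!: arg_cong2[where f=prod])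
  also have "\<dots> = (\<Prod>k\<in>-J. weight a (x $ k)) * (\<Prod>k\<in>J. weight a (z k))"
    by (intro arg_cong2[where f="(*)"] prod.cong) auto
  finally show ?thesis using weight_boundedD(3)[OF assms, of "overwrite J z x"] by (simp add: mult.assoc)
qed

lemma prod_weight_le_1: "1 < a \<Longrightarrow> (\<Prod>k\<in>J. weight a (f k)) \<le> 1"
  by (rule prod_le_1) (auto simp: weight_le_1)

lemma weight_bounded_overwrite':
  fixes q :: "real^'n::finite \<Rightarrow> real"
  assumes "weight_bounded a C q"
  shows "\<bar>q (overwrite J z x)\<bar> \<le> C * (\<Prod>k\<in>J. weight a (z k))"
proof -
  have "C * (\<Prod>k\<in>-J. weight a (x $ k)) \<le> C * 1"
    using weight_boundedD[OF assms] by (intro mult_left_mono prod_weight_le_1) auto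
  then have "C * (\<Prod>k\<in>-J. weight a (x $ k)) * (\<Prod>k\<in>J. weight a (z k)) \<le> C * 1 * (\<Prod>k\<in>J. weight a (z k))"
    by (rule mult_right_mono) (auto intro: prod_nonneg)
  with weight_bounded_overwrite[OF assms, of J z x] show ?thesis by simp
qed

lemma overwrite_integrable:
  fixes q :: "real^'n::finite \<Rightarrow> real"
  assumes [measurable]: "q \<in> borel_measurable borel" and wb: "weight_bounded a C q"
  shows "integrable (PiM J (\<lambda>_. lborel)) (\<lambda>z. q (overwrite J z x))"
proof (rule Bochner_Integration.integrable_bound)
  show "integrable (PiM J (\<lambda>_. lborel)) (\<lambda>z. C * (\<Prod>k\<in>J. weight a (z k)))"
    by (intro integrable_mult_right prod_weight_integrable weight_boundedD(1)[OF wb])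
  show "(\<lambda>z. q (overwrite J z x)) \<in> borel_measurable (PiM J (\<lambda>_. lborel))" by measurable
  show "AE z in PiM J (\<lambda>_. lborel). norm (q (overwrite J z x)) \<le> norm (C * (\<Prod>k\<in>J. weight a (z k)))"
    unfolding real_norm_def by (intro AE_I2 order_trans[OF weight_bounded_overwrite'[OF wb] abs_ge_self])
qed

lemma weight_bounded_integrable:
  fixes q :: "real^'n::finite \<Rightarrow> real"
  assumes [measurable]: "q \<in> borel_measurable borel" and wb: "weight_bounded a C q"
  shows "integrable lborel q"
  unfolding integrable_lborel_vec[OF assms(1)] using overwrite_integrable[OF assms, of UNIV] by simp

lemma tail_integrable:
  fixes q :: "real^'n::finite \<Rightarrow> real"
  assumes [measurable]: "q \<in> borel_measurable borel" and wb: "weight_bounded a C q"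
  shows "integrable (PiM J (\<lambda>_. lborel)) (\<lambda>z. indicator (orthant J x) z * q (overwrite J z x))"
proof (rule Bochner_Integration.integrable_bound[OF overwrite_integrable[OF assms]])
  show "(\<lambda>z. indicator (orthant J x) z * q (overwrite J z x)) \<in> borel_measurable (PiM J (\<lambda>_. lborel))"
    by measurable
qed (auto simp: indicator_def)

lemma tail_bound:
  fixes q :: "real^'n::finite \<Rightarrow> real"
  assumes [measurable]: "q \<in> borel_measurable borel" and wb: "weight_bounded a C q"
  shows "\<bar>tail J q x\<bar> \<le> C * (\<Prod>k\<in>-J. weight a (x $ k)) * (\<integral>z. (\<Prod>k\<in>J. weight a (z k)) \<partial>PiM J (\<lambda>_. lborel))"
proof -
  have "\<bar>tail J q x\<bar> \<le> (\<integral>z. C * (\<Prod>k\<in>-J. weight a (x $ k)) * (\<Prod>k\<in>J. weight a (z k)) \<partial>PiM J (\<lambda>_. lborel))"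
    unfolding tail_def set_lebesgue_integral_def real_norm_def[symmetric]
  proof (rule order_trans[OF integral_norm_bound integral_mono])
    show "integrable (PiM J (\<lambda>_. lborel)) (\<lambda>z. norm (indicator (orthant J x) z *\<^sub>R q (overwrite J z x)))"
      unfolding real_scaleR_def real_norm_def by (rule integrable_abs[OF tail_integrable[OF assms]])
    show "integrable (PiM J (\<lambda>_. lborel)) (\<lambda>z. C * (\<Prod>k\<in>-J. weight a (x $ k)) * (\<Prod>k\<in>J. weight a (z k)))"
      by (intro integrable_mult_right prod_weight_integrable weight_boundedD(1)[OF wb])
    show "norm (indicator (orthant J x) z *\<^sub>R q (overwrite J z x)) \<le> C * (\<Prod>k\<in>-J. weight a (x $ k)) * (\<Prod>k\<in>J. weight a (z k))" for z
      using weight_bounded_overwrite[OF wb, of J z x] abs_ge_zero[of "q (overwrite J z x)"]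
      by (auto simp: indicator_def simp del: abs_ge_zero)
  qed
  then show ?thesis by simp
qed

lemma tail_empty [simp]: "tail {} q x = q x"
proof -
  have "overwrite {} z x = x" for z by (simp add: vec_eq_iff)
  then show ?thesis
    by (simp add: tail_def set_lebesgue_integral_def orthant_def PiM_empty lebesgue_integral_count_space_finite)
qed

lemma tail_cmult: "tail J (\<lambda>x. c * q x) x = c * tail J q x"
  unfolding tail_def set_lebesgue_integral_def by (simp add: mult.left_commute)

text \<open>Fubini with \<open>i\<close> as the outer variable. Through this, derivatives and limits
  of a tail in the direction \<open>i\<close> become statements about an upper integral on the
  line.\<close>

lemma tail_insert:
  fixes q :: "real^'n::finite \<Rightarrow> real"
  assumes [measurable]: "q \<in> borel_measurable borel" and wb: "weight_bounded a C q" and i: "i \<notin> J"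
  shows "tail (insert i J) q x = (LINT s:{x $ i..}|lborel. tail J q (upd x i s))"
proof -
  let ?f = "\<lambda>z. indicator (orthant (insert i J) x) z * q (overwrite (insert i J) z x)"
  have int: "integrable (PiM ({i} \<union> J) (\<lambda>_. lborel)) ?f" using tail_integrable[OF assms(1,2), of "insert i J" x] by simp
  have sw: "?f (merge {i} J (y, z)) = indicator {x $ i..} (y i) * (indicator (orthant J (upd x i (y i))) z * q (overwrite J z (upd x i (y i))))"
    for y z :: "'n \<Rightarrow> real"
  proof -
    have "overwrite (insert i J) (merge {i} J (y, z)) x = overwrite J z (upd x i (y i))"
      using i by (auto simp: vec_eq_iff merge_def)
    moreover have "(indicator (orthant (insert i J) x) (merge {i} J (y, z)) :: real)
       = indicator {x $ i..} (y i) * indicator (orthant J (upd x i (y i))) z"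
      using i by (auto simp: orthant_def indicator_def merge_def)
    ultimately show ?thesis by simp
  qed
  have meas: "(\<lambda>s. indicator {x $ i..} s * tail J q (upd x i s)) \<in> borel_measurable lborel"
  proof -
    have "(\<lambda>s. tail J q (upd x i s)) \<in> borel_measurable borel"
    proof -
      interpret J: sigma_finite_measure "PiM J (\<lambda>_. lborel :: real measure)" by (rule lborel_PiM.sigma_finite) simp
      \<comment> \<open>As \<open>i\<close> is not in \<open>J\<close>, the orthant does not see the
        value at \<open>i\<close>; with a fixed orthant, measurability in \<open>s\<close> is that
        of a parameter integral.\<close>
      have eq: "tail J q (upd x i s) = (\<integral>z. indicator (orthant J x) z * q (overwrite J z (upd x i s)) \<partial>PiM J (\<lambda>_. lborel))" for s
        using i unfolding tail_def set_lebesgue_integral_def orthant_def by (intro Bochner_Integration.integral_cong) (auto simp: indicator_def)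
      have 1: "(\<lambda>p. overwrite J (snd p) (upd x i (fst p))) \<in> borel_measurable (borel \<Otimes>\<^sub>M PiM J (\<lambda>_. lborel))"
      proof -
        have "(\<lambda>p. if k \<in> J then snd p k else upd x i (fst p) $ k) \<in> borel_measurable (borel \<Otimes>\<^sub>M PiM J (\<lambda>_. lborel))" for k
          by (cases "k \<in> J"; cases "k = i") auto
        then show ?thesis
          by (intro borel_measurable_euclidean_space[THEN iffD2]) (auto simp: Basis_vec_def inner_axis)
      qed
      have "(\<lambda>s. \<integral>z. indicator (orthant J x) z * q (overwrite J z (upd x i s)) \<partial>PiM J (\<lambda>_. lborel)) \<in> borel_measurable borel"
        using 1 by measurable
      then show ?thesis by (simp add: eq)
    qed
    then show ?thesis by measurable
  qed
  have "tail (insert i J) q x = (\<integral>z. ?f z \<partial>PiM ({i} \<union> J) (\<lambda>_. lborel))"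
    by (simp add: tail_def set_lebesgue_integral_def)
  also have "\<dots> = (\<integral>y. (\<integral>z. ?f (merge {i} J (y, z)) \<partial>PiM J (\<lambda>_. lborel)) \<partial>PiM {i} (\<lambda>_. lborel))"
    by (rule lborel_PiM.product_integral_fold[OF _ _ _ int]) (use i in auto)
  also have "\<dots> = (\<integral>y. indicator {x $ i..} (y i) * tail J q (upd x i (y i)) \<partial>PiM {i} (\<lambda>_. lborel))"
    by (simp add: sw tail_def set_lebesgue_integral_def)
  also have "\<dots> = (LINT s:{x $ i..}|lborel. tail J q (upd x i s))"
    using lborel_PiM.product_integral_singleton[OF meas] by (simp add: set_lebesgue_integral_def)
  finally show ?thesis .
qed

lemma tail_UNIV:
  fixes q :: "real^'n::finite \<Rightarrow> real"
  assumes [measurable]: "q \<in> borel_measurable borel"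
  shows "tail UNIV q x = (LINT y:{y. x \<le> y}|lborel. q y)"
proof -
  have [measurable]: "{y. x \<le> y} \<in> sets borel"
    using closed_eucl_atLeast[of x] by (auto simp: atLeast_def intro: borel_closed)
  show ?thesis
    unfolding tail_def set_lebesgue_integral_def
    by (subst integral_lborel_vec) (auto simp: orthant_def less_eq_vec_def indicator_def intro!: Bochner_Integration.integral_cong)
qed

lemma tail_tendsto:
  fixes q :: "nat \<Rightarrow> real^'n::finite \<Rightarrow> real"
  assumes "\<And>n. q n \<in> borel_measurable borel" "\<And>n. weight_bounded a C (q n)" "x \<longlonglongrightarrow> l"
    and "\<And>z. (\<lambda>n. q n (overwrite J z (x n))) \<longlonglongrightarrow> q' (overwrite J z l)"
  shows "(\<lambda>n. tail J (q n) (x n)) \<longlonglongrightarrow> tail J q' l"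
  unfolding tail_def
  by (rule orthant_integral_tendsto[OF assms(3) weight_boundedD(1)[OF assms(2)] _ weight_bounded_overwrite'[OF assms(2)] assms(4)])
     (use assms(1) in measurable)

lemma overwrite_tendsto: "x \<longlonglongrightarrow> l \<Longrightarrow> (\<lambda>n. overwrite J z (x n)) \<longlonglongrightarrow> overwrite J z l"
  unfolding overwrite_def by (intro tendsto_vec_lambda) (auto intro: tendsto_vec_nth)

lemma tail_continuous:
  fixes q :: "real^'n::finite \<Rightarrow> real"
  assumes q: "continuous_on UNIV q" and wb: "weight_bounded a C q"
  shows "continuous_on UNIV (tail J q)"
proof -
  have "isCont q x" for x using q by (simp add: continuous_on_eq_continuous_at)
  then show ?thesis
    unfolding continuous_on_sequentially comp_def
    by (auto intro!: tail_tendsto[OF _ wb] isCont_tendsto_compose[of _ q] overwrite_tendsto borel_measurable_continuous_onI q)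
qed

lemma tail_line:
  fixes q :: "real^'n::finite \<Rightarrow> real"
  assumes q: "continuous_on UNIV q" and wb: "weight_bounded a C q" and i: "i \<notin> J"
  shows "continuous_on UNIV (\<lambda>s. tail J q (upd x i s))" "integrable lborel (\<lambda>s. tail J q (upd x i s))"
proof -
  note [measurable] = borel_measurable_continuous_onI[OF q]
  show c: "continuous_on UNIV (\<lambda>s. tail J q (upd x i s))"
    by (rule continuous_on_compose2[OF tail_continuous[OF q wb]]) (auto intro!: continuous_intros)
  have [measurable]: "(\<lambda>s. tail J q (upd x i s)) \<in> borel_measurable borel"
    by (rule borel_measurable_continuous_onI[OF c])
  let ?I = "\<integral>z. (\<Prod>k\<in>J. weight a (z k)) \<partial>PiM J (\<lambda>_. lborel)"
  have I: "0 \<le> ?I" by (intro integral_nonneg_AE AE_I2 prod_nonneg) auto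
  show "integrable lborel (\<lambda>s. tail J q (upd x i s))"
  proof (rule Bochner_Integration.integrable_bound[OF integrable_mult_right[OF weight_integrable[OF weight_boundedD(1)[OF wb]], of "C * ?I"]])
    show "AE s in lborel. norm (tail J q (upd x i s)) \<le> norm (C * ?I * weight a s)"
    proof (rule AE_I2)
      fix s
      \<comment> \<open>The weight at \<open>i\<close> survives because \<open>i\<close> is outside
        \<open>J\<close>, and it supplies the integrable majorant in \<open>s\<close>; the remaining
        frozen weights are at most 1.\<close>
      have "(\<Prod>k\<in>-J. weight a (upd x i s $ k)) = weight a s * (\<Prod>k\<in>-J-{i}. weight a (upd x i s $ k))"
        using i by (subst prod.remove[of _ i]) auto
      also have "\<dots> \<le> weight a s * 1"
        using weight_boundedD[OF wb] by (intro mult_left_mono prod_weight_le_1) auto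
      finally have "C * (\<Prod>k\<in>-J. weight a (upd x i s $ k)) * ?I \<le> C * weight a s * ?I"
        using weight_boundedD[OF wb] I by (intro mult_right_mono mult_left_mono) auto
      with tail_bound[OF _ wb, of J "upd x i s"] show "norm (tail J q (upd x i s)) \<le> norm (C * ?I * weight a s)"
        using weight_boundedD[OF wb] I by (simp add: abs_mult mult_ac)
    qed
  qed measurable
qed

section \<open>Differentiation of tail integrals and recovery from the mixed derivative\<close>

lemma upper_integral:
  fixes h :: "real \<Rightarrow> real"
  assumes c: "continuous_on UNIV h" and int: "integrable lborel h"
  shows "((\<lambda>y. LINT s:{y..}|lborel. h s) has_real_derivative - h y) (at y)"
    and "((\<lambda>y. LINT s:{y..}|lborel. h s) \<longlongrightarrow> 0) at_top"
proof -
  have si: "set_integrable lborel A h" if "A \<in> sets borel" for A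
    using that int unfolding set_integrable_def by (intro integrable_mult_indicator) auto
  \<comment> \<open>With the fixed left end \<open>y - 1\<close>, the upper integral is near
    \<open>y\<close> a constant minus an ordinary interval integral.\<close>
  have eq: "(LINT s:{t..}|lborel. h s) = (LINT s:{y-1..}|lborel. h s) - integral {y-1..t} h" if "t \<in> {y-1<..}" for t
  proof -
    have "(LINT s:{y-1..}|lborel. h s) = (LINT s:{y-1..<t} \<union> {t..}|lborel. h s)"
      using that by (intro arg_cong[where f="\<lambda>A. LINT s:A|lborel. h s"]) auto
    also have "\<dots> = (LINT s:{y-1..<t}|lborel. h s) + (LINT s:{t..}|lborel. h s)"
      by (rule set_integral_Un) (auto intro: si)
    also have "(LINT s:{y-1..<t}|lborel. h s) = (LINT s:{y-1..t}|lborel. h s)"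
    proof (rule set_integral_cong_set)
      show "AE x in lborel. (x \<in> {y-1..t}) = (x \<in> {y-1..<t})"
        using AE_lborel_singleton[of t] by eventually_elim auto
    qed (use si in \<open>auto simp: set_borel_measurable_def set_integrable_def\<close>)
    also have "(LINT s:{y-1..t}|lborel. h s) = integral {y-1..t} h"
      by (rule set_borel_integral_eq_integral(2)) (auto intro: si)
    finally show ?thesis by simp
  qed
  have "((\<lambda>t. integral {y-1..t} h) has_real_derivative h y) (at y within {y-1..y+1})"
    by (rule integral_has_real_derivative) (auto intro: continuous_on_subset[OF c])
  then have "((\<lambda>t. integral {y-1..t} h) has_real_derivative h y) (at y)"
    by (subst (asm) at_within_Icc_at) auto
  then have d: "((\<lambda>t. (LINT s:{y-1..}|lborel. h s) - integral {y-1..t} h) has_real_derivative - h y) (at y)"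
    by (auto intro!: derivative_eq_intros)
  show "((\<lambda>y. LINT s:{y..}|lborel. h s) has_real_derivative - h y) (at y)"
    by (rule has_field_derivative_transform_within_open[OF d, of "{y-1<..}"]) (simp_all add: eq[symmetric])
  have "((\<lambda>t. \<integral>s. indicator {t..} s *\<^sub>R h s \<partial>lborel) \<longlongrightarrow> integral\<^sup>L (lborel :: real measure) (\<lambda>_. 0 :: real)) at_top"
  proof (rule integral_dominated_convergence_at_top[where w="\<lambda>s. norm (h s)"])
    show "AE x in lborel. ((\<lambda>i. indicator {i..} x *\<^sub>R h x) \<longlongrightarrow> 0) at_top"
    proof (rule AE_I2)
      fix x :: real
      show "((\<lambda>i. indicator {i..} x *\<^sub>R h x) \<longlongrightarrow> 0) at_top"
        by (intro tendsto_eventually eventually_mono[OF eventually_gt_at_top[of x]]) auto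
    qed
  qed (use int in \<open>auto simp: indicator_def\<close>)
  then show "((\<lambda>y. LINT s:{y..}|lborel. h s) \<longlongrightarrow> 0) at_top"
    by (simp add: set_lebesgue_integral_def)
qed

lemma tail_line_derivative:
  fixes q :: "real^'n::finite \<Rightarrow> real"
  assumes q: "continuous_on UNIV q" and wb: "weight_bounded a C q" and i: "i \<notin> J"
  shows "((\<lambda>s. tail (insert i J) q (upd x i s)) has_real_derivative - tail J q (upd x i s)) (at s)"
    and "((\<lambda>s. tail (insert i J) q (upd x i s)) \<longlongrightarrow> 0) at_top"
  using upper_integral[OF tail_line[OF q wb i, of x]] tail_insert[OF borel_measurable_continuous_onI[OF q] wb i]
  by simp_all

lemma upd_line_derivative:
  "((\<lambda>s. f (x + s *\<^sub>R axis i 1)) has_real_derivative D) (at 0) \<longleftrightarrow>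
   ((\<lambda>s. f (upd x i s)) has_real_derivative D) (at (x $ i))"
  using DERIV_shift[of "\<lambda>s. f (upd x i s)" D 0 "x $ i"] by (simp add: add_axis_upd add.commute)

lemma partial_derivI: "((\<lambda>s. f (upd x i s)) has_real_derivative D) (at (x $ i)) \<Longrightarrow> partial_deriv i f x = D"
  unfolding partial_deriv_def by (rule DERIV_imp_deriv) (rule upd_line_derivative[THEN iffD2])

lemma partially_differentiableI:
  assumes "\<And>x. ((\<lambda>s. f (upd x i s)) has_real_derivative D x) (at (x $ i))"
  shows "partially_differentiable i f"
  unfolding partially_differentiable_def field_differentiable_def
  using assms[THEN upd_line_derivative[THEN iffD2]] by blast

lemma partially_differentiableD:
  assumes "partially_differentiable i f"
  shows "((\<lambda>s. f (upd x i s)) has_real_derivative partial_deriv i f (upd x i s)) (at s)"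
proof -
  have "((\<lambda>t. f (upd x i s + t *\<^sub>R axis i 1)) has_real_derivative partial_deriv i f (upd x i s)) (at 0)"
    using assms unfolding partially_differentiable_def partial_deriv_def
    by (auto intro: field_differentiable_derivI)
  from upd_line_derivative[THEN iffD1, OF this] show ?thesis by simp
qed

lemma iter_partial_simps [simp]:
  "iter_partial [] f = f" "iter_partial (i # js) f = partial_deriv i (iter_partial js f)"
  by (auto simp: iter_partial_def)

text \<open>Each derivative removes its coordinate from the integrated ones and contributes a sign.
  This is the origin of the factor (-1)^d between a density and the mixed derivative of its
  tail.\<close>

lemma iter_partial_tail:
  fixes q :: "real^'n::finite \<Rightarrow> real"
  assumes q: "continuous_on UNIV q" and wb: "weight_bounded a C q"
  shows "distinct js \<Longrightarrow> iter_partial js (tail UNIV q) = (\<lambda>x. (-1) ^ length js * tail (- set js) q x)"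
proof (induction js)
  case (Cons i js)
  have *: "- set js = insert i (- set (i # js))" using Cons.prems by auto
  have "partial_deriv i (\<lambda>x. (-1) ^ length js * tail (- set js) q x) x = (-1) ^ length js * - tail (- set (i # js)) q x" for x
    unfolding * by (rule partial_derivI DERIV_cmult)+ (use tail_line_derivative(1)[OF q wb, of i "- set (i#js)" x "x $ i"] in auto)
  then show ?case using Cons by auto
qed simp

text \<open>After differentiation in \<open>js\<close> what remains is a tail in which
  \<open>i\<close> is still integrated, so along the direction \<open>i\<close> it is an upper
  integral of an integrable function.\<close>

lemma vanishing_boundary_terms_tail:
  fixes q :: "real^'n::finite \<Rightarrow> real"
  assumes q: "continuous_on UNIV q" and wb: "weight_bounded a C q"
  shows "vanishing_boundary_terms (tail UNIV q)"
  unfolding vanishing_boundary_terms_def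
proof (intro allI impI conjI)
  fix js and i :: 'n assume "distinct js \<and> i \<notin> set js"
  then have d: "distinct js" and i: "i \<notin> - insert i (set js)" and *: "- set js = insert i (- insert i (set js))" by auto
  show "partially_differentiable i (iter_partial js (tail UNIV q))"
    unfolding iter_partial_tail[OF q wb d] *
    by (rule partially_differentiableI DERIV_cmult tail_line_derivative(1)[OF q wb i])+
  fix x
  have "((\<lambda>s. (-1) ^ length js * tail (- set js) q (upd x i s)) \<longlongrightarrow> (-1) ^ length js * 0) at_top"
    unfolding * by (intro tendsto_mult_left tail_line_derivative(2)[OF q wb i])
  then have "((\<lambda>s. (-1) ^ length js * tail (- set js) q (upd x i (x $ i + s))) \<longlongrightarrow> 0) at_top"
    using filterlim_compose[OF _ filterlim_tendsto_add_at_top[OF tendsto_const filterlim_ident]] by force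
  then show "((\<lambda>s. iter_partial js (tail UNIV q) (x + s *\<^sub>R axis i 1)) \<longlongrightarrow> 0) at_top"
    by (simp add: iter_partial_tail[OF q wb d] add_axis_upd)
qed

lemma mixed_deriv_tail:
  fixes q :: "real^'n::{finite,wellorder} \<Rightarrow> real"
  assumes q: "continuous_on UNIV q" and wb: "weight_bounded a C q"
  shows "mixed_deriv (tail UNIV q) = (\<lambda>x. (-1) ^ CARD('n) * q x)"
  unfolding mixed_deriv_def by (subst iter_partial_tail[OF q wb]) auto

text \<open>The derivatives are undone one at a time, from the outermost inwards; moving an index
  from \<open>js\<close> to \<open>ks\<close> is why the induction runs from the end of
  \<open>js\<close>. Taking \<open>ks\<close> empty recovers \<open>g\<close> itself.\<close>

lemma iter_partial_eq_tail:
  fixes g :: "real^'n::finite \<Rightarrow> real"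
  assumes v: "vanishing_boundary_terms g"
    and m: "continuous_on UNIV m" and wb: "weight_bounded a C m"
  shows "distinct (js @ ks) \<Longrightarrow> iter_partial (js @ ks) g = m \<Longrightarrow>
     iter_partial ks g x = (-1) ^ length js * tail (set js) m x"
proof (induction js arbitrary: ks x rule: rev_induct)
  case (snoc i js)
  let ?f = "iter_partial ks g" and ?c = "(-1::real) ^ length js"
  let ?H = "\<lambda>s. ?c * tail (insert i (set js)) m (upd x i s)"
  have i: "i \<notin> set js" "i \<notin> set ks" "distinct ks" using snoc.prems by auto
  have IH: "partial_deriv i ?f x = ?c * tail (set js) m x" for x
    using snoc.IH[of "i # ks" x] snoc.prems by simp
  have pd: "partially_differentiable i ?f" and lim: "\<And>x. ((\<lambda>s. ?f (x + s *\<^sub>R axis i 1)) \<longlongrightarrow> 0) at_top"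
    using v i unfolding vanishing_boundary_terms_def by auto
  have "((\<lambda>s. ?f (upd x i s) + ?H s) has_real_derivative 0) (at s)" for s
    using DERIV_add[OF partially_differentiableD[OF pd, of x s] DERIV_cmult[OF tail_line_derivative(1)[OF m wb i(1), of x s], of ?c]]
    by (simp add: IH)
  then have const: "?f (upd x i s) + ?H s = ?f (upd x i (x $ i)) + ?H (x $ i)" for s
    using DERIV_isconst_all by blast
  \<comment> \<open>The derivative of \<open>?H\<close> is the negative of that of
    \<open>?f\<close>, so the sum is constant on the line; both summands vanish at infinity, hence
    the constant is 0.\<close>
  have "((\<lambda>s. ?f (upd x i s) + ?H s) \<longlongrightarrow> 0 + ?c * 0) at_top"
    by (intro tendsto_add tendsto_mult_left tail_line_derivative(2)[OF m wb i(1)])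
       (use lim[of "upd x i 0"] in \<open>simp add: add_axis_upd\<close>)
  then have "((\<lambda>s::real. ?f (upd x i (x $ i)) + ?H (x $ i)) \<longlongrightarrow> 0) at_top"
    by (subst (asm) const) simp
  then have "?f x + ?c * tail (insert i (set js)) m x = 0"
    by (simp add: tendsto_const_iff)
  then show ?case by (simp add: insert_commute)
qed simp

lemma eq_tail_mixed_deriv:
  fixes g :: "real^'n::{finite,wellorder} \<Rightarrow> real"
  assumes v: "vanishing_boundary_terms g"
    and m: "continuous_on UNIV (mixed_deriv g)" and wb: "weight_bounded a C (mixed_deriv g)"
  shows "g = tail UNIV (\<lambda>x. (-1) ^ CARD('n) * mixed_deriv g x)"
proof
  fix x show "g x = tail UNIV (\<lambda>x. (-1) ^ CARD('n) * mixed_deriv g x) x"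
    using iter_partial_eq_tail[OF v m wb, of "sorted_list_of_set UNIV" "[]" x]
    by (simp add: tail_cmult mixed_deriv_def)
qed

section \<open>Signed measures and the map \<open>F\<close>\<close>

text \<open>A half-space bounding one coordinate from below is a countable union of orthants whose
  other corner coordinates go to minus infinity.\<close>

lemma borel_eq_atLeast_cart: "(borel :: (real^'n::finite) measure) = sigma UNIV (range atLeast)"
  (is "_ = ?SIGMA")
proof (rule borel_eq_sigmaI4[OF borel_eq_halfspace_ge])
  fix a :: real and i :: "real^'n" assume "(a, i) \<in> UNIV \<times> Basis"
  then obtain j where i: "i = axis j 1" by (auto simp: Basis_cart)
  have *: "{x. a \<le> x \<bullet> i} = (\<Union>k::nat. {(\<chi> n. if n = j then a else - real k)..})"
  proof (intro equalityI subsetI)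
    fix x assume "x \<in> {x. a \<le> x \<bullet> i}"
    then have "a \<le> x $ j" by (simp add: i inner_axis)
    obtain k where k: "norm x \<le> real k" using real_arch_simple by blast
    have "- real k \<le> x $ n" for n using component_le_norm_cart[of x n] k by linarith
    with \<open>a \<le> x $ j\<close> show "x \<in> (\<Union>k::nat. {(\<chi> n. if n = j then a else - real k)..})"
      by (auto simp: less_eq_vec_def)
  qed (auto simp: less_eq_vec_def i inner_axis split: if_splits)
  show "{x. a \<le> x \<bullet> i} \<in> ?SIGMA" unfolding * by (intro sets.countable_nat_UN) auto
qed auto

lemma orthant_borel [measurable]: "{y. x \<le> y} \<in> sets (borel :: (real^'n::finite) measure)"
  using closed_eucl_atLeast[of x] by (auto simp: atLeast_def intro: borel_closed)

section \<open>Signed measures as set functions\<close>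

lemma signed_measure_sums:
  assumes "signed_measure Q" "range A \<subseteq> sets borel" "disjoint_family A"
  shows "(\<lambda>n::nat. Q (A n)) sums Q (\<Union>n. A n)"
  using assms unfolding signed_measure_def by blast

lemma signed_measure_empty:
  assumes Q: "signed_measure Q" shows "Q {} = 0"
proof -
  have "(\<lambda>n::nat. Q {}) sums Q (\<Union>n::nat. {})"
    by (rule signed_measure_sums[OF Q]) (auto simp: disjoint_family_on_def)
  then have "summable (\<lambda>n::nat. Q {})" by (rule sums_summable)
  then show ?thesis by (simp add: summable_const_iff)
qed

lemma signed_measure_Un:
  assumes Q: "signed_measure Q" and AB: "A \<in> sets borel" "B \<in> sets borel" "A \<inter> B = {}"
  shows "Q (A \<union> B) = Q A + Q B"
proof -
  have "(\<lambda>n. Q (binaryset A B n)) sums Q (\<Union>n. binaryset A B n)"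
  proof (rule signed_measure_sums[OF Q])
    show "range (binaryset A B) \<subseteq> sets borel" using AB by (simp add: range_binaryset_eq)
    show "disjoint_family (binaryset A B)" using AB by (auto simp: disjoint_family_on_def binaryset_def)
  qed
  moreover have "(\<lambda>n. Q (binaryset A B n)) sums (Q A + Q B)"
    by (rule binaryset_sums[where f=Q, OF signed_measure_empty[OF Q]])
  ultimately show ?thesis by (simp add: UN_binaryset_eq sums_iff)
qed

lemma signed_measure_incseq:
  assumes Q: "signed_measure Q" and A: "incseq A" "\<And>n. A n \<in> sets borel"
  shows "(\<lambda>n. Q (A n)) \<longlonglongrightarrow> Q (\<Union>n. A n)"
proof -
  have dm: "disjointed A n \<in> sets borel" for n
    using sets.range_disjointed_sets[of A borel] A by auto
  have "(\<lambda>n. Q (disjointed A n)) sums Q (\<Union>n. disjointed A n)"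
    by (rule signed_measure_sums[OF Q]) (use dm disjoint_family_disjointed in auto)
  then have "(\<lambda>n. \<Sum>i\<le>n. Q (disjointed A i)) \<longlonglongrightarrow> Q (\<Union>n. A n)"
    by (simp add: sums_def_le UN_disjointed_eq)
  moreover have "(\<Sum>i\<le>n. Q (disjointed A i)) = Q (A n)" for n
  proof (induction n)
    case (Suc n)
    have "A n \<subseteq> A (Suc n)" using A by (simp add: incseq_SucD)
    then have "Q (A (Suc n)) = Q (A n) + Q (A (Suc n) - A n)"
      using signed_measure_Un[OF Q, of "A n" "A (Suc n) - A n"] A by (auto simp: Un_absorb1)
    then show ?case using Suc disjointed_mono[OF A(1)] by simp
  qed (simp add: disjointed_0)
  ultimately show ?thesis by simp
qed

lemma inj_pareto_F: "inj_on pareto_F {Q :: (real^'n::finite) set \<Rightarrow> real. signed_measure Q}"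
proof (rule inj_onI, clarify)
  fix P Q :: "(real^'n) set \<Rightarrow> real"
  assume P: "signed_measure P" and Q: "signed_measure Q" and eq: "pareto_F P = pareto_F Q"
  have base: "P {y..} = Q {y..}" for y
    using fun_cong[OF eq, of y] by (simp add: pareto_F_def atLeast_def)
  \<comment> \<open>Orthants exhausting the space. They give equality of the total values, without
    which the induction could not pass to complements.\<close>
  let ?A = "\<lambda>k::nat. {(\<chi> n. - real k) :: real^'n ..}"
  have inc: "incseq ?A" by (force simp: incseq_def less_eq_vec_def)
  have "x \<in> (\<Union>k. ?A k)" for x
  proof -
    obtain k where k: "norm x \<le> real k" using real_arch_simple by blast
    have "- real k \<le> x $ n" for n using component_le_norm_cart[of x n] k by linarith
    then show ?thesis by (auto simp: less_eq_vec_def)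
  qed
  then have U: "(\<Union>k. ?A k) = UNIV" by blast
  have UU: "P UNIV = Q UNIV"
    using LIMSEQ_unique[OF signed_measure_incseq[OF P inc] signed_measure_incseq[OF Q inc, folded base]] U
    by (simp add: base)
  have compl: "R (UNIV - A) = R UNIV - R A" if "signed_measure R" "A \<in> sets borel" for R :: "(real^'n) set \<Rightarrow> real" and A
    using signed_measure_Un[OF that(1), of A "UNIV - A"] that(2) by auto
  have sets: "sets (borel :: (real^'n) measure) = sigma_sets UNIV (range atLeast)"
    by (subst borel_eq_atLeast_cart) simp
  have IS: "Int_stable (range (atLeast :: real^'n \<Rightarrow> _))"
  proof (rule Int_stableI_image)
    fix x y :: "real^'n"
    show "\<exists>z\<in>UNIV. {x..} \<inter> {y..} = {z..}"
      by (intro bexI[of _ "sup x y"]) auto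
  qed
  have main: "P A = Q A" if A: "A \<in> sigma_sets UNIV (range atLeast)" for A
  proof (rule sigma_sets_induct_disjoint[OF IS _ A, of "\<lambda>A. P A = Q A"])
    fix A :: "(real^'n) set" assume "A \<in> sigma_sets UNIV (range atLeast)" "P A = Q A"
    then show "P (UNIV - A) = Q (UNIV - A)"
      using compl[OF P, of A] compl[OF Q, of A] UU unfolding sets by simp
  next
    fix A :: "nat \<Rightarrow> (real^'n) set"
    assume A: "disjoint_family A" "range A \<subseteq> sigma_sets UNIV (range atLeast)" "\<And>i. P (A i) = Q (A i)"
    then have "(\<lambda>n. P (A n)) sums P (\<Union>n. A n)" "(\<lambda>n. Q (A n)) sums Q (\<Union>n. A n)"
      using signed_measure_sums[OF P, of A] signed_measure_sums[OF Q, of A] unfolding sets by blast+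
    then show "P (\<Union>i. A i) = Q (\<Union>i. A i)" using A(3) by (simp add: sums_iff)
  qed (auto simp: base signed_measure_empty P Q)
  show "P = Q"
  proof
    fix A
    \<comment> \<open>Off the Borel sets both functions are 0 by convention.\<close>
    show "P A = Q A"
      using main[of A] P Q unfolding signed_measure_def sets by (cases "A \<in> sigma_sets UNIV (range atLeast)") auto
  qed
qed

text \<open>\<open>ennreal\<close> sends negative numbers to 0, so the two densities are the
  positive and the negative part of \<open>q\<close>.\<close>

lemma with_density_eq_diff:
  fixes q :: "'a::euclidean_space \<Rightarrow> real"
  assumes q: "integrable lborel q"
  defines "M \<equiv> density lborel (\<lambda>x. ennreal (q x))" and "N \<equiv> density lborel (\<lambda>x. ennreal (- q x))"
  shows "finite_measure M" "finite_measure N" "sets M = sets borel" "sets N = sets borel"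
    and "\<And>A. A \<in> sets borel \<Longrightarrow> with_density q A = measure M A - measure N A"
proof -
  note [measurable] = borel_measurable_integrable[OF q]
  show "sets M = sets borel" "sets N = sets borel" by (auto simp: M_def N_def)
  have fin: "integral\<^sup>N lborel (\<lambda>x. ennreal (q x)) < \<infinity>" "integral\<^sup>N lborel (\<lambda>x. ennreal (- q x)) < \<infinity>"
    using q unfolding real_integrable_def by (auto simp: less_top)
  show "finite_measure M" "finite_measure N"
    unfolding M_def N_def by (rule finite_measureI; use fin in \<open>simp add: emeasure_density less_top[symmetric]\<close>)+
  fix A :: "'a set" assume [measurable]: "A \<in> sets borel"
  have "integrable lborel (\<lambda>x. indicator A x *\<^sub>R q x)"
    by (rule integrable_mult_indicator[OF _ q]) simp
  moreover have "(\<integral>\<^sup>+ x. ennreal (indicator A x *\<^sub>R q x) \<partial>lborel) = emeasure M A"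
    "(\<integral>\<^sup>+ x. ennreal (- (indicator A x *\<^sub>R q x)) \<partial>lborel) = emeasure N A"
    unfolding M_def N_def by (auto simp: emeasure_density indicator_def intro!: nn_integral_cong)
  ultimately show "with_density q A = measure M A - measure N A"
    by (simp add: with_density_def set_lebesgue_integral_def real_lebesgue_integral_def measure_def)
qed

lemma signed_measure_with_density:
  fixes q :: "'a::euclidean_space \<Rightarrow> real"
  assumes q: "integrable lborel q"
  shows "signed_measure (with_density q)"
  unfolding signed_measure_def
proof (intro conjI allI impI)
  fix A :: "nat \<Rightarrow> 'a set" assume A: "range A \<subseteq> sets borel" "disjoint_family A"
  note D = with_density_eq_diff[OF q]
  have "(\<lambda>n. measure (density lborel (\<lambda>x. ennreal (q x))) (A n) - measure (density lborel (\<lambda>x. ennreal (- q x))) (A n))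
    sums (measure (density lborel (\<lambda>x. ennreal (q x))) (\<Union>n. A n) - measure (density lborel (\<lambda>x. ennreal (- q x))) (\<Union>n. A n))"
    using D(1-4) A by (intro sums_diff finite_measure.finite_measure_UNION) auto
  moreover have "with_density q (A n) = measure (density lborel (\<lambda>x. ennreal (q x))) (A n) - measure (density lborel (\<lambda>x. ennreal (- q x))) (A n)" for n
    using A by (intro D(5)) auto
  moreover have "with_density q (\<Union>n. A n) = measure (density lborel (\<lambda>x. ennreal (q x))) (\<Union>n. A n) - measure (density lborel (\<lambda>x. ennreal (- q x))) (\<Union>n. A n)"
    using A by (intro D(5)) auto
  ultimately show "(\<lambda>n. with_density q (A n)) sums with_density q (\<Union>n. A n)" by simp
qed (simp add: with_density_def)

text \<open>The set of agreement is closed and has full Lebesgue measure, so it is the whole space.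
  This turns almost everywhere uniqueness of densities into equality of functions.\<close>

lemma continuous_AE_eq:
  fixes f g :: "'a::euclidean_space \<Rightarrow> real"
  assumes "continuous_on UNIV f" "continuous_on UNIV g" "AE x in lborel. f x = g x"
  shows "f = g"
proof
  fix x
  have "closed {x. f x = g x}" by (intro closed_Collect_eq assms)
  moreover have "AE x in lebesgue. x \<in> {x. f x = g x}" using AE_completion[OF assms(3)] by simp
  ultimately have "x \<in> {x. f x = g x}" by (rule mem_closed_if_AE_lebesgue)
  then show "f x = g x" by simp
qed

lemma density_of_with_density:
  fixes q :: "'a::euclidean_space \<Rightarrow> real"
  assumes q: "continuous_on UNIV q" "integrable lborel q"
  shows "density_of (with_density q) = q"
  unfolding density_of_def
proof (rule the_equality)
  fix r assume r: "continuous_on UNIV r \<and> integrable lborel r \<and> with_density r = with_density q"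
  have "AE x in lborel. r x = q x"
  proof (rule sigma_finite_measure.density_unique_banach[OF sigma_finite_lborel])
    show "set_lebesgue_integral lborel A r = set_lebesgue_integral lborel A q" if "A \<in> sets lborel" for A
    proof -
      have "with_density r A = with_density q A" using r by simp
      then show ?thesis using that by (simp add: with_density_def)
    qed
  qed (use q r in auto)
  then show "r = q" using r q by (intro continuous_AE_eq) auto
qed (use q in simp)

text \<open>On an indicator every representation as a difference of measures returns the value of
  the signed measure, so the description operator is well defined here. The dual of a flow semigroup
  meets only indicators, because composition with a map sends indicators to indicators.\<close>

lemma signed_integral_indicator:
  fixes q :: "'a::euclidean_space \<Rightarrow> real"
  assumes q: "integrable lborel q" and B: "B \<in> sets borel"
  shows "signed_integral (with_density q) (indicator B) = with_density q B"
  unfolding signed_integral_def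
proof (rule the_equality)
  note D = with_density_eq_diff[OF q]
  show "\<exists>M N. finite_measure M \<and> finite_measure N \<and> sets M = sets borel \<and> sets N = sets borel \<and>
      (\<forall>A\<in>sets borel. with_density q A = measure M A - measure N A) \<and>
      with_density q B = (LINT x|M. indicator B x) - (LINT x|N. indicator B x)"
    using D B by (intro exI[of _ "density lborel (\<lambda>x. ennreal (q x))"] exI[of _ "density lborel (\<lambda>x. ennreal (- q x))"])
      (simp add: space_density)
  fix r :: real assume "\<exists>M N. finite_measure M \<and> finite_measure N \<and> sets M = sets borel \<and> sets N = sets borel \<and>
      (\<forall>A\<in>sets borel. with_density q A = measure M A - measure N A) \<and>
      r = (LINT x|M. indicator B x) - (LINT x|N. indicator B x)"
  then obtain M N where MN: "sets M = sets borel" "sets N = sets (borel :: 'a measure)"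
     "\<forall>A\<in>sets borel. with_density q A = measure M A - measure N A"
     "r = (LINT x|M. indicator B x) - (LINT x|N. indicator B x)" by auto
  then have "space M = UNIV" "space N = UNIV" using sets_eq_imp_space_eq[OF MN(1)] sets_eq_imp_space_eq[OF MN(2)] by auto
  with MN B show "r = with_density q B" by simp
qed

lemma dual_operator_flow:
  fixes q :: "'a::euclidean_space \<Rightarrow> real"
  assumes q: "integrable lborel q" and X: "X t \<in> borel_measurable borel" and A: "A \<in> sets borel"
  shows "dual_operator (flow_semigroup X t) (with_density q) A = with_density q (X t -` A)"
proof -
  have "flow_semigroup X t (indicator A) = indicator (X t -` A)"
    by (auto simp: flow_semigroup_def indicator_def)
  moreover have "X t -` A \<in> sets borel" using measurable_sets[OF X A] by simp
  ultimately show ?thesis using A by (simp add: dual_operator_def signed_integral_indicator[OF q])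
qed

lemma pareto_F_with_density:
  fixes q :: "real^'n::finite \<Rightarrow> real"
  assumes "q \<in> borel_measurable borel"
  shows "pareto_F (with_density q) = tail UNIV q"
  by (auto simp: pareto_F_def with_density_def tail_UNIV[OF assms])

lemma pareto_F_inv_tail:
  fixes q :: "real^'n::finite \<Rightarrow> real"
  assumes q: "q \<in> borel_measurable borel" and wb: "weight_bounded a C q"
  shows "pareto_F_inv (tail UNIV q) = with_density q"
  unfolding pareto_F_inv_def pareto_F_with_density[OF q, symmetric]
  by (rule the_inv_into_f_f[OF inj_pareto_F])
     (simp add: signed_measure_with_density weight_bounded_integrable[OF q wb])

lemma pareto_dual_semigroup_tail:
  fixes q :: "real^'n::finite \<Rightarrow> real"
  assumes q: "q \<in> borel_measurable borel" and wb: "weight_bounded a C q" and X: "X t \<in> borel_measurable borel"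
  shows "pareto_dual_semigroup X t (tail UNIV q) x = (LINT z:{z. x \<le> X t z}|lborel. q z)"
proof -
  have "X t -` {y. x \<le> y} \<in> sets borel" using measurable_sets[OF X orthant_borel[of x]] by simp
  then show ?thesis
    by (simp add: pareto_dual_semigroup_def pareto_F_inv_tail[OF q wb] pareto_F_def
      dual_operator_flow[where X=X and t=t, OF weight_bounded_integrable[OF q wb] X] with_density_def vimage_def)
qed

section \<open>The dual generator\<close>

lemma upper_integral_FTC:
  fixes h :: "real \<Rightarrow> real"
  assumes c: "continuous_on UNIV h" and int: "integrable lborel h"
    and F: "\<And>s. (F has_real_derivative h s) (at s)" "(F \<longlongrightarrow> 0) at_top"
  shows "(LINT s:{y..}|lborel. h s) = - F y"
proof -
  let ?H = "\<lambda>y. LINT s:{y..}|lborel. h s"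
  have "((\<lambda>s. F s + ?H s) has_real_derivative h s + - h s) (at s)" for s
    by (rule DERIV_add[OF F(1) upper_integral(1)[OF c int]])
  then have const: "F s + ?H s = F y + ?H y" for s using DERIV_isconst_all[of "\<lambda>s. F s + ?H s" s y] by simp
  have "((\<lambda>s. F s + ?H s) \<longlongrightarrow> 0 + 0) at_top"
    by (rule tendsto_add[OF F(2) upper_integral(2)[OF c int]])
  then have "((\<lambda>s::real. F y + ?H y) \<longlongrightarrow> 0) at_top" by (subst (asm) const) simp
  then show ?thesis by (simp add: tendsto_const_iff)
qed

lemma weight_tendsto_0: "1 < a \<Longrightarrow> (weight a \<longlongrightarrow> 0) at_top"
  unfolding weight_def by real_asymp

lemma weight_bounded_line:
  fixes q :: "real^'n::finite \<Rightarrow> real"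
  assumes wb: "weight_bounded a C q"
  shows "\<bar>q (upd x i s)\<bar> \<le> C * weight a s"
proof -
  have "upd x i s = overwrite {i} (\<lambda>_. s) x" by (simp add: vec_eq_iff)
  then show ?thesis using weight_bounded_overwrite'[OF wb, of "{i}" "\<lambda>_. s" x] by simp
qed

text \<open>Fubini in the order opposite to \<open>tail_insert\<close>: \<open>j\<close> is the
  innermost variable, so the derivative is integrated away on each line before the face is
  integrated over. The weight bound on \<open>F\<close> makes the boundary value at infinity
  0.\<close>

lemma tail_partial_deriv:
  fixes F :: "real^'n::finite \<Rightarrow> real"
  assumes F: "partially_differentiable j F" "weight_bounded a C F"
    and h: "continuous_on UNIV (partial_deriv j F)" "weight_bounded a' C' (partial_deriv j F)"
  shows "tail UNIV (partial_deriv j F) x = - tail (- {j}) F x"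
proof -
  let ?h = "partial_deriv j F"
  note [measurable] = borel_measurable_continuous_onI[OF h(1)]
  let ?f = "\<lambda>z. indicator (orthant UNIV x) z * ?h (overwrite UNIV z x)"
  have line: "(LINT s:{x $ j..}|lborel. ?h (upd y j s)) = - F (upd y j (x $ j))" for y
  proof (rule upper_integral_FTC)
    show c: "continuous_on UNIV (\<lambda>s. ?h (upd y j s))"
      by (rule continuous_on_compose2[OF h(1)]) (auto intro!: continuous_intros)
    show "integrable lborel (\<lambda>s. ?h (upd y j s))"
    proof (rule Bochner_Integration.integrable_bound)
      show "integrable lborel (\<lambda>s. C' * weight a' s)"
        by (intro integrable_mult_right weight_integrable weight_boundedD(1)[OF h(2)])
      show "(\<lambda>s. ?h (upd y j s)) \<in> borel_measurable lborel" using borel_measurable_continuous_onI[OF c] by simp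
      show "AE s in lborel. norm (?h (upd y j s)) \<le> norm (C' * weight a' s)"
        unfolding real_norm_def by (intro AE_I2 order_trans[OF weight_bounded_line[OF h(2)] abs_ge_self])
    qed
    show "((\<lambda>s. F (upd y j s)) has_real_derivative ?h (upd y j s)) (at s)" for s
      by (rule partially_differentiableD[OF F(1)])
    have "((\<lambda>s. C * weight a s) \<longlongrightarrow> C * 0) at_top"
      by (intro tendsto_mult_left weight_tendsto_0 weight_boundedD(1)[OF F(2)])
    then show "((\<lambda>s. F (upd y j s)) \<longlongrightarrow> 0) at_top"
      by (intro Lim_null_comparison[of "\<lambda>s. F (upd y j s)" "\<lambda>s. C * weight a s"])
         (use weight_bounded_line[OF F(2)] in auto)
  qed
  have ins: "insert j (- {j}) = (UNIV :: 'n set)" by auto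
  have "tail UNIV ?h x = (\<integral>z. ?f z \<partial>PiM (insert j (-{j})) (\<lambda>_. lborel))"
    unfolding ins by (simp add: tail_def set_lebesgue_integral_def)
  also have "\<dots> = (\<integral>z. (\<integral>s. ?f (z(j := s)) \<partial>lborel) \<partial>PiM (-{j}) (\<lambda>_. lborel))"
  proof (rule lborel_PiM.product_integral_insert)
    show "integrable (PiM (insert j (- {j})) (\<lambda>_. lborel)) ?f"
      unfolding ins by (rule tail_integrable[OF _ h(2)]) measurable
  qed auto
  also have "\<dots> = (\<integral>z. indicator (orthant (-{j}) x) z * - F (overwrite (-{j}) z x) \<partial>PiM (-{j}) (\<lambda>_. lborel))"
  proof (rule Bochner_Integration.integral_cong[OF refl])
    fix z
    have "?f (z(j := s)) = indicator (orthant (-{j}) x) z * (indicator {x $ j..} s * ?h (upd (overwrite (-{j}) z x) j s))" for s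
    proof -
      have "overwrite UNIV (z(j := s)) x = upd (overwrite (-{j}) z x) j s" by (auto simp: vec_eq_iff)
      then show ?thesis by (auto simp: orthant_def indicator_def)
    qed
    then have "(\<integral>s. ?f (z(j := s)) \<partial>lborel) = indicator (orthant (-{j}) x) z * (LINT s:{x $ j..}|lborel. ?h (upd (overwrite (-{j}) z x) j s))"
      by (simp add: set_lebesgue_integral_def)
    also have "upd (overwrite (-{j}) z x) j (x $ j) = overwrite (-{j}) z x" by (auto simp: vec_eq_iff)
    then have "(LINT s:{x $ j..}|lborel. ?h (upd (overwrite (-{j}) z x) j s)) = - F (overwrite (-{j}) z x)"
      by (simp add: line)
    finally show "(\<integral>s. ?f (z(j := s)) \<partial>lborel) = indicator (orthant (-{j}) x) z * - F (overwrite (-{j}) z x)" .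
  qed
  also have "\<dots> = - tail (- {j}) F x" by (simp add: tail_def set_lebesgue_integral_def)
  finally show ?thesis .
qed

lemma weight_bounded_mult:
  fixes f q :: "real^'n::finite \<Rightarrow> real"
  assumes f: "bounded (range f)" and q: "weight_bounded a C q"
  shows "\<exists>C'. weight_bounded a C' (\<lambda>x. f x * q x)"
proof -
  obtain B where B: "\<And>x. \<bar>f x\<bar> \<le> B" using f by (auto simp: bounded_iff)
  have "weight_bounded a (B * C) (\<lambda>x. f x * q x)"
    unfolding weight_bounded_def abs_mult
  proof (intro conjI allI)
    fix x
    have "0 \<le> B" using B[of x] by linarith
    then show "\<bar>f x\<bar> * \<bar>q x\<bar> \<le> B * C * (\<Prod>k\<in>UNIV. weight a (x $ k))"
      using mult_mono[OF B[of x] weight_boundedD(3)[OF q, of x]] by (simp add: mult.assoc)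
  qed (rule weight_boundedD(1)[OF q])
  then show ?thesis by blast
qed

lemma weight_bounded_add:
  assumes "weight_bounded a C f" "weight_bounded a C' g"
  shows "weight_bounded a (C + C') (\<lambda>x. f x + g x)"
  unfolding weight_bounded_def
  using assms weight_boundedD(1)[OF assms(1)]
  by (auto simp: weight_bounded_def distrib_right intro!: order_trans[OF abs_triangle_ineq] add_mono)

lemma partial_deriv_mult:
  fixes f g :: "real^'n::finite \<Rightarrow> real"
  assumes "partially_differentiable j f" "partially_differentiable j g"
  shows "partially_differentiable j (\<lambda>x. f x * g x)"
    and "partial_deriv j (\<lambda>x. f x * g x) = (\<lambda>x. partial_deriv j f x * g x + f x * partial_deriv j g x)"
proof -
  have *: "((\<lambda>s. f (upd x j s) * g (upd x j s)) has_real_derivative partial_deriv j f x * g x + f x * partial_deriv j g x) (at (x $ j))" for x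
    using DERIV_mult[OF partially_differentiableD[OF assms(1), of x "x $ j"] partially_differentiableD[OF assms(2), of x "x $ j"]]
    by (simp add: mult.commute)
  show "partially_differentiable j (\<lambda>x. f x * g x)" by (rule partially_differentiableI) (rule *)
  show "partial_deriv j (\<lambda>x. f x * g x) = (\<lambda>x. partial_deriv j f x * g x + f x * partial_deriv j g x)"
    by (rule ext partial_derivI *)+
qed

lemma glue_eq_overwrite: "glue j z x = overwrite (-{j}) z x"
  by (auto simp: glue_def vec_eq_iff)

lemma dual_integral_operator_eq:
  fixes b :: "real^'n::{finite,wellorder} \<Rightarrow> real^'n::_"
  shows "dual_integral_operator b g x = (\<Sum>j\<in>UNIV. tail (-{j}) (\<lambda>y. b y $ j * ((-1) ^ CARD('n) * mixed_deriv g y)) x)"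
proof -
  have "tail (-{j}) (\<lambda>y. b y $ j * ((-1) ^ CARD('n) * mixed_deriv g y)) x
      = (-1) ^ CARD('n) * tail (-{j}) (\<lambda>y. b y $ j * mixed_deriv g y) x" for j
    by (simp add: tail_cmult[symmetric] mult.left_commute)
  then show ?thesis
    by (simp add: dual_integral_operator_def sum_distrib_left tail_def orthant_def glue_eq_overwrite)
qed

text \<open>The drift density is a finite sum of derivatives in the coordinate directions, each of
  which leaves one face. The minus sign of \<open>L'\<close> cancels against the one from the lower
  end of the integral. Integrability and continuity of \<open>q\<close> identify the density that
  the description operator returns.\<close>

lemma pareto_dual_generator_tail:
  fixes b :: "real^'n::{finite,wellorder} \<Rightarrow> real^'n::_"
  assumes b: "\<And>j. C1_bounded (\<lambda>x. b x $ j)"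
    and q: "continuous_on UNIV q" "weight_bounded a C q"
    and dq: "\<And>j. partially_differentiable j q" "\<And>j. continuous_on UNIV (partial_deriv j q)"
      "\<And>j. weight_bounded a C (partial_deriv j q)"
  shows "pareto_dual_generator b (tail UNIV q) x = (\<Sum>j\<in>UNIV. tail (-{j}) (\<lambda>y. b y $ j * q y) x)"
proof -
  note qm = borel_measurable_continuous_onI[OF q(1)]
  let ?F = "\<lambda>j y. b y $ j * q y"
  have b': "partially_differentiable j (\<lambda>x. b x $ j)" "continuous_on UNIV (\<lambda>x. b x $ j)"
    "bounded (range (\<lambda>x. b x $ j))" "continuous_on UNIV (partial_deriv j (\<lambda>x. b x $ j))"
    "bounded (range (partial_deriv j (\<lambda>x. b x $ j)))" for j
    using b[of j] by (auto simp: C1_bounded_def)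
  note pm = partial_deriv_mult[OF b'(1) dq(1)]
  have c: "continuous_on UNIV (partial_deriv j (?F j))" for j
    unfolding pm by (intro continuous_intros b' q dq)
  have w: "\<exists>C'. weight_bounded a C' (partial_deriv j (?F j))" for j
    unfolding pm using weight_bounded_mult[OF b'(5) q(2)] weight_bounded_mult[OF b'(3) dq(3)] weight_bounded_add by blast
  have t: "tail UNIV (partial_deriv j (?F j)) x = - tail (-{j}) (?F j) x" for j
  proof -
    obtain C1 where "weight_bounded a C1 (?F j)" using weight_bounded_mult[OF b'(3) q(2)] by blast
    moreover obtain C2 where "weight_bounded a C2 (partial_deriv j (?F j))" using w by blast
    ultimately show ?thesis by (intro tail_partial_deriv pm(1) c)
  qed
  have dm: "dual_drift_density b q \<in> borel_measurable borel"
    unfolding dual_drift_density_def using c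
    by (intro borel_measurable_continuous_onI) (auto intro!: continuous_intros simp del: One_nat_def)
  have int: "set_integrable lborel {y. x \<le> y} (partial_deriv j (?F j))" for j
    using weight_bounded_integrable[OF borel_measurable_continuous_onI[OF c]] w[of j]
    unfolding set_integrable_def by (intro integrable_mult_indicator) auto
  have "pareto_dual_generator b (tail UNIV q) x = tail UNIV (dual_drift_density b q) x"
    by (simp add: pareto_dual_generator_def pareto_F_inv_tail[OF qm q(2)] dual_drift_operator_def
      density_of_with_density[OF q(1) weight_bounded_integrable[OF qm q(2)]] pareto_F_with_density[OF dm])
  also have "\<dots> = (\<integral>y. - (\<Sum>j\<in>UNIV. indicator {y. x \<le> y} y *\<^sub>R partial_deriv j (?F j) y) \<partial>lborel)"
    unfolding tail_UNIV[OF dm] dual_drift_density_def set_lebesgue_integral_def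
    by (intro Bochner_Integration.integral_cong) (auto simp: indicator_def)
  also have "\<dots> = - (\<Sum>j\<in>UNIV. \<integral>y. indicator {y. x \<le> y} y *\<^sub>R partial_deriv j (?F j) y \<partial>lborel)"
    using int unfolding set_integrable_def by (subst Bochner_Integration.integral_minus, subst Bochner_Integration.integral_sum) auto
  also have "\<dots> = - (\<Sum>j\<in>UNIV. tail UNIV (partial_deriv j (?F j)) x)"
    unfolding tail_UNIV[OF borel_measurable_continuous_onI[OF c]] set_lebesgue_integral_def by simp
  finally show ?thesis by (simp add: t sum_negf)
qed

section \<open>Flows of bounded Lipschitz fields\<close>

text \<open>The increment is made one coordinate at a time, with the mean value theorem on each
  edge. Intermediate points differ from \<open>x\<close> in every coordinate by at most the
  increment there, so they stay where the partial derivatives are within \<open>e\<close> of those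
  at \<open>x\<close>.\<close>

lemma partial_sum_bound:
  fixes f :: "real^'n::finite \<Rightarrow> real"
  assumes pd: "\<And>j. partially_differentiable j f"
    and e: "\<And>j z. norm (z - x) \<le> norm h \<Longrightarrow> \<bar>partial_deriv j f z - partial_deriv j f x\<bar> \<le> e"
  shows "finite S \<Longrightarrow> \<bar>f (x + (\<Sum>j\<in>S. (h $ j) *\<^sub>R axis j 1)) - f x - (\<Sum>j\<in>S. h $ j * partial_deriv j f x)\<bar>
           \<le> real (card S) * (e * norm h)"
proof (induction S rule: finite_induct)
  case (insert i S)
  define z where "z = x + (\<Sum>j\<in>S. (h $ j) *\<^sub>R axis j 1)"
  have zn: "z $ k = x $ k + (if k \<in> S then h $ k else 0)" for k
    using insert.hyps(1) by (auto simp: z_def axis_def if_distrib cong: if_cong)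
  let ?phi = "\<lambda>s. f (upd z i (z $ i + s * h $ i)) - s * (h $ i * partial_deriv i f x)"
  let ?phi' = "\<lambda>s. partial_deriv i f (upd z i (z $ i + s * h $ i)) * h $ i - h $ i * partial_deriv i f x"
  have "(?phi has_real_derivative ?phi' s) (at s)" for s
    by (rule DERIV_diff DERIV_chain2[OF partially_differentiableD[OF pd]] derivative_eq_intros refl | simp)+
  then obtain s where s: "0 < s" "s < 1" "?phi 1 - ?phi 0 = (1 - 0) * ?phi' s"
    using MVT2[of 0 1 ?phi ?phi'] by auto
  have "norm (upd z i (z $ i + s * h $ i) - x) \<le> norm h"
  proof (rule norm_le_componentwise_cart)
    fix k show "norm ((upd z i (z $ i + s * h $ i) - x) $ k) \<le> norm (h $ k)"
      using insert.hyps(2) s by (auto simp: zn abs_mult mult_left_le_one_le)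
  qed
  from e[OF this, of i] have "\<bar>?phi' s\<bar> \<le> e * norm h"
    using mult_mono[OF e[OF \<open>norm (upd z i (z $ i + s * h $ i) - x) \<le> norm h\<close>, of i] component_le_norm_cart[of h i]]
    by (simp add: abs_mult[symmetric] algebra_simps)
  moreover have "upd z i (z $ i + h $ i) = x + (\<Sum>j\<in>insert i S. (h $ j) *\<^sub>R axis j 1)"
    unfolding add_axis_upd[symmetric] using insert.hyps by (simp add: z_def algebra_simps)
  ultimately have "\<bar>f (x + (\<Sum>j\<in>insert i S. (h $ j) *\<^sub>R axis j 1)) - f z - h $ i * partial_deriv i f x\<bar> \<le> e * norm h"
    using s(3) by simp
  with insert show ?case
    by (simp add: z_def[symmetric] distrib_right)
qed simp

lemma has_derivative_of_partials:
  fixes f :: "real^'n::finite \<Rightarrow> real"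
  assumes pd: "\<And>j. partially_differentiable j f" and c: "\<And>j. continuous_on UNIV (partial_deriv j f)"
  shows "(f has_derivative (\<lambda>h. \<Sum>j\<in>UNIV. h $ j * partial_deriv j f x)) (at x)"
proof (rule has_derivativeI)
  show "bounded_linear (\<lambda>h. \<Sum>j\<in>UNIV. h $ j * partial_deriv j f x)"
    by (intro bounded_linear_sum bounded_linear_mult_left[THEN bounded_linear_compose] bounded_linear_vec_nth)
  show "((\<lambda>y. (f y - f x - (\<Sum>j\<in>UNIV. (y - x) $ j * partial_deriv j f x)) /\<^sub>R norm (y - x)) \<longlongrightarrow> 0) (at x)"
  proof (rule tendstoI)
    fix e :: real assume e: "0 < e"
    \<comment> \<open>The d edges together contribute \<open>e / 2\<close>, which leaves room for
      the strict inequality.\<close>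
    let ?e = "e / (2 * real CARD('n))"
    have e': "0 < ?e" using e by simp
    have "\<forall>\<^sub>F z in nhds x. \<forall>j\<in>UNIV. \<bar>partial_deriv j f z - partial_deriv j f x\<bar> < ?e"
    proof (rule eventually_ball_finite)
      show "\<forall>j\<in>UNIV. \<forall>\<^sub>F z in nhds x. \<bar>partial_deriv j f z - partial_deriv j f x\<bar> < ?e"
      proof
        fix j
        have "isCont (partial_deriv j f) x" using c[of j] by (simp add: continuous_on_eq_continuous_at)
        then have "(partial_deriv j f \<longlongrightarrow> partial_deriv j f x) (nhds x)"
          by (simp add: isCont_def tendsto_at_iff_tendsto_nhds)
        from tendstoD[OF this e'] show "\<forall>\<^sub>F z in nhds x. \<bar>partial_deriv j f z - partial_deriv j f x\<bar> < ?e"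
          by (simp add: dist_real_def)
      qed
    qed simp
    then obtain d where d: "0 < d" "\<And>z j. dist z x < d \<Longrightarrow> \<bar>partial_deriv j f z - partial_deriv j f x\<bar> < ?e"
      unfolding eventually_nhds_metric by auto
    show "\<forall>\<^sub>F y in at x. dist ((f y - f x - (\<Sum>j\<in>UNIV. (y - x) $ j * partial_deriv j f x)) /\<^sub>R norm (y - x)) 0 < e"
      unfolding eventually_at
    proof (intro exI conjI ballI impI)
      show "0 < d" by fact
      fix y assume y: "y \<noteq> x \<and> dist y x < d"
      have yx: "x + (\<Sum>j\<in>UNIV. ((y - x) $ j) *\<^sub>R axis j 1) = y"
        by (simp add: vec_eq_iff axis_def if_distrib cong: if_cong)
      have "\<bar>f y - f x - (\<Sum>j\<in>UNIV. (y - x) $ j * partial_deriv j f x)\<bar> \<le> real CARD('n) * (?e * norm (y - x))"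
        using partial_sum_bound[OF pd, where S=UNIV and h="y - x" and e="?e" and x=x] d(2) y unfolding yx
        by (simp add: dist_norm less_imp_le)
      also have "\<dots> = e / 2 * norm (y - x)" by simp
      also have "\<dots> < e * norm (y - x)" using e y by simp
      finally show "dist ((f y - f x - (\<Sum>j\<in>UNIV. (y - x) $ j * partial_deriv j f x)) /\<^sub>R norm (y - x)) 0 < e"
        using y by (simp add: divide_simps abs_mult)
    qed
  qed
qed

lemma lipschitz_of_partials:
  fixes f :: "real^'n::finite \<Rightarrow> real"
  assumes "C1_bounded f"
  shows "\<exists>B. 0 \<le> B \<and> (\<forall>x y. \<bar>f x - f y\<bar> \<le> B * norm (x - y))"
proof -
  have pd: "\<And>j. partially_differentiable j f" and c: "\<And>j. continuous_on UNIV (partial_deriv j f)"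
    and b: "\<And>j. bounded (range (partial_deriv j f))"
    using assms by (auto simp: C1_bounded_def)
  have "\<exists>B. \<forall>x. \<bar>partial_deriv j f x\<bar> \<le> B" for j using b[of j] by (auto simp: bounded_iff)
  then obtain B where B: "\<And>j x. \<bar>partial_deriv j f x\<bar> \<le> B j" by metis
  have "norm (f x - f y) \<le> (\<Sum>j\<in>UNIV. B j) * norm (x - y)" for x y
  proof (rule differentiable_bound[OF convex_UNIV])
    fix x :: "real^'n"
    show "(f has_derivative (\<lambda>h. \<Sum>j\<in>UNIV. h $ j * partial_deriv j f x)) (at x within UNIV)"
      by (rule has_derivative_of_partials[OF pd c])
    show "onorm (\<lambda>h. \<Sum>j\<in>UNIV. h $ j * partial_deriv j f x) \<le> (\<Sum>j\<in>UNIV. B j)"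
    proof (rule onorm_le)
      fix h :: "real^'n"
      have "norm (\<Sum>j\<in>UNIV. h $ j * partial_deriv j f x) \<le> (\<Sum>j\<in>UNIV. norm h * B j)"
        by (rule sum_norm_le) (auto simp: abs_mult intro!: mult_mono component_le_norm_cart B)
      also have "(\<Sum>j\<in>UNIV. norm h * B j) = (\<Sum>j\<in>UNIV. B j) * norm h"
        by (subst sum_distrib_left[symmetric]) (rule mult.commute)
      finally show "norm (\<Sum>j\<in>UNIV. h $ j * partial_deriv j f x) \<le> (\<Sum>j\<in>UNIV. B j) * norm h" .
    qed
  qed auto
  moreover have "0 \<le> (\<Sum>j\<in>UNIV. B j)" using B abs_ge_zero order_trans by (intro sum_nonneg) blast
  ultimately show ?thesis by auto
qed

text \<open>\<open>phi t * exp (- L * t)\<close> is nonincreasing. The derivative is asked for in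
  the open interval only, because a flow has just a one-sided derivative at time 0.\<close>

lemma gronwall:
  fixes phi :: "real \<Rightarrow> real"
  assumes ac: "a \<le> c" and cont: "continuous_on {a..c} phi"
    and d: "\<And>t. a < t \<Longrightarrow> t < c \<Longrightarrow> (phi has_real_derivative phi' t) (at t)"
    and le: "\<And>t. a < t \<Longrightarrow> t < c \<Longrightarrow> phi' t \<le> L * phi t"
  shows "phi c \<le> exp (L * (c - a)) * phi a"
proof -
  have "phi c * exp (- L * c) \<le> phi a * exp (- L * a)"
  proof (rule DERIV_nonpos_imp_decreasing_open[OF ac])
    fix t assume t: "a < t" "t < c"
    have "((\<lambda>t. phi t * exp (- L * t)) has_real_derivative (phi' t - L * phi t) * exp (- L * t)) (at t)"
      by (auto intro!: derivative_eq_intros d[OF t] simp: algebra_simps)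
    moreover have "(phi' t - L * phi t) * exp (- L * t) \<le> 0"
      using le[OF t] by (simp add: mult_nonpos_nonneg)
    ultimately show "\<exists>y. ((\<lambda>t. phi t * exp (- L * t)) has_real_derivative y) (at t) \<and> y \<le> 0" by blast
  qed (intro continuous_intros cont)
  then have "phi c * exp (- L * c) * exp (L * c) \<le> phi a * exp (- L * a) * exp (L * c)"
    by (rule mult_right_mono) simp
  then show ?thesis by (simp add: mult.assoc exp_add[symmetric] algebra_simps)
qed

lemma vector_derivative_norm_bound:
  fixes f :: "real \<Rightarrow> 'a::real_normed_vector"
  assumes "a \<le> c" and d: "\<And>t. t \<in> {a..c} \<Longrightarrow> (f has_vector_derivative f' t) (at t within {a..c})"
    and B: "\<And>t. t \<in> {a..c} \<Longrightarrow> norm (f' t) \<le> B"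
  shows "norm (f c - f a) \<le> B * (c - a)"
proof -
  have "norm (f c - f a) \<le> B * norm (c - a)"
  proof (rule differentiable_bound[of "{a..c}"])
    fix t assume t: "t \<in> {a..c}"
    show "(f has_derivative (\<lambda>h. h *\<^sub>R f' t)) (at t within {a..c})"
      using d[OF t] by (simp add: has_vector_derivative_def)
    show "onorm (\<lambda>h. h *\<^sub>R f' t) \<le> B"
      using mult_right_mono[OF B[OF t] abs_ge_zero] by (intro onorm_le) (simp add: mult.commute)
  qed (use assms(1) in auto)
  then show ?thesis using assms(1) by simp
qed

text \<open>The assumptions are invariant under time reversal: the inverse flow satisfies them for
  the field \<open>- b\<close> with the same \<open>K\<close> and \<open>M\<close>, so every result
  on \<open>X\<close> also holds for \<open>Y\<close>.\<close>

locale lipschitz_flow =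
  fixes b :: "'a::euclidean_space \<Rightarrow> 'a" and X :: "real \<Rightarrow> 'a \<Rightarrow> 'a" and K M :: real
  assumes lip: "norm (b x - b y) \<le> K * norm (x - y)" and K: "0 \<le> K"
    and bd: "norm (b x) \<le> M"
    and flow: "flow_of b X"
begin

lemma M: "0 \<le> M" using bd[of 0] norm_ge_zero order_trans by blast

lemma X_0 [simp]: "X 0 x = x" using flow by (simp add: flow_of_def)

lemma X_deriv: "0 \<le> t \<Longrightarrow> ((\<lambda>s. X s x) has_vector_derivative b (X t x)) (at t within {0..})"
  using flow by (simp add: flow_of_def)

lemma X_deriv_at: "0 < t \<Longrightarrow> ((\<lambda>s. X s x) has_vector_derivative b (X t x)) (at t)"
  using X_deriv[of t x] at_within_interior[of t "{0..}"] by (simp add: interior_real_atLeast)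

lemma X_deriv_Icc: "t \<in> {0..c} \<Longrightarrow> ((\<lambda>s. X s x) has_vector_derivative b (X t x)) (at t within {0..c})"
  by (rule has_vector_derivative_within_subset[OF X_deriv]) auto

lemma X_continuous: "continuous_on {0..} (\<lambda>s. X s x)"
  by (rule continuous_on_vector_derivative[OF X_deriv]) simp

text \<open>Gronwall for the squared distance, which unlike the distance is differentiable also
  where the two solutions meet.\<close>

lemma solutions_bound:
  assumes ac: "a \<le> c" and cu: "continuous_on {a..c} u" and cv: "continuous_on {a..c} v"
    and du: "\<And>t. a < t \<Longrightarrow> t < c \<Longrightarrow> (u has_vector_derivative b (u t)) (at t)"
    and dv: "\<And>t. a < t \<Longrightarrow> t < c \<Longrightarrow> (v has_vector_derivative b (v t)) (at t)"
  shows "norm (u c - v c) \<le> exp (K * (c - a)) * norm (u a - v a)"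
proof -
  let ?phi = "\<lambda>t. (u t - v t) \<bullet> (u t - v t)"
  have "?phi c \<le> exp (2 * K * (c - a)) * ?phi a"
  proof (rule gronwall[OF ac, where phi' = "\<lambda>t. 2 * ((u t - v t) \<bullet> (b (u t) - b (v t)))"])
    show "continuous_on {a..c} ?phi" by (intro continuous_intros cu cv)
    fix t assume t: "a < t" "t < c"
    have d: "((\<lambda>t. u t - v t) has_derivative (\<lambda>h. h *\<^sub>R (b (u t) - b (v t)))) (at t)"
      using has_vector_derivative_diff[OF du[OF t] dv[OF t]] by (simp add: has_vector_derivative_def)
    show "(?phi has_real_derivative 2 * ((u t - v t) \<bullet> (b (u t) - b (v t)))) (at t)"
      unfolding has_field_derivative_def
      by (rule has_derivative_eq_rhs[OF has_derivative_inner[OF d d]]) (auto simp: inner_commute algebra_simps)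
    have "(u t - v t) \<bullet> (b (u t) - b (v t)) \<le> norm (u t - v t) * norm (b (u t) - b (v t))"
      by (rule norm_cauchy_schwarz)
    also have "\<dots> \<le> norm (u t - v t) * (K * norm (u t - v t))"
      by (rule mult_left_mono[OF lip]) simp
    also have "\<dots> = K * ?phi t" by (simp add: power2_norm_eq_inner[symmetric] power2_eq_square)
    finally show "2 * ((u t - v t) \<bullet> (b (u t) - b (v t))) \<le> 2 * K * ?phi t" by simp
  qed
  also have "exp (2 * K * (c - a)) = (exp (K * (c - a)))\<^sup>2"
    by (simp add: exp_double[symmetric] mult.assoc)
  finally have "(norm (u c - v c))\<^sup>2 \<le> (exp (K * (c - a)) * norm (u a - v a))\<^sup>2"
    by (simp add: power_mult_distrib power2_norm_eq_inner)
  then show ?thesis by (rule power2_le_imp_le) simp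
qed

lemma X_lipschitz:
  assumes "0 \<le> t" shows "norm (X t x - X t y) \<le> exp (K * t) * norm (x - y)"
  using solutions_bound[OF assms continuous_on_subset[OF X_continuous] continuous_on_subset[OF X_continuous], of x y]
  by (auto intro: X_deriv_at)

lemma X_time_lipschitz:
  assumes "0 \<le> s" "0 \<le> t" shows "norm (X t x - X s x) \<le> M * \<bar>t - s\<bar>"
proof -
  have *: "norm (X t x - X s x) \<le> M * (t - s)" if "0 \<le> s" "s \<le> t" for s t
    using that by (intro vector_derivative_norm_bound[where f'="\<lambda>t. b (X t x)"])
      (auto intro: has_vector_derivative_within_subset[OF X_deriv] bd)
  show ?thesis using *[of s t] *[of t s] assms by (cases "s \<le> t") (auto simp: norm_minus_commute)
qed

text \<open>Both sides solve the same equation from the same initial point, so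
  \<open>solutions_bound\<close> leaves distance 0 between them.\<close>

lemma X_add:
  assumes "0 \<le> s" "0 \<le> t" shows "X (s + t) x = X s (X t x)"
proof -
  have "norm (X (s + t) x - X s (X t x)) \<le> exp (K * (s - 0)) * norm (X (0 + t) x - X 0 (X t x))"
  proof (rule solutions_bound[OF assms(1)])
    show "continuous_on {0..s} (\<lambda>s. X (s + t) x)"
      by (rule continuous_on_compose2[OF X_continuous]) (use assms in \<open>auto intro!: continuous_intros\<close>)
    show "continuous_on {0..s} (\<lambda>s. X s (X t x))"
      by (rule continuous_on_subset[OF X_continuous]) auto
    fix r assume r: "0 < r" "r < s"
    have 1: "((\<lambda>r. r + t) has_vector_derivative 1) (at r)"
      by (auto intro!: derivative_eq_intros simp: has_real_derivative_iff_has_vector_derivative[symmetric])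
    show "((\<lambda>s. X (s + t) x) has_vector_derivative b (X (r + t) x)) (at r)"
      using vector_diff_chain_at[OF 1 X_deriv_at] r assms by (simp add: o_def)
    show "((\<lambda>s. X s (X t x)) has_vector_derivative b (X r (X t x))) (at r)"
      using r by (intro X_deriv_at)
  qed
  then show ?thesis by simp
qed

text \<open>The velocity difference of two trajectories is at most K times their distance;
  integrating it shows that the displacement has a Lipschitz constant of order h, which is what
  makes short time maps invertible.\<close>

lemma X_perturbation:
  assumes "0 \<le> h"
  shows "norm ((X h x - x) - (X h y - y)) \<le> K * exp (K * h) * h * norm (x - y)"
proof -
  have "norm ((X h x - X h y) - (X 0 x - X 0 y)) \<le> K * (exp (K * h) * norm (x - y)) * (h - 0)"
  proof (rule vector_derivative_norm_bound[OF assms, where f'="\<lambda>t. b (X t x) - b (X t y)"])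
    fix t assume t: "t \<in> {0..h}"
    show "((\<lambda>t. X t x - X t y) has_vector_derivative b (X t x) - b (X t y)) (at t within {0..h})"
      by (intro has_vector_derivative_diff X_deriv_Icc t)
    have "norm (X t x - X t y) \<le> exp (K * t) * norm (x - y)" using t by (intro X_lipschitz) auto
    also have "\<dots> \<le> exp (K * h) * norm (x - y)" using t K by (intro mult_right_mono) (auto intro: mult_left_mono)
    finally show "norm (b (X t x) - b (X t y)) \<le> K * (exp (K * h) * norm (x - y))"
      using lip[of "X t x" "X t y"] mult_left_mono[OF _ K] order_trans by blast
  qed
  then show ?thesis by (simp add: algebra_simps)
qed

text \<open>Identity plus contraction: with K h at most 1/4 and exp(K h) at most 3, the displacement
  has Lipschitz constant at most 3/4. Injectivity is immediate, and a preimage of \<open>y\<close>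
  is the fixed point of z to \<open>y - (X h z - z)\<close>.\<close>

lemma X_bij_small:
  assumes h: "0 \<le> h" "K * h \<le> 1 / 4"
  shows "bij (X h)"
proof -
  let ?c = "K * exp (K * h) * h"
  have "exp (K * h) \<le> exp 1" using h by simp
  then have e: "exp (K * h) \<le> 3" using exp_le by linarith
  have c: "0 \<le> ?c" "?c < 1"
    using mult_mono[OF h(2) e] h K by (auto simp: mult_ac)
  show ?thesis
  proof (rule bijI)
    show "inj (X h)"
    proof (rule injI)
      fix x y assume "X h x = X h y"
      then have "norm (x - y) \<le> ?c * norm (x - y)"
        using X_perturbation[OF h(1), of x y] by (simp add: norm_minus_commute)
      then have "(1 - ?c) * norm (x - y) \<le> 0" by (simp add: algebra_simps)
      then show "x = y" using c by (simp add: mult_le_0_iff)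
    qed
    have "\<exists>z. X h z = y" for y
    proof -
      have "\<exists>!z. y - (X h z - z) = z"
      proof (rule banach_fix_type[OF c], intro allI)
        fix u v show "dist (y - (X h u - u)) (y - (X h v - v)) \<le> ?c * dist u v"
          using X_perturbation[OF h(1), of u v]
          by (simp add: dist_norm norm_minus_commute algebra_simps)
      qed
      then obtain z where "y - (X h z - z) = z" by blast
      then show ?thesis by (intro exI[of _ z]) (simp add: algebra_simps)
    qed
    then show "surj (X h)" by (metis surjI)
  qed
qed

lemma X_bij:
  assumes t: "0 \<le> t" shows "bij (X t)"
proof -
  \<comment> \<open>Enough steps for each to have length satisfying K h at most 1/4; the summand 1
    keeps \<open>n\<close> positive.\<close>
  obtain n :: nat where n: "4 * (K * t) + 1 \<le> real n" using real_arch_simple by blast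
  define h where "h = t / real n"
  have n0: "0 < real n" using n K t mult_nonneg_nonneg[OF K t] by linarith
  have h: "0 \<le> h" "K * h \<le> 1/4" using n n0 t by (auto simp: h_def field_simps)
  have "bij (X (real m * h))" for m
  proof (induction m)
    case 0 then show ?case by (simp add: bij_def inj_def surj_def)
  next
    case (Suc m)
    have "X (real (Suc m) * h) = X h \<circ> X (real m * h)"
      using X_add[of h "real m * h"] h by (auto simp: fun_eq_iff algebra_simps)
    then show ?case using bij_comp[OF Suc X_bij_small[OF h]] by metis
  qed
  from this[of n] show ?thesis using n0 by (simp add: h_def)
qed

section \<open>The inverse flow\<close>

definition Y :: "real \<Rightarrow> 'a \<Rightarrow> 'a" where
  "Y t = inv (X t)"

lemma Y_X [simp]: "0 \<le> t \<Longrightarrow> Y t (X t x) = x"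
  using X_bij[of t] by (simp add: Y_def bij_is_inj)

lemma X_Y [simp]: "0 \<le> t \<Longrightarrow> X t (Y t x) = x"
  using X_bij[of t] by (simp add: Y_def bij_is_surj surj_f_inv_f)

lemma Y_X_diff:
  assumes "0 \<le> s" "s \<le> t" shows "Y s (X t x) = X (t - s) x"
  using X_add[of s "t - s" x] assms Y_X[of s "X (t - s) x"] by simp

lemma flow_of_Y: "flow_of (\<lambda>x. - b x) Y"
  unfolding flow_of_def
proof (intro allI conjI impI)
  fix x show "Y 0 x = x" using Y_X[of 0 x] by simp
  fix t :: real assume t: "0 \<le> t"
  \<comment> \<open>Up to time T the backward motion from \<open>x\<close> is the forward trajectory
    of \<open>w\<close> run in reverse. A final time beyond \<open>t\<close> makes the derivative
    within \<open>{0..T}\<close> the same as the one within \<open>{0..}\<close>.\<close>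
  define T w where "T = t + 1" and "w = Y T x"
  have Ys: "Y s x = X (T - s) w" if "s \<in> {0..T}" for s
    using Y_X_diff[of s T w] that t by (simp add: w_def T_def)
  have 1: "((\<lambda>s. T - s) has_vector_derivative -1) (at t within {0..T})"
    by (auto intro!: derivative_eq_intros simp: has_real_derivative_iff_has_vector_derivative[symmetric])
  have 2: "((\<lambda>s. X s w) has_vector_derivative b (X (T - t) w)) (at (T - t) within (\<lambda>s. T - s) ` {0..T})"
    using t by (intro has_vector_derivative_within_subset[OF X_deriv]) (auto simp: T_def)
  have "((\<lambda>s. X (T - s) w) has_vector_derivative - b (X (T - t) w)) (at t within {0..T})"
    using vector_diff_chain_within[OF 1 2] by (simp add: o_def)
  then have "((\<lambda>s. Y s x) has_vector_derivative - b (Y t x)) (at t within {0..T})"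
    using t Ys by (subst Ys) (auto simp: T_def intro: has_vector_derivative_transform)
  moreover have "at t within {0..T} = at t within {0..}"
    by (rule at_within_nhd[of t "{..<T}"]) (auto simp: T_def)
  ultimately show "((\<lambda>s. Y s x) has_vector_derivative - b (Y t x)) (at t within {0..})" by simp
qed

lemma lipschitz_flow_Y: "lipschitz_flow (\<lambda>x. - b x) Y K M"
proof
  show "norm (- b x - - b y) \<le> K * norm (x - y)" for x y
    using lip[of x y] by (simp add: norm_minus_commute)
qed (use K bd flow_of_Y in auto)

lemma X_joint_continuous: "continuous_on ({0..} \<times> UNIV) (\<lambda>(t, x). X t x)"
  unfolding continuous_on_def
proof (intro ballI)
  fix p :: "real \<times> 'a" assume p: "p \<in> {0..} \<times> UNIV"
  obtain t0 x0 where p0: "p = (t0, x0)" "0 \<le> t0" using p by (cases p) auto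
  let ?F = "at (t0, x0) within {0..} \<times> UNIV"
  have ev: "\<forall>\<^sub>F q in ?F. norm ((case q of (t, x) \<Rightarrow> X t x) - X t0 x0) \<le> exp (K * fst q) * norm (snd q - x0) + M * \<bar>fst q - t0\<bar>"
    unfolding eventually_at_filter
  proof (intro always_eventually allI impI)
    fix q :: "real \<times> 'a" assume "q \<noteq> (t0, x0)" "q \<in> {0..} \<times> UNIV"
    then obtain t x where q: "q = (t, x)" "0 \<le> t" by (cases q) auto
    have "norm (X t x - X t0 x0) \<le> norm (X t x - X t x0) + norm (X t x0 - X t0 x0)"
      using norm_triangle_ineq[of "X t x - X t x0" "X t x0 - X t0 x0"] by simp
    also have "\<dots> \<le> exp (K * t) * norm (x - x0) + M * \<bar>t - t0\<bar>"
      by (intro add_mono X_lipschitz X_time_lipschitz q p0)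
    finally show "norm ((case q of (t, x) \<Rightarrow> X t x) - X t0 x0) \<le> exp (K * fst q) * norm (snd q - x0) + M * \<bar>fst q - t0\<bar>"
      by (simp add: q)
  qed
  have id: "((\<lambda>q. q) \<longlongrightarrow> (t0, x0)) ?F" by (rule tendsto_ident_at)
  have f: "(fst \<longlongrightarrow> t0) ?F" "(snd \<longlongrightarrow> x0) ?F" using tendsto_fst[OF id] tendsto_snd[OF id] by auto
  have "((\<lambda>q. exp (K * fst q) * norm (snd q - x0) + M * \<bar>fst q - t0\<bar>) \<longlongrightarrow> exp (K * t0) * norm (x0 - x0) + M * \<bar>t0 - t0\<bar>) ?F"
    by (intro tendsto_intros f)
  then have "((\<lambda>q. (case q of (t, x) \<Rightarrow> X t x) - X t0 x0) \<longlongrightarrow> 0) ?F"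
    by (intro Lim_null_comparison[OF ev]) simp
  then show "((\<lambda>(t, x). X t x) \<longlongrightarrow> (case p of (t, x) \<Rightarrow> X t x)) (at p within {0..} \<times> UNIV)"
    unfolding p0 by (subst Lim_null) simp
qed

lemma X_continuous_space: "0 \<le> t \<Longrightarrow> continuous_on UNIV (X t)"
  by (rule continuous_on_compose2[OF X_joint_continuous, of UNIV "\<lambda>x. (t, x)", simplified])
     (auto intro!: continuous_intros)

lemma X_measurable: "0 \<le> t \<Longrightarrow> X t \<in> borel_measurable borel"
  by (rule borel_measurable_continuous_onI[OF X_continuous_space])

lemma X_near: "0 \<le> t \<Longrightarrow> norm (X t x - x) \<le> M * t"
  using X_time_lipschitz[of 0 t x] by simp

text \<open>Up to time h the trajectory moves by at most M h, so its velocity deviates from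
  \<open>b x\<close> by at most K M h; integration gives the second factor h.\<close>

lemma X_euler:
  assumes h: "0 \<le> h" shows "norm (X h x - (x + h *\<^sub>R b x)) \<le> K * M * h * h"
proof -
  have "norm ((X h x - h *\<^sub>R b x) - (X 0 x - 0 *\<^sub>R b x)) \<le> K * (M * h) * (h - 0)"
  proof (rule vector_derivative_norm_bound[OF h, where f'="\<lambda>t. b (X t x) - 1 *\<^sub>R b x"])
    fix t assume t: "t \<in> {0..h}"
    have "((\<lambda>t. t *\<^sub>R b x) has_vector_derivative 1 *\<^sub>R b x) (at t within {0..h})"
      unfolding has_vector_derivative_def by (auto intro!: derivative_eq_intros)
    then show "((\<lambda>t. X t x - t *\<^sub>R b x) has_vector_derivative b (X t x) - 1 *\<^sub>R b x) (at t within {0..h})"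
      by (intro has_vector_derivative_diff X_deriv_Icc t)
    have "norm (X t x - x) \<le> M * h" using X_near[of t x] t M mult_left_mono[of t h M] by auto
    then show "norm (b (X t x) - 1 *\<^sub>R b x) \<le> K * (M * h)"
      using lip[of "X t x" x] mult_left_mono[OF _ K, of "norm (X t x - x)" "M * h"] by simp
  qed
  then show ?thesis by (simp add: algebra_simps)
qed

end

section \<open>Liouville's formula\<close>

text \<open>The error constant depends on \<open>N\<close> and \<open>S\<close> alone. This
  uniformity is what allows one constant for the Jacobian matrices at all points.\<close>

lemma prod_near_one:
  fixes N :: real
  assumes N: "0 \<le> N"
  shows "finite S \<Longrightarrow> \<exists>C\<ge>0. \<forall>a h. (\<forall>i\<in>S. \<bar>a i\<bar> \<le> N) \<longrightarrow> 0 \<le> h \<longrightarrow> h \<le> 1 \<longrightarrow>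
    \<bar>(\<Prod>i\<in>S. 1 + h * a i) - (1 + h * (\<Sum>i\<in>S. a i))\<bar> \<le> C * h\<^sup>2"
proof (induction S rule: finite_induct)
  case (insert x S)
  then obtain C where C: "0 \<le> C" "\<And>a h. (\<forall>i\<in>S. \<bar>a i\<bar> \<le> N) \<Longrightarrow> 0 \<le> h \<Longrightarrow> h \<le> 1 \<Longrightarrow>
    \<bar>(\<Prod>i\<in>S. 1 + h * a i) - (1 + h * (\<Sum>i\<in>S. a i))\<bar> \<le> C * h\<^sup>2" by metis
  \<comment> \<open>The new factor adds \<open>h * a x\<close> times \<open>P - 1\<close>, and
    \<open>\<bar>P - 1\<bar>\<close> is at most \<open>h * (C + card S * N)\<close> for h at most
    1.\<close>
  let ?D = "C + N * (C + real (card S) * N)"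
  show ?case
  proof (intro exI[of _ ?D] conjI allI impI)
    show "0 \<le> ?D" using C(1) N by simp
    fix a and h :: real
    assume a: "\<forall>i\<in>insert x S. \<bar>a i\<bar> \<le> N" and h: "0 \<le> h" "h \<le> 1"
    define P s where "P = (\<Prod>i\<in>S. 1 + h * a i)" and "s = (\<Sum>i\<in>S. a i)"
    have 1: "\<bar>P - (1 + h * s)\<bar> \<le> C * h\<^sup>2" using C(2)[of a h] a h by (simp add: P_def s_def)
    have s: "\<bar>s\<bar> \<le> real (card S) * N"
      unfolding s_def using a by (intro order_trans[OF sum_abs sum_bounded_above]) auto
    have "C * h\<^sup>2 \<le> C * h" using h C(1) by (intro mult_left_mono) (auto simp: power2_eq_square mult_left_le_one_le)
    moreover have "\<bar>h * s\<bar> \<le> h * (real (card S) * N)" using s h by (simp add: abs_mult mult_left_mono)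
    ultimately have 2: "\<bar>P - 1\<bar> \<le> h * (C + real (card S) * N)" using 1 by (simp add: algebra_simps)
    have "\<bar>h * a x * (P - 1)\<bar> \<le> (h * N) * (h * (C + real (card S) * N))"
      unfolding abs_mult[of "h * a x"] using a h N by (intro mult_mono 2) (auto simp: abs_mult mult_left_mono)
    moreover have "(\<Prod>i\<in>insert x S. 1 + h * a i) - (1 + h * (\<Sum>i\<in>insert x S. a i)) = (P - (1 + h * s)) + h * a x * (P - 1)"
      using insert.hyps by (simp add: P_def[symmetric] s_def[symmetric] algebra_simps)
    ultimately have "\<bar>(\<Prod>i\<in>insert x S. 1 + h * a i) - (1 + h * (\<Sum>i\<in>insert x S. a i))\<bar>
       \<le> C * h\<^sup>2 + (h * N) * (h * (C + real (card S) * N))" using 1 by linarith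
    also have "\<dots> = ?D * h\<^sup>2" by (simp add: algebra_simps power2_eq_square)
    finally show "\<bar>(\<Prod>i\<in>insert x S. 1 + h * a i) - (1 + h * (\<Sum>i\<in>insert x S. a i))\<bar> \<le> ?D * h\<^sup>2" .
  qed
qed (auto intro!: exI[of _ 0])

text \<open>A permutation other than the identity moves at least two indices, so its term contains
  two off-diagonal entries, each of order h. The identity term is the product treated in
  \<open>prod_near_one\<close>.\<close>

lemma det_near_identity:
  fixes N :: real
  assumes N: "0 \<le> N"
  shows "\<exists>C\<ge>0. \<forall>(A::real^'n::finite^'n) h. (\<forall>i j. \<bar>A $ i $ j\<bar> \<le> N) \<longrightarrow> 0 \<le> h \<longrightarrow> h \<le> 1 \<longrightarrow>
    \<bar>det (mat 1 + h *\<^sub>R A) - (1 + h * (\<Sum>i\<in>UNIV. A $ i $ i))\<bar> \<le> C * h\<^sup>2"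
proof -
  let ?U = "UNIV :: 'n set" let ?Q = "{p. p permutes ?U} - {id}"
  let ?M = "N\<^sup>2 * (1 + N) ^ CARD('n)"
  obtain C where C: "0 \<le> C" "\<And>a h. (\<forall>i. \<bar>a i\<bar> \<le> N) \<Longrightarrow> 0 \<le> h \<Longrightarrow> h \<le> 1 \<Longrightarrow>
    \<bar>(\<Prod>i\<in>?U. 1 + h * a i) - (1 + h * (\<Sum>i\<in>?U. a i))\<bar> \<le> C * h\<^sup>2"
    using prod_near_one[OF N, of ?U] by auto
  have fin: "finite {p. p permutes ?U}" by (rule finite_permutations) simp
  show ?thesis
  proof (intro exI[of _ "C + real (card ?Q) * ?M"] conjI allI impI)
    show "0 \<le> C + real (card ?Q) * ?M" using C N by simp
    fix A :: "real^'n^'n" and h :: real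
    assume A: "\<forall>i j. \<bar>A $ i $ j\<bar> \<le> N" and h: "0 \<le> h" "h \<le> 1"
    let ?B = "mat 1 + h *\<^sub>R A"
    let ?t = "\<lambda>p. of_int (sign p) * (\<Prod>i\<in>?U. ?B $ i $ p i)"
    have tb: "\<bar>?t p\<bar> \<le> ?M * h\<^sup>2" if p: "p \<in> ?Q" for p
    proof -
      have inj: "inj p" using p permutes_inj by auto
      obtain i where i: "p i \<noteq> i" using p by (auto simp: fun_eq_iff)
      define j where "j = p i"
      have j: "p j \<noteq> j" "j \<noteq> i" using i inj by (auto simp: j_def dest: injD)
      let ?c = "\<lambda>k. \<bar>?B $ k $ p k\<bar>"
      have hA: "\<bar>h * A $ k $ l\<bar> \<le> h * N" for k l using A h by (simp add: abs_mult mult_left_mono)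
      have off: "?c k \<le> h * N" if "p k \<noteq> k" for k
        using hA[of k "p k"] that by (simp add: mat_def)
      have "h * N \<le> N" using h N by (simp add: mult_left_le_one_le)
      then have all: "?c k \<le> 1 + N" for k
        using hA[of k "p k"] N by (cases "p k = k") (auto simp: mat_def)
      have "(\<Prod>k\<in>?U - {i} - {j}. ?c k) \<le> (\<Prod>k\<in>?U - {i} - {j}. 1 + N)"
        by (intro prod_mono conjI all) auto
      also have "\<dots> \<le> (1 + N) ^ CARD('n)"
        unfolding prod_constant using N by (intro power_increasing card_mono) auto
      finally have r: "(\<Prod>k\<in>?U - {i} - {j}. ?c k) \<le> (1 + N) ^ CARD('n)" .
      have "\<bar>?t p\<bar> = (\<Prod>k\<in>?U. ?c k)" by (simp add: abs_mult abs_prod sign_def)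
      also have "\<dots> = ?c i * (?c j * (\<Prod>k\<in>?U - {i} - {j}. ?c k))"
        using j by (simp add: prod.remove[of ?U i] prod.remove[of "?U - {i}" j])
      also have "\<dots> \<le> (h * N) * ((h * N) * (1 + N) ^ CARD('n))"
        using h N by (intro mult_mono off i j r mult_nonneg_nonneg prod_nonneg) auto
      also have "\<dots> = ?M * h\<^sup>2" by (simp add: power2_eq_square)
      finally show ?thesis .
    qed
    have "det ?B = ?t id + (\<Sum>p\<in>?Q. ?t p)"
      unfolding det_def by (rule sum.remove[OF fin]) (simp add: permutes_id)
    moreover have "?t id = (\<Prod>i\<in>?U. 1 + h * A $ i $ i)" by (simp add: mat_def)
    moreover have "\<bar>\<Sum>p\<in>?Q. ?t p\<bar> \<le> real (card ?Q) * (?M * h\<^sup>2)"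
      using sum_abs[of ?t ?Q] sum_bounded_above[of ?Q "\<lambda>p. \<bar>?t p\<bar>" "?M * h\<^sup>2", OF tb] by linarith
    moreover have "\<bar>(\<Prod>i\<in>?U. 1 + h * A $ i $ i) - (1 + h * (\<Sum>i\<in>?U. A $ i $ i))\<bar> \<le> C * h\<^sup>2"
      using C(2)[of "\<lambda>i. A $ i $ i" h] A h by simp
    ultimately have "\<bar>det ?B - (1 + h * (\<Sum>i\<in>?U. A $ i $ i))\<bar> \<le> C * h\<^sup>2 + real (card ?Q) * (?M * h\<^sup>2)"
      by linarith
    then show "\<bar>det ?B - (1 + h * (\<Sum>i\<in>?U. A $ i $ i))\<bar> \<le> (C + real (card ?Q) * ?M) * h\<^sup>2"
      by (simp add: algebra_simps)
  qed
qed

lemma exp_near_one: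
  fixes x :: real
  assumes "\<bar>x\<bar> \<le> 1" shows "\<bar>exp x - (1 + x)\<bar> \<le> x\<^sup>2"
proof -
  have "exp x \<le> 1 + x + x\<^sup>2"
  proof (cases "0 \<le> x")
    case True then show ?thesis using exp_bound[of x] assms by simp
  next
    case False
    \<comment> \<open>For negative x, the product equals \<open>1 - x ^ 3\<close>; together with
      \<open>1 - x \<le> exp (- x)\<close> this bounds \<open>exp x\<close> from above.\<close>
    have "1 \<le> (1 - x) * (1 + x + x\<^sup>2)"
    proof -
      have "(1 - x) * (1 + x + x\<^sup>2) = 1 - x ^ 3" by (simp add: algebra_simps power2_eq_square power3_eq_cube)
      moreover have "x ^ 3 \<le> 0" using False by (simp add: power_le_zero_eq)
      ultimately show ?thesis by simp
    qed
    moreover have "1 - x \<le> exp (- x)" using exp_ge_add_one_self[of "- x"] by simp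
    moreover have "0 \<le> 1 + x + x\<^sup>2" using assms zero_le_power2[of x] by linarith
    ultimately have "1 \<le> exp (- x) * (1 + x + x\<^sup>2)"
      by (meson mult_right_mono order_trans)
    then show ?thesis by (simp add: exp_minus field_simps)
  qed
  moreover have "1 + x \<le> exp x" by (rule exp_ge_add_one_self)
  ultimately show ?thesis by simp
qed

text \<open>Telescoping, one factor exchanged at a time. In the application \<open>A\<close> is the
  exponential of a multiple of h, so \<open>A ^ n\<close> stays bounded when n h is fixed.\<close>

lemma prod_diff_bound:
  fixes a c :: "nat \<Rightarrow> real"
  assumes "\<And>k. k < n \<Longrightarrow> \<bar>a k\<bar> \<le> A" "\<And>k. k < n \<Longrightarrow> \<bar>c k\<bar> \<le> A" "\<And>k. k < n \<Longrightarrow> \<bar>a k - c k\<bar> \<le> e" "1 \<le> A"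
  shows "\<bar>(\<Prod>k<n. a k) - (\<Prod>k<n. c k)\<bar> \<le> real n * e * A ^ n"
  using assms(1-3)
proof (induction n)
  case (Suc n)
  have e: "0 \<le> e" using Suc.prems(3)[of n] by simp
  have IH: "\<bar>(\<Prod>k<n. a k) - (\<Prod>k<n. c k)\<bar> \<le> real n * e * A ^ n" using Suc by simp
  have "\<bar>\<Prod>k<n. c k\<bar> \<le> (\<Prod>k<n. A)" unfolding abs_prod by (intro prod_mono) (use Suc in auto)
  then have pc: "\<bar>\<Prod>k<n. c k\<bar> \<le> A ^ n" by simp
  have "(\<Prod>k<Suc n. a k) - (\<Prod>k<Suc n. c k) = ((\<Prod>k<n. a k) - (\<Prod>k<n. c k)) * a n + (\<Prod>k<n. c k) * (a n - c n)"
    by (simp add: algebra_simps)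
  also have "\<bar>\<dots>\<bar> \<le> \<bar>(\<Prod>k<n. a k) - (\<Prod>k<n. c k)\<bar> * \<bar>a n\<bar> + \<bar>\<Prod>k<n. c k\<bar> * \<bar>a n - c n\<bar>"
    by (rule order_trans[OF abs_triangle_ineq]) (simp add: abs_mult)
  also have "\<dots> \<le> (real n * e * A ^ n) * A + A ^ n * e"
    using e assms(4) by (intro add_mono mult_mono IH pc Suc.prems) auto
  also have "\<dots> \<le> (real n * e * A ^ n) * A + (A ^ n * e) * A"
    using e assms(4) mult_left_mono[of 1 A "A ^ n * e"] by simp
  also have "\<dots> = real (Suc n) * e * A ^ Suc n" by (simp add: algebra_simps)
  finally show ?case .
qed simp

lemma joint_continuousI:
  fixes f :: "real \<Rightarrow> 'a::metric_space \<Rightarrow> 'b::real_normed_vector"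
  assumes L: "\<And>s t x. s \<in> S \<Longrightarrow> t \<in> S \<Longrightarrow> norm (f t x - f s x) \<le> L * \<bar>t - s\<bar>"
    and c: "\<And>t. t \<in> S \<Longrightarrow> continuous_on UNIV (f t)"
  shows "continuous_on (S \<times> UNIV) (\<lambda>(t, x). f t x)"
  unfolding continuous_on_def
proof (intro ballI)
  fix p :: "real \<times> 'a" assume p: "p \<in> S \<times> UNIV"
  obtain t0 x0 where p0: "p = (t0, x0)" "t0 \<in> S" using p by (cases p) auto
  let ?F = "at (t0, x0) within S \<times> UNIV"
  have ev: "\<forall>\<^sub>F q in ?F. norm ((case q of (t, x) \<Rightarrow> f t x) - f t0 (snd q)) \<le> L * \<bar>fst q - t0\<bar>"
    unfolding eventually_at_filter
    by (intro always_eventually allI impI) (use L p0 in auto)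
  have id: "((\<lambda>q. q) \<longlongrightarrow> (t0, x0)) ?F" by (rule tendsto_ident_at)
  have f: "(fst \<longlongrightarrow> t0) ?F" "(snd \<longlongrightarrow> x0) ?F" using tendsto_fst[OF id] tendsto_snd[OF id] by auto
  have "((\<lambda>q. L * \<bar>fst q - t0\<bar>) \<longlongrightarrow> L * \<bar>t0 - t0\<bar>) ?F"
    by (intro tendsto_intros f)
  then have 1: "((\<lambda>q. (case q of (t, x) \<Rightarrow> f t x) - f t0 (snd q)) \<longlongrightarrow> 0) ?F"
    by (intro Lim_null_comparison[OF ev]) simp
  have "isCont (f t0) x0" using c[OF p0(2)] by (simp add: continuous_on_eq_continuous_at)
  then have 2: "((\<lambda>q. f t0 (snd q)) \<longlongrightarrow> f t0 x0) ?F" by (rule isCont_tendsto_compose[OF _ f(2)])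
  show "((\<lambda>(t, x). f t x) \<longlongrightarrow> (case p of (t, x) \<Rightarrow> f t x)) (at p within S \<times> UNIV)"
    unfolding p0 using tendsto_add[OF 1 2] by (simp add: case_prod_unfold)
qed

lemma continuous_on_section:
  assumes c: "continuous_on (S \<times> UNIV) (\<lambda>(t, x). f t x)" and t: "t \<in> S"
  shows "continuous_on UNIV (f t)"
proof -
  have "continuous_on UNIV (\<lambda>x. (t, x))" by (intro continuous_intros)
  moreover have "range (\<lambda>x. (t, x)) \<subseteq> S \<times> UNIV" using t by auto
  ultimately show ?thesis using continuous_on_compose2[OF c] by fastforce
qed

lemma compact_support_absolutely_integrable:
  fixes f :: "'a::euclidean_space \<Rightarrow> real"
  assumes c: "continuous_on UNIV f" and s: "\<And>x. f x \<noteq> 0 \<Longrightarrow> norm x \<le> R"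
  shows "f absolutely_integrable_on UNIV" "integrable lborel f"
proof -
  have "set_integrable lborel (cball 0 R) f"
    unfolding set_integrable_def
    by (rule borel_integrable_compact[OF compact_cball]) (rule continuous_on_subset[OF c subset_UNIV])
  moreover have "(\<lambda>x. indicator (cball 0 R) x *\<^sub>R f x) = f" using s by (auto simp: fun_eq_iff indicator_def)
  ultimately show i: "integrable lborel f" by (simp add: set_integrable_def)
  then show "f absolutely_integrable_on UNIV"
    unfolding set_integrable_def by (subst integrable_completion) auto
qed

section \<open>Euler maps and their Jacobian determinants\<close>

definition jacobi_matrix :: "(real^'n \<Rightarrow> real^'n) \<Rightarrow> real^'n \<Rightarrow> real^'n^'n::finite" where
  "jacobi_matrix b x = (\<chi> i j. partial_deriv j (\<lambda>y. b y $ i) x)"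

definition divergence :: "(real^'n \<Rightarrow> real^'n) \<Rightarrow> real^'n::finite \<Rightarrow> real" where
  "divergence b x = (\<Sum>j\<in>UNIV. partial_deriv j (\<lambda>y. b y $ j) x)"

definition euler :: "(real^'n \<Rightarrow> real^'n) \<Rightarrow> real \<Rightarrow> real^'n \<Rightarrow> real^'n::finite" where
  "euler b h z = z + h *\<^sub>R b z"

definition euler_det :: "(real^'n \<Rightarrow> real^'n) \<Rightarrow> real \<Rightarrow> real^'n::finite \<Rightarrow> real" where
  "euler_det b h z = \<bar>det (mat 1 + h *\<^sub>R jacobi_matrix b z)\<bar>"

locale C1_flow = lipschitz_flow b X K M
  for b :: "real^'n::{finite,wellorder} \<Rightarrow> real^'n::_" and X K M +
  assumes C1: "\<And>j. C1_bounded (\<lambda>x. b x $ j)"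
begin

lemma b_partial: "partially_differentiable j (\<lambda>x. b x $ i)"
  "continuous_on UNIV (partial_deriv j (\<lambda>x. b x $ i))" "bounded (range (partial_deriv j (\<lambda>x. b x $ i)))"
  and b_component: "continuous_on UNIV (\<lambda>x. b x $ i)" "bounded (range (\<lambda>x. b x $ i))"
  using C1[of i] by (auto simp: C1_bounded_def)

lemma b_has_derivative: "(b has_derivative (\<lambda>h. jacobi_matrix b x *v h)) (at x)"
proof -
  have "((\<lambda>y. b y $ i) has_derivative (\<lambda>h. (jacobi_matrix b x *v h) $ i)) (at x)" for i
    using has_derivative_of_partials[OF b_partial(1,2), of i x]
    by (simp add: jacobi_matrix_def matrix_vector_mult_def mult.commute)
  then show ?thesis
    by (subst has_derivative_componentwise_within) (auto simp: Basis_cart inner_axis)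
qed

lemma divergence_continuous: "continuous_on UNIV (divergence b)"
  unfolding divergence_def by (intro continuous_on_sum b_partial)

lemma jacobi_matrix_bound: "\<exists>N\<ge>0. \<forall>x i j. \<bar>jacobi_matrix b x $ i $ j\<bar> \<le> N"
proof -
  have "\<exists>B. \<forall>x. \<bar>partial_deriv j (\<lambda>x. b x $ i) x\<bar> \<le> B" for i j
    using b_partial(3)[of j i] unfolding bounded_iff by auto
  note ex = this
  define B where "B i j = (SOME B. \<forall>x. \<bar>partial_deriv j (\<lambda>x. b x $ i) x\<bar> \<le> B)" for i j
  have B: "\<bar>partial_deriv j (\<lambda>x. b x $ i) x\<bar> \<le> B i j" for i j x
    using someI_ex[OF ex[where i=i and j=j]] unfolding B_def by blast
  have B0: "0 \<le> B i j" for i j by (rule order_trans[OF abs_ge_zero B])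
  have "\<bar>jacobi_matrix b x $ i $ j\<bar> \<le> (\<Sum>i\<in>UNIV. \<Sum>j\<in>UNIV. B i j)" for x i j
  proof -
    have "B i j \<le> (\<Sum>j\<in>UNIV. B i j)" by (rule member_le_sum) (auto intro: B0)
    also have "\<dots> \<le> (\<Sum>i\<in>UNIV. \<Sum>j\<in>UNIV. B i j)" by (rule member_le_sum) (auto intro: B0 sum_nonneg)
    finally show ?thesis using B[of j i x] by (simp add: jacobi_matrix_def)
  qed
  moreover have "0 \<le> (\<Sum>i\<in>UNIV. \<Sum>j\<in>UNIV. B i j)" by (intro sum_nonneg B0)
  ultimately show ?thesis by blast
qed

lemma divergence_jacobi_matrix: "divergence b x = (\<Sum>i\<in>UNIV. jacobi_matrix b x $ i $ i)"
  by (simp add: divergence_def jacobi_matrix_def)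

lemma divergence_bound: "\<exists>B\<ge>0. \<forall>x. \<bar>divergence b x\<bar> \<le> B"
proof -
  obtain N where N: "0 \<le> N" "\<And>x i j. \<bar>jacobi_matrix b x $ i $ j\<bar> \<le> N" using jacobi_matrix_bound by auto
  have "\<bar>divergence b x\<bar> \<le> real CARD('n) * N" for x
    unfolding divergence_jacobi_matrix
    by (rule order_trans[OF sum_abs]) (use sum_bounded_above[of UNIV "\<lambda>i. \<bar>jacobi_matrix b x $ i $ i\<bar>" N] N in auto)
  then show ?thesis using N(1) by (intro exI[of _ "real CARD('n) * N"]) auto
qed

lemma euler_has_derivative: "(euler b h has_derivative (\<lambda>v. (mat 1 + h *\<^sub>R jacobi_matrix b x) *v v)) (at x)"
  unfolding euler_def
  by (auto intro!: derivative_eq_intros b_has_derivative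
      simp: matrix_vector_mult_add_rdistrib scaleR_matrix_vector_assoc[symmetric])

lemma euler_inj:
  assumes h: "0 \<le> h" "K * h < 1" shows "inj (euler b h)"
proof (rule injI)
  fix x y assume "euler b h x = euler b h y"
  then have "x - y = h *\<^sub>R (b y - b x)" by (simp add: euler_def algebra_simps)
  then have "norm (x - y) = h * norm (b x - b y)" using h by (simp add: norm_minus_commute)
  also have "\<dots> \<le> h * (K * norm (x - y))" using h lip by (intro mult_left_mono)
  finally have "(1 - K * h) * norm (x - y) \<le> 0" by (simp add: algebra_simps)
  then show "x = y" using h by (simp add: mult_le_0_iff)
qed

lemma euler_surj:
  assumes h: "0 \<le> h" "K * h < 1" shows "surj (euler b h)"
proof -
  have "\<exists>z. euler b h z = y" for y
  proof -
    have "\<exists>!z. y - h *\<^sub>R b z = z"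
    proof (rule banach_fix_type[of "K * h"], use h K in simp, use h in simp, intro allI)
      fix u v
      have "dist (y - h *\<^sub>R b u) (y - h *\<^sub>R b v) = h * norm (b u - b v)"
        using h by (simp add: dist_norm norm_minus_commute scaleR_diff_right[symmetric])
      also have "\<dots> \<le> h * (K * norm (u - v))" using h lip by (intro mult_left_mono)
      finally show "dist (y - h *\<^sub>R b u) (y - h *\<^sub>R b v) \<le> K * h * dist u v" by (simp add: dist_norm mult_ac)
    qed
    then obtain z where "y - h *\<^sub>R b z = z" by blast
    then have "euler b h z = y" unfolding euler_def by (metis diff_add_cancel)
    then show ?thesis ..
  qed
  then show ?thesis by (metis surjI)
qed

text \<open>For K h below 1 the Euler map is a differentiable bijection of the whole space with an
  explicit derivative, so the formula is exact at each step and only the number of steps needs a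
  limit.\<close>

lemma euler_change_of_variables:
  assumes h: "0 \<le> h" "K * h < 1" and phi: "phi absolutely_integrable_on UNIV"
  shows "(\<lambda>z. euler_det b h z * phi (euler b h z)) absolutely_integrable_on UNIV"
    and "integral UNIV (\<lambda>z. euler_det b h z * phi (euler b h z)) = integral UNIV (phi :: _ \<Rightarrow> real)"
proof -
  \<comment> \<open>Scalars are read as vectors of length 1, the form in which the change of
    variables theorem is applied.\<close>
  let ?f = "\<lambda>x. vec (phi x) :: real^1"
  have m: "matrix (\<lambda>v. (mat 1 + h *\<^sub>R jacobi_matrix b x) *v v) = mat 1 + h *\<^sub>R jacobi_matrix b x" for x
    by (rule matrix_of_matrix_vector_mul)
  have "?f absolutely_integrable_on (range (euler b h)) \<and> integral (range (euler b h)) ?f = vec (integral UNIV phi)"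
    using phi by (simp add: euler_surj[OF h] absolutely_integrable_on_1_iff integral_on_1_eq)
  then have "(\<lambda>x. \<bar>det (matrix (\<lambda>v. (mat 1 + h *\<^sub>R jacobi_matrix b x) *v v))\<bar> *\<^sub>R ?f (euler b h x)) absolutely_integrable_on UNIV \<and>
    integral UNIV (\<lambda>x. \<bar>det (matrix (\<lambda>v. (mat 1 + h *\<^sub>R jacobi_matrix b x) *v v))\<bar> *\<^sub>R ?f (euler b h x)) = vec (integral UNIV phi)"
    by (subst has_absolute_integral_change_of_variables)
       (use euler_has_derivative euler_inj[OF h] in auto)
  then show "(\<lambda>z. euler_det b h z * phi (euler b h z)) absolutely_integrable_on UNIV"
    and "integral UNIV (\<lambda>z. euler_det b h z * phi (euler b h z)) = integral UNIV phi"
    unfolding m by (simp_all add: absolutely_integrable_on_1_iff integral_on_1_eq euler_det_def vec_eq_iff)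
qed

lemma euler_iterate:
  assumes h: "0 \<le> h" "K * h < 1" and phi: "phi absolutely_integrable_on UNIV"
  shows "(\<lambda>z. (\<Prod>k<n. euler_det b h ((euler b h ^^ k) z)) * phi ((euler b h ^^ n) z)) absolutely_integrable_on UNIV \<and>
     integral UNIV (\<lambda>z. (\<Prod>k<n. euler_det b h ((euler b h ^^ k) z)) * phi ((euler b h ^^ n) z)) = integral UNIV (phi :: _ \<Rightarrow> real)"
proof (induction n)
  case (Suc n)
  let ?P = "\<lambda>n z. (\<Prod>k<n. euler_det b h ((euler b h ^^ k) z)) * phi ((euler b h ^^ n) z)"
  \<comment> \<open>The first Euler step is split off, so that the integrand for
    \<open>Suc n\<close> is what one change of variables makes of the integrand for
    \<open>n\<close>.\<close>
  have "?P (Suc n) = (\<lambda>z. euler_det b h z * ?P n (euler b h z))"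
    by (rule ext) (simp add: prod.lessThan_Suc_shift funpow_swap1 mult.assoc del: prod.lessThan_Suc)
  then show ?case using euler_change_of_variables[OF h, of "?P n"] Suc by simp
qed (use phi in simp)

lemma euler_move: 
  assumes "0 \<le> h" shows "norm ((euler b h ^^ k) z - z) \<le> M * h * real k"
proof (induction k)
  case (Suc k)
  have "norm ((euler b h ^^ Suc k) z - z) \<le> norm ((euler b h ^^ k) z - z) + norm (h *\<^sub>R b ((euler b h ^^ k) z))"
    using norm_triangle_ineq[of "(euler b h ^^ k) z - z" "h *\<^sub>R b ((euler b h ^^ k) z)"]
    by (simp add: euler_def algebra_simps)
  also have "\<dots> \<le> M * h * real k + h * M"
    using Suc assms bd[of "(euler b h ^^ k) z"] by (intro add_mono) (simp_all add: mult_left_mono)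
  finally show ?case by (simp add: algebra_simps)
qed simp

text \<open>Every step adds a local error K M h^2 and multiplies the error so far by at most 1 + K
  h, which is below exp(K h).\<close>

lemma euler_error:
  assumes h: "0 \<le> h"
  shows "norm ((euler b h ^^ k) z - X (real k * h) z) \<le> K * M * h * h * real k * exp (K * (real k * h))"
proof (induction k)
  case (Suc k)
  let ?y = "(euler b h ^^ k) z" and ?x = "X (real k * h) z"
  have kh: "0 \<le> real k * h" using h by simp
  have X: "X (real (Suc k) * h) z = X h ?x"
    using X_add[OF h kh, of z] by (simp add: algebra_simps)
  have Kh: "0 \<le> K * h" using h K by simp
  have "euler b h ?y - euler b h ?x = (?y - ?x) + h *\<^sub>R (b ?y - b ?x)"
    by (simp add: euler_def algebra_simps)
  then have "norm (euler b h ?y - euler b h ?x) \<le> norm (?y - ?x) + h * norm (b ?y - b ?x)"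
    using norm_triangle_ineq[of "?y - ?x" "h *\<^sub>R (b ?y - b ?x)"] h by simp
  also have "\<dots> \<le> norm (?y - ?x) + h * (K * norm (?y - ?x))" using h lip by (intro add_left_mono mult_left_mono)
  also have "\<dots> = (1 + K * h) * norm (?y - ?x)" by (simp add: algebra_simps)
  also have "\<dots> \<le> exp (K * h) * (K * M * h * h * real k * exp (K * (real k * h)))"
    using Kh by (intro mult_mono Suc exp_ge_add_one_self) auto
  also have "\<dots> = K * M * h * h * real k * exp (K * (real (Suc k) * h))"
    by (simp add: algebra_simps exp_add)
  finally have 1: "norm (euler b h ?y - euler b h ?x) \<le> K * M * h * h * real k * exp (K * (real (Suc k) * h))" .
  have "norm (X h ?x - euler b h ?x) \<le> K * M * h * h" using X_euler[OF h, of ?x] by (simp add: euler_def)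
  also have "\<dots> \<le> K * M * h * h * exp (K * (real (Suc k) * h))"
    using h K M mult_left_mono[of 1 "exp (K * (real (Suc k) * h))" "K * M * h * h"] by simp
  finally have 2: "norm (X h ?x - euler b h ?x) \<le> K * M * h * h * exp (K * (real (Suc k) * h))" .
  have "norm ((euler b h ^^ Suc k) z - X (real (Suc k) * h) z) \<le> norm (euler b h ?y - euler b h ?x) + norm (X h ?x - euler b h ?x)"
    unfolding X funpow.simps comp_def
    using norm_triangle_ineq[of "euler b h ?y - euler b h ?x" "euler b h ?x - X h ?x"]
    by (simp add: norm_minus_commute)
  also have "\<dots> \<le> K * M * h * h * real k * exp (K * (real (Suc k) * h)) + K * M * h * h * exp (K * (real (Suc k) * h))"
    by (rule add_mono[OF 1 2])
  also have "\<dots> = K * M * h * h * real (Suc k) * exp (K * (real (Suc k) * h))" by (simp add: algebra_simps)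
  finally show ?case .
qed simp

text \<open>
  Formally the Jacobian determinant of \<open>X\<^sub>t\<close>; \<open>distr_flow\<close> states this as a change of variables, without
  differentiating the flow.
\<close>

definition jac :: "real \<Rightarrow> real^'n::_ \<Rightarrow> real" where
  "jac t z = exp (integral {0..t} (\<lambda>s. divergence b (X s z)))"

lemma div_path_continuous: "continuous_on {0..} (\<lambda>s. divergence b (X s z))"
  by (rule continuous_on_compose2[OF divergence_continuous X_continuous]) auto

lemma div_path_integrable: "0 \<le> a \<Longrightarrow> (\<lambda>s. divergence b (X s z)) integrable_on {a..c}"
  by (rule integrable_continuous_real) (rule continuous_on_subset[OF div_path_continuous], auto)

lemma sum_integral_steps:
  assumes h: "0 \<le> h"
  shows "(\<Sum>k<j. integral {real k * h..real (Suc k) * h} (\<lambda>s. divergence b (X s z)))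
    = integral {0..real j * h} (\<lambda>s. divergence b (X s z))"
proof (induction j)
  case (Suc j)
  have "integral {0..real j * h} (\<lambda>s. divergence b (X s z)) + integral {real j * h..real (Suc j) * h} (\<lambda>s. divergence b (X s z))
     = integral {0..real (Suc j) * h} (\<lambda>s. divergence b (X s z))"
    using h by (intro Henstock_Kurzweil_Integration.integral_combine div_path_integrable) (auto intro: mult_right_mono)
  then show ?case using Suc by simp
qed simp

lemma euler_tendsto:
  assumes t: "0 \<le> t"
  shows "(\<lambda>n. (euler b (t / real n) ^^ n) z) \<longlonglongrightarrow> X t z"
proof -
  have "\<forall>\<^sub>F n in sequentially. norm ((euler b (t / real n) ^^ n) z - X t z) \<le> K * M * t * exp (K * t) * (t / real n)"
    using eventually_gt_at_top[of 0]
  proof eventually_elim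
    case (elim n)
    then have n: "real n * (t / real n) = t" by simp
    from euler_error[of "t / real n" n z, unfolded n] t elim show ?case by (simp add: mult_ac)
  qed
  moreover have "(\<lambda>n. K * M * t * exp (K * t) * (t / real n)) \<longlonglongrightarrow> 0"
    using tendsto_mult_left[OF lim_const_over_n[of t], of "K * M * t * exp (K * t)"] by simp
  ultimately have "(\<lambda>n. (euler b (t / real n) ^^ n) z - X t z) \<longlonglongrightarrow> 0"
    by (rule Lim_null_comparison)
  then show ?thesis by (rule LIM_zero_cancel)
qed

lemma euler_det_near: 
  "\<exists>C\<ge>0. \<forall>h z B. 0 \<le> h \<longrightarrow> h \<le> 1 \<longrightarrow> (\<forall>x. \<bar>divergence b x\<bar> \<le> B) \<longrightarrow>
     \<bar>euler_det b h z\<bar> \<le> exp (h * (B + C)) \<and> (h * B \<le> 1 \<longrightarrow> \<bar>euler_det b h z - (1 + h * divergence b z)\<bar> \<le> C * h\<^sup>2)"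
proof -
  obtain N where N: "0 \<le> N" "\<And>x i j. \<bar>jacobi_matrix b x $ i $ j\<bar> \<le> N" using jacobi_matrix_bound by auto
  obtain C where C: "0 \<le> C" and C': "\<And>(A::real^'n::_^'n::_) h. (\<forall>i j. \<bar>A $ i $ j\<bar> \<le> N) \<Longrightarrow> 0 \<le> h \<Longrightarrow> h \<le> 1 \<Longrightarrow>
    \<bar>det (mat 1 + h *\<^sub>R A) - (1 + h * (\<Sum>i\<in>UNIV. A $ i $ i))\<bar> \<le> C * h\<^sup>2"
    using det_near_identity[OF N(1), where 'n='n] by auto
  have C2: "\<bar>det (mat 1 + h *\<^sub>R jacobi_matrix b z) - (1 + h * divergence b z)\<bar> \<le> C * h\<^sup>2" if "0 \<le> h" "h \<le> 1" for h z
    unfolding divergence_jacobi_matrix by (rule C') (use N(2) that in auto)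
  show ?thesis
  proof (intro exI[of _ C] conjI allI impI)
    fix h B :: real and z :: "real^'n::_"
    assume h: "0 \<le> h" "h \<le> 1" and B: "\<forall>x. \<bar>divergence b x\<bar> \<le> B"
    note c = C2[OF h, of z]
    have hd: "\<bar>h * divergence b z\<bar> \<le> h * B" using B h by (simp add: abs_mult mult_left_mono)
    have "C * h\<^sup>2 \<le> C * h" using h C by (intro mult_left_mono) (auto simp: power2_eq_square mult_left_le_one_le)
    then have "\<bar>euler_det b h z\<bar> \<le> 1 + h * (B + C)"
      using c hd unfolding euler_det_def by (simp add: algebra_simps)
    also have "\<dots> \<le> exp (h * (B + C))" by (rule exp_ge_add_one_self)
    finally show "\<bar>euler_det b h z\<bar> \<le> exp (h * (B + C))" .
    \<comment> \<open>Here \<open>1 + h * divergence b z\<close> is nonnegative, so passing to the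
      absolute value of the determinant does not increase the error.\<close>
    show "\<bar>euler_det b h z - (1 + h * divergence b z)\<bar> \<le> C * h\<^sup>2" if "h * B \<le> 1"
      using c hd that unfolding euler_det_def by linarith
  qed (rule C)
qed

text \<open>Each determinant is compared with the exponential of the divergence integrated over one
  time step. The divergence is merely continuous, so its oscillation enters as a small number
  \<open>e'\<close> and not as a rate in h.\<close>

lemma euler_det_tendsto:
  assumes t: "0 \<le> t"
  shows "(\<lambda>n. \<Prod>k<n. euler_det b (t / real n) ((euler b (t / real n) ^^ k) z)) \<longlonglongrightarrow> jac t z"
proof (rule tendstoI)
  fix e :: real assume e: "0 < e"
  obtain B where B: "0 \<le> B" "\<And>x. \<bar>divergence b x\<bar> \<le> B" using divergence_bound by auto
  obtain C where C: "0 \<le> C"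
    "\<And>h z. 0 \<le> h \<Longrightarrow> h \<le> 1 \<Longrightarrow> \<bar>euler_det b h z\<bar> \<le> exp (h * (B + C))"
    "\<And>h z. 0 \<le> h \<Longrightarrow> h \<le> 1 \<Longrightarrow> h * B \<le> 1 \<Longrightarrow> \<bar>euler_det b h z - (1 + h * divergence b z)\<bar> \<le> C * h\<^sup>2"
    using euler_det_near B(2) by metis
  \<comment> \<open>Makes the accumulated contribution \<open>t * e' * exp (t * (B + C))\<close>
    smaller than \<open>e\<close>, with 2 (t + 1) in the denominator also covering t = 0.\<close>
  define e' where "e' = e / (2 * (t + 1) * exp (t * (B + C)))"
  have e': "0 < e'" using e t by (simp add: e'_def)
  \<comment> \<open>During one time step the trajectory stays within \<open>c * h\<close> of the
    Euler point: the Euler error gives the first summand and the motion within the step gives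
    \<open>M\<close>.\<close>
  define c where "c = K * M * t * exp (K * t) + M"
  have c: "0 \<le> c" using K M t by (simp add: c_def)
  \<comment> \<open>Speed at most \<open>M\<close> keeps the trajectory and the Euler points in this
    ball up to time \<open>t\<close>; by compactness the divergence is uniformly continuous
    there.\<close>
  let ?S = "cball z (M * t)"
  have "uniformly_continuous_on ?S (divergence b)"
    by (intro compact_uniformly_continuous compact_cball continuous_on_subset[OF divergence_continuous]) auto
  then obtain d where d: "0 < d" "\<And>x y. x \<in> ?S \<Longrightarrow> y \<in> ?S \<Longrightarrow> dist y x < d \<Longrightarrow> dist (divergence b y) (divergence b x) < e'"
    unfolding uniformly_continuous_on_def using e' by metis
  let ?h = "\<lambda>n. t / real n"
  \<comment> \<open>The three summands come from the expansion of the determinant, the oscillation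
    of the divergence and the expansion of the exponential.\<close>
  let ?err = "\<lambda>n. t * (C * ?h n + e' + ?h n * B\<^sup>2) * exp (t * (B + C))"
  have h0: "?h \<longlonglongrightarrow> 0" by (rule lim_const_over_n)
  have "?err \<longlonglongrightarrow> t * (C * 0 + e' + 0 * B\<^sup>2) * exp (t * (B + C))"
    by (intro tendsto_intros h0)
  moreover have "t * (C * 0 + e' + 0 * B\<^sup>2) * exp (t * (B + C)) < e"
  proof -
    have "t * e' * exp (t * (B + C)) = e * (t / (2 * (t + 1)))" using t by (simp add: e'_def)
    also have "\<dots> < e * 1" using e t by (intro mult_strict_left_mono) (auto simp: divide_simps)
    finally show ?thesis by simp
  qed
  ultimately have ev1: "\<forall>\<^sub>F n in sequentially. ?err n < e" by (rule order_tendstoD(2))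
  have ev2: "\<forall>\<^sub>F n in sequentially. ?h n < 1" by (rule order_tendstoD(2)[OF h0]) simp
  have ev3: "\<forall>\<^sub>F n in sequentially. ?h n * B < 1"
    by (rule order_tendstoD(2)[OF tendsto_mult_right[OF h0]]) simp
  have ev4: "\<forall>\<^sub>F n in sequentially. c * ?h n < d"
    by (rule order_tendstoD(2)[OF tendsto_mult_left[OF h0]]) (simp add: d)
  show "\<forall>\<^sub>F n in sequentially. dist (\<Prod>k<n. euler_det b (t / real n) ((euler b (t / real n) ^^ k) z)) (jac t z) < e"
    using ev1 ev2 ev3 ev4 eventually_gt_at_top[of 0]
  proof eventually_elim
    case (elim n)
    define h where "h = t / real n"
    have h: "0 \<le> h" "h \<le> 1" "h * B \<le> 1" "c * h < d" and nh: "real n * h = t"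
      using elim t by (auto simp: h_def)
    let ?y = "\<lambda>k. (euler b h ^^ k) z" and ?f = "\<lambda>s. divergence b (X s z)"
    let ?I = "\<lambda>k. integral {real k * h..real (Suc k) * h} ?f"
    have jac: "jac t z = (\<Prod>k<n. exp (?I k))"
      unfolding jac_def exp_sum[symmetric, OF finite_lessThan] sum_integral_steps[OF h(1)] nh ..
    have Ib: "\<bar>?I k\<bar> \<le> h * B" for k
    proof -
      have "norm (?I k) \<le> B * (real (Suc k) * h - real k * h)"
        using h B(2) by (intro integral_bound continuous_on_subset[OF div_path_continuous]) (auto intro: mult_right_mono)
      then show ?thesis by (simp add: algebra_simps)
    qed
    have step: "\<bar>euler_det b h (?y k) - exp (?I k)\<bar> \<le> C * h\<^sup>2 + h * e' + h\<^sup>2 * B\<^sup>2" if k: "k < n" for k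
    proof -
      have kh: "real k * h \<le> t" "real (Suc k) * h \<le> t"
        using k h(1) unfolding nh[symmetric] by (auto intro!: mult_right_mono)
      have yS: "?y k \<in> ?S"
      proof -
        have "M * h * real k \<le> M * t" using mult_left_mono[OF kh(1) M] by (simp add: mult_ac)
        then show ?thesis using euler_move[OF h(1), of k z] by (simp add: dist_norm norm_minus_commute)
      qed
      have err: "norm (?y k - X (real k * h) z) \<le> K * M * t * exp (K * t) * h"
      proof -
        have "norm (?y k - X (real k * h) z) \<le> K * M * h * (real k * h) * exp (K * (real k * h))"
          using euler_error[OF h(1), of k z] by (simp add: mult_ac)
        also have "\<dots> \<le> K * M * h * t * exp (K * t)"
          using kh K M h(1) t by (intro mult_mono) (auto intro: mult_left_mono)
        finally show ?thesis by (simp add: mult_ac)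
      qed
      have pt: "\<bar>?f s - divergence b (?y k)\<bar> \<le> e'" if s: "s \<in> {real k * h..real (Suc k) * h}" for s
      proof -
        have "0 \<le> real k * h" using h(1) by simp
        then have s0: "0 \<le> s" using s by (meson atLeastAtMost_iff order_trans)
        have "M * s \<le> M * t" using s kh M by (intro mult_left_mono) auto
        then have "X s z \<in> ?S" using X_near[OF s0, of z] by (simp add: dist_norm norm_minus_commute)
        moreover have "dist (X s z) (?y k) < d"
        proof -
          have "norm (X s z - X (real k * h) z) \<le> M * \<bar>s - real k * h\<bar>" using s0 h(1) by (intro X_time_lipschitz) auto
          also have "\<dots> \<le> M * h" using s M by (intro mult_left_mono) (auto simp: algebra_simps)
          finally have "norm (X s z - ?y k) \<le> M * h + K * M * t * exp (K * t) * h"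
            using err norm_triangle_ineq[of "X s z - X (real k * h) z" "X (real k * h) z - ?y k"] by (simp add: norm_minus_commute)
          then show ?thesis using h(4) by (simp add: dist_norm c_def algebra_simps)
        qed
        ultimately show ?thesis using d(2)[OF yS, of "X s z"] by (simp add: dist_real_def)
      qed
      have "\<bar>?I k - h * divergence b (?y k)\<bar> \<le> h * e'"
      proof -
        have le: "real k * h \<le> real (Suc k) * h" using h by (simp add: mult_right_mono)
        have "?I k - h * divergence b (?y k) = integral {real k * h..real (Suc k) * h} (\<lambda>s. ?f s - divergence b (?y k))"
          using le h by (subst Henstock_Kurzweil_Integration.integral_diff[OF div_path_integrable]) (auto simp: algebra_simps)
        moreover have "norm (integral {real k * h..real (Suc k) * h} (\<lambda>s. ?f s - divergence b (?y k))) \<le> e' * (real (Suc k) * h - real k * h)"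
          using h pt by (intro integral_bound le continuous_intros continuous_on_subset[OF div_path_continuous]) auto
        ultimately show ?thesis by (simp add: algebra_simps)
      qed
      moreover have "\<bar>euler_det b h (?y k) - (1 + h * divergence b (?y k))\<bar> \<le> C * h\<^sup>2"
        by (rule C(3)) (use h in auto)
      moreover have "\<bar>exp (?I k) - (1 + ?I k)\<bar> \<le> h\<^sup>2 * B\<^sup>2"
      proof -
        have "\<bar>exp (?I k) - (1 + ?I k)\<bar> \<le> (?I k)\<^sup>2" using Ib[of k] h by (intro exp_near_one) linarith
        also have "\<dots> \<le> (h * B)\<^sup>2" using Ib[of k] by (rule power2_le_iff_abs_le[THEN iffD2, rotated]) (use h B in auto)
        finally show ?thesis by (simp add: power_mult_distrib)
      qed
      ultimately show ?thesis by linarith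
    qed
    have "\<bar>(\<Prod>k<n. euler_det b h (?y k)) - (\<Prod>k<n. exp (?I k))\<bar> \<le> real n * (C * h\<^sup>2 + h * e' + h\<^sup>2 * B\<^sup>2) * exp (h * (B + C)) ^ n"
    proof (rule prod_diff_bound)
      fix k assume "k < n"
      show "\<bar>euler_det b h (?y k)\<bar> \<le> exp (h * (B + C))" by (rule C(2)) (use h in auto)
      have "h * B \<le> h * (B + C)" using h C by (intro mult_left_mono) auto
      then show "\<bar>exp (?I k)\<bar> \<le> exp (h * (B + C))" using Ib[of k] by simp
    qed (use step h B C in auto)
    also have "exp (h * (B + C)) ^ n = exp (t * (B + C))"
      by (simp add: exp_of_nat_mult[symmetric] nh[symmetric] mult.assoc)
    also have "real n * (C * h\<^sup>2 + h * e' + h\<^sup>2 * B\<^sup>2) = t * (C * h + e' + h * B\<^sup>2)"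
      unfolding nh[symmetric] by (simp add: algebra_simps power2_eq_square)
    also have "t * (C * h + e' + h * B\<^sup>2) * exp (t * (B + C)) < e" using elim(1) by (simp add: h_def)
    finally show ?case by (simp add: dist_real_def jac h_def[symmetric])
  qed
qed

text \<open>For Euler iterates the identity is exact, and the limit is taken inside the
  integral.\<close>

lemma liouville_compact:
  assumes t: "0 \<le> t" and c: "continuous_on UNIV psi" and s: "\<And>x. psi x \<noteq> (0::real) \<Longrightarrow> norm x \<le> R"
  shows "((\<lambda>z. jac t z * psi (X t z)) has_integral integral UNIV psi) UNIV"
proof -
  obtain B where B: "0 \<le> B" "\<And>x. \<bar>divergence b x\<bar> \<le> B" using divergence_bound by auto
  obtain C where C: "0 \<le> C" "\<And>h z. 0 \<le> h \<Longrightarrow> h \<le> 1 \<Longrightarrow> \<bar>euler_det b h z\<bar> \<le> exp (h * (B + C))"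
    using euler_det_near B(2) by metis
  \<comment> \<open>Starting the sequence at \<open>N\<close> steps ensures h at most 1 and K h
    below 1 for all of its terms, as the change of variables and the domination require.\<close>
  obtain N :: nat where N: "(K + 1) * t + 1 \<le> real N" using real_arch_simple by blast
  have "bounded (psi ` cball 0 R)"
    by (intro compact_imp_bounded compact_continuous_image compact_cball continuous_on_subset[OF c]) auto
  then obtain P where "\<forall>x\<in>cball 0 R. \<bar>psi x\<bar> \<le> P" unfolding bounded_iff by auto
  then have P: "\<And>x. x \<in> cball 0 R \<Longrightarrow> \<bar>psi x\<bar> \<le> P" by blast
  have P': "\<bar>psi x\<bar> \<le> \<bar>P\<bar>" for x using s[of x] P[of x] by (cases "psi x = 0") auto
  let ?m = "\<lambda>n. n + N" let ?h = "\<lambda>n. t / real (?m n)"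
  let ?f = "\<lambda>n z. (\<Prod>k<?m n. euler_det b (?h n) ((euler b (?h n) ^^ k) z)) * psi ((euler b (?h n) ^^ ?m n) z)"
  have Kt: "0 \<le> K * t" using K t by simp
  have m: "1 \<le> real (?m n)" for n using N Kt t by (simp add: algebra_simps)
  have h: "0 \<le> ?h n" "?h n \<le> 1" "K * ?h n < 1" "real (?m n) * ?h n = t" for n
  proof -
    have "(K + 1) * t + 1 \<le> real (?m n)" using N by simp
    then have "K * t < real (?m n)" "t \<le> real (?m n)" using t Kt by (auto simp: algebra_simps)
    then show "0 \<le> ?h n" "?h n \<le> 1" "K * ?h n < 1" "real (?m n) * ?h n = t"
      using m[of n] t by (auto simp: divide_le_eq divide_less_eq)
  qed
  note I = euler_iterate[OF h(1,3) compact_support_absolutely_integrable(1)[OF c s]]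
  have fi: "?f n integrable_on UNIV" "integral UNIV (?f n) = integral UNIV psi" for n
    using I[of n "?m n"] by (auto simp: absolutely_integrable_on_def)
  \<comment> \<open>Iterates displace a point by at most \<open>M * t\<close>, so all integrands
    live in one ball; the exponential bounds the product of determinants and \<open>P\<close> bounds
    \<open>psi\<close>.\<close>
  let ?g = "\<lambda>z. exp (t * (B + C)) * \<bar>P\<bar> * indicator (cball (0 :: real^'n::_) (R + M * t)) z :: real"
  have gi: "?g integrable_on UNIV"
    by (intro integrable_on_lborel integrable_mult_right integrable_real_indicator) (use emeasure_compact_finite[OF compact_cball, of "0 :: real^'n::_" "R + M * t"] in auto)
  have bnd: "norm (?f n z) \<le> ?g z" for n z
  proof (cases "psi ((euler b (?h n) ^^ ?m n) z) = 0")
    case False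
    then have "norm ((euler b (?h n) ^^ ?m n) z) \<le> R" by (rule s)
    moreover have "norm ((euler b (?h n) ^^ ?m n) z - z) \<le> M * t"
    proof -
      have "M * ?h n * real (?m n) = M * t" using h(4)[of n] by (metis mult.assoc mult.commute)
      then show ?thesis using euler_move[OF h(1)[of n], of "?m n" z] by metis
    qed
    ultimately have z: "z \<in> cball 0 (R + M * t)"
      using norm_triangle_sub[of z "(euler b (?h n) ^^ ?m n) z"] by (simp add: norm_minus_commute)
    have "\<bar>\<Prod>k<?m n. euler_det b (?h n) ((euler b (?h n) ^^ k) z)\<bar> \<le> (\<Prod>k<?m n. exp (?h n * (B + C)))"
      unfolding abs_prod by (intro prod_mono conjI C(2)[OF h(1,2)] abs_ge_zero)
    also have "\<dots> = exp (real (?m n) * (?h n * (B + C)))"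
      by (simp only: prod_constant card_lessThan exp_of_nat_mult)
    also have "\<dots> = exp (t * (B + C))" using h(4)[of n] by (metis mult.assoc)
    finally show ?thesis using z P'[of "(euler b (?h n) ^^ ?m n) z"] by (auto simp: abs_mult intro!: mult_mono)
  qed auto
  have lim: "(\<lambda>n. ?f n z) \<longlonglongrightarrow> jac t z * psi (X t z)" for z
  proof (intro tendsto_mult)
    show "(\<lambda>n. \<Prod>k<?m n. euler_det b (?h n) ((euler b (?h n) ^^ k) z)) \<longlonglongrightarrow> jac t z"
      by (rule LIMSEQ_ignore_initial_segment[OF euler_det_tendsto[OF t], of N])
    have "isCont psi (X t z)" using c by (simp add: continuous_on_eq_continuous_at)
    then show "(\<lambda>n. psi ((euler b (?h n) ^^ ?m n) z)) \<longlonglongrightarrow> psi (X t z)"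
      by (rule isCont_tendsto_compose) (rule LIMSEQ_ignore_initial_segment[OF euler_tendsto[OF t], of N])
  qed
  have "(\<lambda>z. jac t z * psi (X t z)) integrable_on UNIV" "(\<lambda>n. integral UNIV (?f n)) \<longlonglongrightarrow> integral UNIV (\<lambda>z. jac t z * psi (X t z))"
    using dominated_convergence[of ?f UNIV ?g "\<lambda>z. jac t z * psi (X t z)"] fi(1) gi bnd lim by auto
  moreover from this(2) have "integral UNIV (\<lambda>z. jac t z * psi (X t z)) = integral UNIV psi"
    unfolding fi(2) by (simp add: LIMSEQ_const_iff)
  ultimately show ?thesis by (metis integrable_integral)
qed

text \<open>In time the integral is Lipschitz with a bound of the divergence as constant, uniformly
  in \<open>z\<close>; at a fixed time it is a parameter integral, continuous in
  \<open>z\<close>.\<close>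

lemma log_jac_joint_continuous:
  "continuous_on ({0..} \<times> UNIV) (\<lambda>(t, z). integral {0..t} (\<lambda>s. divergence b (X s z)))"
proof -
  obtain B where B: "0 \<le> B" "\<And>x. \<bar>divergence b x\<bar> \<le> B" using divergence_bound by auto
  show ?thesis
  proof (rule joint_continuousI[where L=B])
    have *: "norm (integral {0..t} (\<lambda>s. divergence b (X s z)) - integral {0..s} (\<lambda>s. divergence b (X s z))) \<le> B * (t - s)"
      if "0 \<le> s" "s \<le> t" for s t z
    proof -
      have "integral {0..t} (\<lambda>s. divergence b (X s z)) - integral {0..s} (\<lambda>s. divergence b (X s z)) = integral {s..t} (\<lambda>s. divergence b (X s z))"
        using Henstock_Kurzweil_Integration.integral_combine[OF that div_path_integrable, of z] by simp
      then show ?thesis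
        using that B integral_bound[OF that(2) continuous_on_subset[OF div_path_continuous], of z B] by auto
    qed
    show "norm (integral {0..t} (\<lambda>s. divergence b (X s z)) - integral {0..s} (\<lambda>s. divergence b (X s z))) \<le> B * \<bar>t - s\<bar>"
      if "s \<in> {0..}" "t \<in> {0..}" for s t z
      using *[of s t z] *[of t s z] that by (cases "s \<le> t") (auto simp: norm_minus_commute)
    fix t :: real assume "t \<in> {0..}"
    have "continuous_on (UNIV \<times> cbox 0 t) (\<lambda>(z, s). divergence b (X s z))"
      unfolding case_prod_unfold
      by (rule continuous_on_compose2[OF divergence_continuous])
         (auto intro!: continuous_on_compose2[OF X_joint_continuous, of _ "\<lambda>p. (snd p, fst p)", unfolded case_prod_unfold, simplified] continuous_intros)
    from integral_continuous_on_param[OF this]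
    show "continuous_on UNIV (\<lambda>z. integral {0..t} (\<lambda>s. divergence b (X s z)))" by simp
  qed
qed

lemma jac_joint_continuous: "continuous_on ({0..} \<times> UNIV) (\<lambda>(t, z). jac t z)"
  unfolding jac_def using continuous_on_exp[OF log_jac_joint_continuous] by (simp add: case_prod_unfold)

lemma jac_continuous: "0 \<le> t \<Longrightarrow> continuous_on UNIV (jac t)"
  by (rule continuous_on_section[OF jac_joint_continuous]) simp

lemma jac_pos [simp]: "0 < jac t z" "jac t z \<noteq> 0" "0 \<le> jac t z"
  by (auto simp: jac_def)

lemma jac_measurable [measurable]: "0 \<le> t \<Longrightarrow> jac t \<in> borel_measurable borel"
  by (rule borel_measurable_continuous_onI[OF jac_continuous])

text \<open>Boxes determine Lebesgue measure, and the indicator of an open box is a monotone limit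
  of continuous functions with compact support. As an equality of measures the formula applies to
  arbitrary Borel integrands, in particular to indicators of orthants.\<close>

lemma distr_flow:
  assumes t: "0 \<le> t"
  shows "lborel = distr (density lborel (\<lambda>z. ennreal (jac t z))) borel (X t)" (is "_ = ?N")
proof (rule lborel_eqI)
  note [measurable] = jac_measurable[OF t] X_measurable[OF t]
  fix l u :: "real^'n::_" assume le: "\<And>c. c \<in> Basis \<Longrightarrow> l \<bullet> c \<le> u \<bullet> c"
  let ?S = "box l u"
  \<comment> \<open>Continuous, zero outside the box and increasing with \<open>m\<close> to its
    indicator.\<close>
  define psi where "psi m x = min 1 (real m * infdist x (- ?S))" for m :: nat and x
  \<comment> \<open>The distance to the empty set is 0 by convention, so positivity of the distance
    inside the box requires a nonempty complement.\<close>
  have ne: "- ?S \<noteq> {}"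
  proof
    assume "- ?S = {}"
    then have "?S = UNIV" by blast
    then show False using bounded_box[of l u] not_bounded_UNIV by metis
  qed
  have cont: "continuous_on UNIV (psi m)" for m
    unfolding psi_def by (intro continuous_intros)
  have nn: "0 \<le> psi m x" for m x by (simp add: psi_def infdist_nonneg)
  obtain R where R: "\<And>x. x \<in> ?S \<Longrightarrow> norm x \<le> R" using bounded_box[of l u] by (auto simp: bounded_iff)
  have supp: "norm x \<le> R" if "psi m x \<noteq> 0" for m x
    using that R[of x] by (cases "x \<in> ?S") (auto simp: psi_def)
  have eq: "integral\<^sup>N ?N (\<lambda>x. ennreal (psi m x)) = integral\<^sup>N lborel (\<lambda>x. ennreal (psi m x))" for m
  proof -
    note [measurable] = borel_measurable_continuous_onI[OF cont[of m]]
    have "integral\<^sup>N ?N (\<lambda>x. ennreal (psi m x)) = (\<integral>\<^sup>+z. ennreal (jac t z * psi m (X t z)) \<partial>lborel)"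
      by (simp add: nn_integral_distr nn_integral_density ennreal_mult' nn)
    also have "\<dots> = ennreal (integral UNIV (psi m))"
      by (rule nn_integral_has_integral_lborel[OF _ _ liouville_compact[OF t cont supp]]) (auto simp: nn)
    also have "\<dots> = integral\<^sup>N lborel (\<lambda>x. ennreal (psi m x))"
      by (rule nn_integral_has_integral_lborel[symmetric])
         (use compact_support_absolutely_integrable(1)[OF cont supp] nn in \<open>auto simp: absolutely_integrable_on_def\<close>)
    finally show ?thesis .
  qed
  have lim: "(\<lambda>m. integral\<^sup>N L (\<lambda>x. ennreal (psi m x))) \<longlonglongrightarrow> emeasure L ?S" if L: "sets L = sets borel" for L
  proof -
    have [measurable]: "(\<lambda>x. ennreal (psi m x)) \<in> borel_measurable L" for m
      using borel_measurable_continuous_onI[OF cont[of m]] L by (simp cong: measurable_cong_sets)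
    have "(\<lambda>m. integral\<^sup>N L (\<lambda>x. ennreal (psi m x))) \<longlonglongrightarrow> integral\<^sup>N L (indicator ?S)"
    proof (rule nn_integral_LIMSEQ)
      show "incseq (\<lambda>m x. ennreal (psi m x))"
        by (auto simp: incseq_def le_fun_def psi_def intro!: ennreal_leI min.mono mult_right_mono infdist_nonneg)
      fix x
      show "(\<lambda>m. ennreal (psi m x)) \<longlonglongrightarrow> indicator ?S x"
      proof (cases "x \<in> ?S")
        case True
        then have pos: "0 < infdist x (- ?S)"
          using infdist_pos_not_in_closed[OF closed_Compl[OF open_box] ne] by simp
        have "\<forall>\<^sub>F m in sequentially. 1 / infdist x (- ?S) \<le> real m"
          by (rule filterlim_real_sequentially[unfolded filterlim_at_top, rule_format])
        then have "\<forall>\<^sub>F m in sequentially. psi m x = 1"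
          by eventually_elim (use pos in \<open>auto simp: psi_def field_simps min_def\<close>)
        then have "\<forall>\<^sub>F m in sequentially. ennreal (psi m x) = indicator ?S x"
          by eventually_elim (use True in simp)
        then show ?thesis by (rule tendsto_eventually)
      qed (simp add: psi_def)
    qed measurable
    then show ?thesis using L by simp
  qed
  have "emeasure ?N ?S = emeasure lborel ?S"
    using LIMSEQ_unique[OF lim[of ?N, unfolded eq] lim[of lborel]] by simp
  then show "emeasure ?N ?S = (\<Prod>c\<in>Basis. (u - l) \<bullet> c)"
    using le by (simp add: emeasure_lborel_box_eq)
qed simp

section \<open>Densities transported by the flow\<close>

definition flow_density :: "(real^'n::_ \<Rightarrow> real) \<Rightarrow> real \<Rightarrow> real^'n::_ \<Rightarrow> real" where
  "flow_density q t y = q (Y t y) / jac t (Y t y)"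

lemma Y_joint_continuous: "continuous_on ({0..} \<times> UNIV) (\<lambda>(t, x). Y t x)"
  by (rule lipschitz_flow.X_joint_continuous[OF lipschitz_flow_Y])

lemma flow_density_joint_continuous:
  assumes q: "continuous_on UNIV q"
  shows "continuous_on ({0..} \<times> UNIV) (\<lambda>(t, y). flow_density q t y)"
proof -
  have Y: "continuous_on ({0..} \<times> UNIV) (\<lambda>p. Y (fst p) (snd p))"
    using Y_joint_continuous by (simp add: case_prod_unfold)
  have "continuous_on ({0..} \<times> UNIV) (\<lambda>p. q (Y (fst p) (snd p)))"
    by (rule continuous_on_compose2[OF q Y]) auto
  moreover have "continuous_on ({0..} \<times> UNIV) (\<lambda>p. jac (fst p) (Y (fst p) (snd p)))"
  proof -
    have "continuous_on ({0..} \<times> UNIV) (\<lambda>p. (fst p, Y (fst p) (snd p)))"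
      by (intro continuous_intros Y)
    moreover have "(\<lambda>p. (fst p, Y (fst p) (snd p))) ` ({0..} \<times> UNIV) \<subseteq> {0..} \<times> UNIV" by auto
    ultimately show ?thesis using continuous_on_compose2[OF jac_joint_continuous] by fastforce
  qed
  ultimately show ?thesis
    unfolding flow_density_def case_prod_unfold by (intro continuous_on_divide) auto
qed

lemma flow_density_continuous:
  assumes q: "continuous_on UNIV q" and t: "0 \<le> t"
  shows "continuous_on UNIV (flow_density q t)"
  by (rule continuous_on_section[OF flow_density_joint_continuous[OF q]]) (use t in simp)

lemma flow_transport:
  fixes f q :: "real^'n::_ \<Rightarrow> real"
  assumes t: "0 \<le> t" and f: "f \<in> borel_measurable borel" and q: "continuous_on UNIV q"
  shows "(\<integral>z. f (X t z) * q z \<partial>lborel) = (\<integral>y. f y * flow_density q t y \<partial>lborel)"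
proof -
  note [measurable] = jac_measurable[OF t] X_measurable[OF t] f borel_measurable_continuous_onI[OF flow_density_continuous[OF q t]]
  have "(\<integral>y. f y * flow_density q t y \<partial>lborel)
     = (\<integral>y. f y * flow_density q t y \<partial>distr (density lborel (\<lambda>z. ennreal (jac t z))) borel (X t))"
    using distr_flow[OF t] by simp
  also have "\<dots> = (\<integral>z. jac t z * (f (X t z) * flow_density q t (X t z)) \<partial>lborel)"
    by (simp add: integral_distr integral_density)
  also have "\<dots> = (\<integral>z. f (X t z) * q z \<partial>lborel)"
    using t by (intro Bochner_Integration.integral_cong) (auto simp: flow_density_def)
  finally show ?thesis by simp
qed

text \<open>Up to time T points move by at most M T, so \<open>1 + norm y\<close> is at most
  \<open>1 + M * T\<close> times the same quantity at \<open>Y t y\<close>, and the Jacobian is at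
  least exp(-B T). The exponent p is preserved; only the constant grows with T.\<close>

lemma flow_density_decay:
  assumes T: "0 \<le> T" and p: "0 \<le> p" and q: "\<And>x. \<bar>q x\<bar> \<le> C * (1 + norm x) powr (- p)"
  shows "\<exists>C'. \<forall>t\<in>{0..T}. \<forall>y. \<bar>flow_density q t y\<bar> \<le> C' * (1 + norm y) powr (- p)"
proof -
  obtain B where B: "0 \<le> B" "\<And>x. \<bar>divergence b x\<bar> \<le> B" using divergence_bound by auto
  have C: "0 \<le> C" using q[of 0] by auto
  have "\<bar>flow_density q t y\<bar> \<le> (exp (B * T) * C * (1 + M * T) powr p) * (1 + norm y) powr (- p)" if t: "t \<in> {0..T}" for t y
  proof -
    let ?x = "Y t y"
    have "\<bar>integral {0..t} (\<lambda>s. divergence b (X s ?x))\<bar> \<le> B * (t - 0)"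
      unfolding real_norm_def[symmetric] using t B
      by (intro integral_bound continuous_on_subset[OF div_path_continuous]) auto
    moreover have "B * t \<le> B * T" using t B by (intro mult_left_mono) auto
    ultimately have J: "exp (- (B * T)) \<le> jac t ?x" by (simp add: jac_def abs_le_iff)
    have "norm (?x - y) \<le> M * t"
      using lipschitz_flow.X_near[OF lipschitz_flow_Y, of t y] t by simp
    moreover have "M * t \<le> M * T" using t M by (intro mult_left_mono) auto
    ultimately have "1 + norm y \<le> 1 + norm ?x + M * T"
      using norm_triangle_sub[of y ?x] by (simp add: norm_minus_commute)
    also have "\<dots> \<le> (1 + norm ?x) * (1 + M * T)" using M T by (simp add: algebra_simps)
    finally have le: "1 + norm y \<le> (1 + norm ?x) * (1 + M * T)" .
    have pos: "0 < 1 + norm y" "0 < 1 + norm ?x" "0 < 1 + M * T"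
      using M T by (auto intro: add_pos_nonneg)
    have "(1 + norm ?x) powr (- p) * (1 + M * T) powr (- p) \<le> (1 + norm y) powr (- p)"
      using le pos p by (subst powr_mult[symmetric]) (auto intro!: powr_mono2' simp: less_imp_le)
    then have d: "(1 + norm ?x) powr (- p) \<le> (1 + M * T) powr p * (1 + norm y) powr (- p)"
      using pos by (simp add: powr_minus field_simps)
    have "\<bar>flow_density q t y\<bar> = \<bar>q ?x\<bar> / jac t ?x" by (simp add: flow_density_def)
    also have "\<dots> \<le> (C * (1 + norm ?x) powr (- p)) / exp (- (B * T))"
      using J q[of ?x] by (intro frac_le) auto
    also have "\<dots> = exp (B * T) * C * (1 + norm ?x) powr (- p)" by (simp add: exp_minus field_simps)
    also have "\<dots> \<le> exp (B * T) * C * ((1 + M * T) powr p * (1 + norm y) powr (- p))"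
      using d C by (intro mult_left_mono) auto
    finally show ?thesis by (simp add: mult_ac)
  qed
  then show ?thesis by blast
qed

end

section \<open>Testing tail integrals against products\<close>

text \<open>
  \<open>m\<close> is the test function and \<open>M\<close> its antiderivative from \<open>-\<infinity>\<close>, hence constant near \<open>+\<infinity>\<close>. Testing a tail
  integral of \<open>q\<close> against a product of \<open>m\<close>'s amounts to testing \<open>q\<close> against the product of the \<open>M\<close>'s.
\<close>

definition test_function :: "(real \<Rightarrow> real) \<Rightarrow> (real \<Rightarrow> real) \<Rightarrow> bool" where
  "test_function M m \<longleftrightarrow> (\<forall>s. (M has_real_derivative m s) (at s)) \<and> continuous_on UNIV m \<and>
     (\<exists>R. (\<forall>s. R < \<bar>s\<bar> \<longrightarrow> m s = 0) \<and> (\<forall>s. s < - R \<longrightarrow> M s = 0))"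

lemma test_functionD:
  assumes "test_function M m"
  shows "(M has_real_derivative m s) (at s)" "continuous_on UNIV m" "continuous_on UNIV M"
    "m \<in> borel_measurable borel" "M \<in> borel_measurable borel"
proof -
  show d: "(M has_real_derivative m s) (at s)" for s using assms by (auto simp: test_function_def)
  show c: "continuous_on UNIV m" "continuous_on UNIV M"
    using assms DERIV_isCont[OF d] by (auto simp: test_function_def continuous_at_imp_continuous_on)
  show "m \<in> borel_measurable borel" "M \<in> borel_measurable borel"
    by (intro borel_measurable_continuous_onI c)+
qed

lemma test_function_integrable:
  assumes "test_function M m" shows "integrable lborel m"
proof -
  obtain R where R: "\<And>s. R < \<bar>s\<bar> \<Longrightarrow> m s = 0" using assms by (auto simp: test_function_def)
  show ?thesis
    by (rule compact_support_absolutely_integrable(2)[OF test_functionD(2)[OF assms], of R])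
       (use R in force)
qed

lemma test_function_lower_integral:
  assumes "test_function M m"
  shows "(\<integral>u. indicator {..s} u * m u \<partial>lborel) = M s"
proof -
  obtain R where R: "\<And>s. R < \<bar>s\<bar> \<Longrightarrow> m s = 0" "\<And>s. s < - R \<Longrightarrow> M s = 0"
    using assms by (auto simp: test_function_def)
  let ?a = "- (\<bar>R\<bar> + \<bar>s\<bar> + 1)"
  have "(\<integral>u. indicator {..s} u * m u \<partial>lborel) = (\<integral>u. indicator {?a..s} u *\<^sub>R m u \<partial>lborel)"
    using R(1) by (intro Bochner_Integration.integral_cong) (auto simp: indicator_def)
  also have "\<dots> = M s - M ?a"
    using test_functionD(1,2)[OF assms]
    by (intro integral_FTC_atLeastAtMost)
       (auto simp: has_real_derivative_iff_has_vector_derivative[symmetric] intro: has_field_derivative_at_within continuous_on_subset)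
  also have "M ?a = 0" by (rule R(2)) simp
  finally show ?thesis by simp
qed

text \<open>\<open>m\<close> is bounded by compactness of its support, and \<open>M\<close> by the
  integral of \<open>\<bar>m\<bar>\<close>, being a lower integral of \<open>m\<close>. A bound of
  at least 1 lets products over fewer coordinates be estimated by the full power.\<close>

lemma test_function_bounded:
  assumes "test_function M m"
  shows "\<exists>B\<ge>1. \<forall>s. \<bar>M s\<bar> \<le> B \<and> \<bar>m s\<bar> \<le> B"
proof -
  obtain R where R: "\<And>s. R < \<bar>s\<bar> \<Longrightarrow> m s = 0" using assms by (auto simp: test_function_def)
  have "bounded (m ` {-R..R})"
    by (intro compact_imp_bounded compact_continuous_image compact_Icc continuous_on_subset[OF test_functionD(2)[OF assms]]) auto
  then obtain P where "\<forall>s\<in>{-R..R}. \<bar>m s\<bar> \<le> P" unfolding bounded_iff by auto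
  then have P: "\<bar>m s\<bar> \<le> \<bar>P\<bar>" for s using R[of s] by (cases "s \<in> {-R..R}") force+
  have MI: "\<bar>M s\<bar> \<le> (\<integral>u. \<bar>m u\<bar> \<partial>lborel)" for s
  proof -
    have "\<bar>\<integral>u. indicator {..s} u * m u \<partial>lborel\<bar> \<le> (\<integral>u. \<bar>indicator {..s} u * m u\<bar> \<partial>lborel)"
      by (rule integral_abs_bound)
    also have "\<dots> \<le> (\<integral>u. \<bar>m u\<bar> \<partial>lborel)"
      by (rule integral_mono_AE')
         (use test_function_integrable[OF assms] in \<open>auto simp: indicator_def intro: integrable_abs\<close>)
    finally show ?thesis by (simp add: test_function_lower_integral[OF assms])
  qed
  have I: "0 \<le> (\<integral>u. \<bar>m u\<bar> \<partial>lborel)" by simp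
  show ?thesis
  proof (intro exI[of _ "\<bar>P\<bar> + (\<integral>u. \<bar>m u\<bar> \<partial>lborel) + 1"] conjI allI)
    show "\<bar>M s\<bar> \<le> \<bar>P\<bar> + (\<integral>u. \<bar>m u\<bar> \<partial>lborel) + 1" for s using MI[of s] by linarith
    show "\<bar>m s\<bar> \<le> \<bar>P\<bar> + (\<integral>u. \<bar>m u\<bar> \<partial>lborel) + 1" for s using P[of s] I by linarith
  qed (use I in simp)
qed

lemma test_functions_bounded:
  fixes M m :: "'n::finite \<Rightarrow> real \<Rightarrow> real"
  assumes "\<And>i. test_function (M i) (m i)"
  shows "\<exists>B\<ge>1. \<forall>i s. \<bar>M i s\<bar> \<le> B \<and> \<bar>m i s\<bar> \<le> B"
proof -
  define B where "B i = (SOME B. 1 \<le> B \<and> (\<forall>s. \<bar>M i s\<bar> \<le> B \<and> \<bar>m i s\<bar> \<le> B))" for i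
  have B: "1 \<le> B i" "\<bar>M i s\<bar> \<le> B i" "\<bar>m i s\<bar> \<le> B i" for i s
    using someI_ex[OF test_function_bounded[OF assms[of i]]] unfolding B_def by blast+
  have le: "B i \<le> (\<Sum>i\<in>UNIV. B i)" for i
    using order_trans[OF zero_le_one B(1)] by (intro member_le_sum) auto
  then have "1 \<le> (\<Sum>i\<in>UNIV. B i)" using B(1) order_trans by blast
  then show ?thesis using B le order_trans by (intro exI[of _ "\<Sum>i\<in>UNIV. B i"]) blast
qed

text \<open>The coordinates in \<open>J\<close> are those over which a tail has been integrated;
  testing replaces \<open>m\<close> by its antiderivative exactly there.\<close>

definition test_mix :: "'n set \<Rightarrow> ('n \<Rightarrow> real \<Rightarrow> real) \<Rightarrow> ('n \<Rightarrow> real \<Rightarrow> real) \<Rightarrow> real^'n::finite \<Rightarrow> real" where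
  "test_mix J M m z = (\<Prod>k\<in>J. M k (z $ k)) * (\<Prod>k\<in>-J. m k (z $ k))"

lemma test_mix_continuous:
  assumes "\<And>i. test_function (M i) (m i)"
  shows "continuous_on UNIV (test_mix J M m)"
  unfolding test_mix_def
  by (intro continuous_intros continuous_on_compose2[OF test_functionD(2)[OF assms]]
      continuous_on_compose2[OF test_functionD(3)[OF assms]]) auto

lemma test_mix_bounded:
  fixes M m :: "'n::finite \<Rightarrow> real \<Rightarrow> real"
  assumes "\<And>i. test_function (M i) (m i)"
  shows "\<exists>B\<ge>0. \<forall>J z. \<bar>test_mix J M m z\<bar> \<le> B"
proof -
  obtain B where B: "1 \<le> B" "\<And>i s. \<bar>M i s\<bar> \<le> B" "\<And>i s. \<bar>m i s\<bar> \<le> B"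
    using test_functions_bounded[of M m, OF assms] by auto
  have "\<bar>test_mix J M m z\<bar> \<le> B ^ CARD('n) * B ^ CARD('n)" for J and z :: "real^'n"
  proof -
    have *: "(\<Prod>k\<in>I. f k) \<le> B ^ CARD('n)" if "\<And>k. 0 \<le> f k" "\<And>k. f k \<le> B" for I :: "'n set" and f
    proof -
      have "(\<Prod>k\<in>I. f k) \<le> (\<Prod>k\<in>I. B)" using that by (intro prod_mono) auto
      also have "\<dots> \<le> B ^ CARD('n)" unfolding prod_constant using B(1) by (intro power_increasing card_mono) auto
      finally show ?thesis .
    qed
    show ?thesis
      unfolding test_mix_def abs_mult abs_prod using B by (intro mult_mono * prod_nonneg) auto
  qed
  moreover have "0 \<le> B ^ CARD('n) * B ^ CARD('n)" using B(1) by simp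
  ultimately show ?thesis by blast
qed

lemma integrable_bounded_mult:
  fixes f g :: "'a \<Rightarrow> real"
  assumes "integrable N f" "g \<in> borel_measurable N" "\<And>x. \<bar>g x\<bar> \<le> B"
  shows "integrable N (\<lambda>x. f x * g x)" "integrable N (\<lambda>x. g x * f x)"
proof -
  note [measurable] = assms(2) borel_measurable_integrable[OF assms(1)]
  show "integrable N (\<lambda>x. g x * f x)"
  proof (rule Bochner_Integration.integrable_bound)
    show "integrable N (\<lambda>x. B * f x)" by (intro integrable_mult_right assms)
    show "(\<lambda>x. g x * f x) \<in> borel_measurable N" by measurable
    show "AE x in N. norm (g x * f x) \<le> norm (B * f x)"
      unfolding real_norm_def abs_mult
      by (intro AE_I2 mult_right_mono abs_ge_zero order_trans[OF assms(3) abs_ge_self])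
  qed
  then show "integrable N (\<lambda>x. f x * g x)" by (simp add: mult.commute)
qed

lemma tail_bounded:
  fixes q :: "real^'n::finite \<Rightarrow> real"
  assumes "q \<in> borel_measurable borel" and wb: "weight_bounded a C q"
  shows "\<bar>tail J q x\<bar> \<le> C * (\<integral>z. (\<Prod>k\<in>J. weight a (z k)) \<partial>PiM J (\<lambda>_. lborel))"
proof -
  let ?I = "\<integral>z. (\<Prod>k\<in>J. weight a (z k)) \<partial>PiM J (\<lambda>_. lborel)"
  have I: "0 \<le> ?I" by (intro integral_nonneg_AE AE_I2 prod_nonneg) auto
  have "C * (\<Prod>k\<in>-J. weight a (x $ k)) * ?I \<le> C * 1 * ?I"
    using weight_boundedD(1,2)[OF wb] I by (intro mult_right_mono mult_left_mono prod_weight_le_1) auto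
  with tail_bound[OF assms, of J x] show ?thesis by simp
qed

lemma integral_lborel_split:
  fixes f :: "real^'n::finite \<Rightarrow> real"
  assumes "integrable lborel f"
  shows "integral\<^sup>L lborel f = (\<integral>y. (\<integral>z. f (vec_lambda (merge (-J) J (y, z))) \<partial>PiM J (\<lambda>_. lborel)) \<partial>PiM (-J) (\<lambda>_. lborel))"
proof -
  have m: "f \<in> borel_measurable borel" using borel_measurable_integrable[OF assms] by simp
  have U: "- J \<union> J = UNIV" by auto
  have "integrable (PiM (- J \<union> J) (\<lambda>_. lborel)) (\<lambda>z. f (vec_lambda z))"
    unfolding U using assms integrable_lborel_vec[OF m] by simp
  from lborel_PiM.product_integral_fold[OF _ _ _ this] show ?thesis
    unfolding U integral_lborel_vec[OF m] by auto
qed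

lemma test_prod_integrable:
  fixes M m :: "'n::finite \<Rightarrow> real \<Rightarrow> real"
  assumes t: "\<And>i. test_function (M i) (m i)"
  shows "integrable lborel (\<lambda>x::real^'n. \<Prod>i\<in>UNIV. m i (x $ i))"
proof -
  note [measurable] = test_functionD(4)[OF t]
  show ?thesis
    by (subst integrable_lborel_vec) (auto intro!: lborel_PiM.product_integrable_prod test_function_integrable[OF t])
qed

lemma tail_test_integrable:
  fixes F :: "real^'n::finite \<Rightarrow> real"
  assumes F: "continuous_on UNIV F" and wb: "weight_bounded a C F"
    and t: "\<And>i. test_function (M i) (m i)"
  shows "integrable lborel (\<lambda>x. tail J F x * (\<Prod>i\<in>UNIV. m i (x $ i)))"
    and "integrable lborel (\<lambda>z. test_mix J M m z * F z)"
proof -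
  note [measurable] = borel_measurable_continuous_onI[OF F]
    borel_measurable_continuous_onI[OF tail_continuous[OF F wb]]
    borel_measurable_continuous_onI[OF test_mix_continuous[of M m, OF t]]
  show "integrable lborel (\<lambda>x. tail J F x * (\<Prod>i\<in>UNIV. m i (x $ i)))"
    by (rule integrable_bounded_mult(2)[OF test_prod_integrable[of M m, OF t] _ tail_bounded[OF _ wb]]) auto
  obtain B where B: "\<And>z. \<bar>test_mix J M m z\<bar> \<le> B" using test_mix_bounded[of M m, OF t] by auto
  show "integrable lborel (\<lambda>z. test_mix J M m z * F z)"
    by (rule integrable_bounded_mult(2)[OF weight_bounded_integrable[OF _ wb] _ B]) auto
qed

text \<open>The orthant couples the test variable w and the integration variable z only through w_k
  at most z_k for k in \<open>J\<close>. After Fubini the inner integral over w factorises, and each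
  factor is a lower integral of \<open>m k\<close>, that is \<open>M k\<close> at z_k.\<close>

lemma tail_test:
  fixes F :: "real^'n::finite \<Rightarrow> real"
  assumes F: "continuous_on UNIV F" and wb: "weight_bounded a C F"
    and t: "\<And>i. test_function (M i) (m i)"
  shows "(\<integral>x. tail J F x * (\<Prod>i\<in>UNIV. m i (x $ i)) \<partial>lborel) = (\<integral>z. test_mix J M m z * F z \<partial>lborel)"
proof -
  note [measurable] = borel_measurable_continuous_onI[OF F] test_functionD(4,5)[OF t]
    borel_measurable_continuous_onI[OF tail_continuous[OF F wb]]
    borel_measurable_continuous_onI[OF test_mix_continuous[of M m, OF t]]
  note i1 = tail_test_integrable(1)[of F a C M m J, OF F wb t] and i2 = tail_test_integrable(2)[of F a C M m J, OF F wb t]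
  interpret J: sigma_finite_measure "PiM J (\<lambda>_. lborel :: real measure)" by (rule lborel_PiM.sigma_finite) simp
  interpret JJ: pair_sigma_finite "PiM J (\<lambda>_. lborel :: real measure)" "PiM J (\<lambda>_. lborel :: real measure)" ..
  have inner: "(\<integral>w. (\<integral>z. indicator (orthant J (vec_lambda w)) z * G z \<partial>PiM J (\<lambda>_. lborel)) * (\<Prod>k\<in>J. m k (w k)) \<partial>PiM J (\<lambda>_. lborel))
     = (\<integral>z. (\<Prod>k\<in>J. M k (z k)) * G z \<partial>PiM J (\<lambda>_. lborel))"
    if G: "integrable (PiM J (\<lambda>_. lborel)) G" for G
  proof -
    note [measurable] = borel_measurable_integrable[OF G]
    \<comment> \<open>The indicator is absorbed into the product, one factor per coordinate, so that
      the integral over \<open>w\<close> splits.\<close>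
    let ?h = "\<lambda>w z. (\<Prod>k\<in>J. (if w k \<le> z k then 1 else 0) * m k (w k)) * G z"
    have h_eq: "?h w z = indicator (orthant J (vec_lambda w)) z * G z * (\<Prod>k\<in>J. m k (w k))" for w z
    proof (cases "z \<in> orthant J (vec_lambda w)")
      case True then show ?thesis by (auto simp: orthant_def intro!: prod.cong)
    next
      case False
      then obtain k where "k \<in> J" "\<not> w k \<le> z k" by (auto simp: orthant_def)
      then show ?thesis using False by (auto intro!: bexI[of _ k])
    qed
    have hm: "(\<lambda>p. ?h (fst p) (snd p)) \<in> borel_measurable (PiM J (\<lambda>_. lborel) \<Otimes>\<^sub>M PiM J (\<lambda>_. lborel))"
      by measurable
    have pm: "integrable (PiM J (\<lambda>_. lborel)) (\<lambda>w. \<Prod>k\<in>J. m k (w k))"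
      by (intro lborel_PiM.product_integrable_prod test_function_integrable[OF t]) auto
    have Gz: "integrable (PiM J (\<lambda>_. lborel)) (\<lambda>z. ?h w z)" for w
      unfolding h_eq by (intro integrable_mult_left integrable_bounded_mult(2)[OF G orthant_measurable, where B=1]) (auto simp: indicator_def)
    have int: "integrable (PiM J (\<lambda>_. lborel) \<Otimes>\<^sub>M PiM J (\<lambda>_. lborel)) (\<lambda>p. ?h (fst p) (snd p))"
    proof (rule JJ.Fubini_integrable[OF hm])
      show "integrable (PiM J (\<lambda>_. lborel)) (\<lambda>w. \<integral>z. norm (?h (fst (w, z)) (snd (w, z))) \<partial>PiM J (\<lambda>_. lborel))"
      proof (rule Bochner_Integration.integrable_bound)
        show "integrable (PiM J (\<lambda>_. lborel)) (\<lambda>w. (\<integral>z. \<bar>G z\<bar> \<partial>PiM J (\<lambda>_. lborel)) * (\<Prod>k\<in>J. m k (w k)))"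
          by (rule integrable_mult_right[OF pm])
        show "(\<lambda>w. \<integral>z. norm (?h (fst (w, z)) (snd (w, z))) \<partial>PiM J (\<lambda>_. lborel)) \<in> borel_measurable (PiM J (\<lambda>_. lborel))"
          by measurable
        show "AE w in PiM J (\<lambda>_. lborel). norm (\<integral>z. norm (?h (fst (w, z)) (snd (w, z))) \<partial>PiM J (\<lambda>_. lborel))
           \<le> norm ((\<integral>z. \<bar>G z\<bar> \<partial>PiM J (\<lambda>_. lborel)) * (\<Prod>k\<in>J. m k (w k)))"
        proof (rule AE_I2)
          fix w
          have "(\<integral>z. norm (?h w z) \<partial>PiM J (\<lambda>_. lborel)) \<le> (\<integral>z. \<bar>G z\<bar> * \<bar>\<Prod>k\<in>J. m k (w k)\<bar> \<partial>PiM J (\<lambda>_. lborel))"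
          proof (rule Bochner_Integration.integral_mono)
            show "integrable (PiM J (\<lambda>_. lborel)) (\<lambda>z. norm (?h w z))" by (rule integrable_norm[OF Gz])
            show "integrable (PiM J (\<lambda>_. lborel)) (\<lambda>z. \<bar>G z\<bar> * \<bar>\<Prod>k\<in>J. m k (w k)\<bar>)"
              by (intro integrable_mult_left integrable_abs G)
            show "norm (?h w z) \<le> \<bar>G z\<bar> * \<bar>\<Prod>k\<in>J. m k (w k)\<bar>" for z
              unfolding h_eq by (auto simp: abs_mult indicator_def)
          qed
          then show "norm (\<integral>z. norm (?h (fst (w, z)) (snd (w, z))) \<partial>PiM J (\<lambda>_. lborel))
             \<le> norm ((\<integral>z. \<bar>G z\<bar> \<partial>PiM J (\<lambda>_. lborel)) * (\<Prod>k\<in>J. m k (w k)))"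
            by (simp add: abs_mult)
        qed
      qed
      show "AE w in PiM J (\<lambda>_. lborel). integrable (PiM J (\<lambda>_. lborel)) (\<lambda>z. ?h (fst (w, z)) (snd (w, z)))"
        using Gz by simp
    qed
    have "(\<integral>w. (\<integral>z. indicator (orthant J (vec_lambda w)) z * G z \<partial>PiM J (\<lambda>_. lborel)) * (\<Prod>k\<in>J. m k (w k)) \<partial>PiM J (\<lambda>_. lborel))
      = (\<integral>w. (\<integral>z. ?h w z \<partial>PiM J (\<lambda>_. lborel)) \<partial>PiM J (\<lambda>_. lborel))"
      unfolding h_eq by simp
    also have "\<dots> = (\<integral>z. (\<integral>w. ?h w z \<partial>PiM J (\<lambda>_. lborel)) \<partial>PiM J (\<lambda>_. lborel))"
      by (rule JJ.Fubini_integral[symmetric]) (use int in \<open>simp add: case_prod_unfold\<close>)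
    also have "\<dots> = (\<integral>z. (\<Prod>k\<in>J. M k (z k)) * G z \<partial>PiM J (\<lambda>_. lborel))"
    proof (rule Bochner_Integration.integral_cong[OF refl])
      fix z
      have ind: "(if u \<le> z k then 1 else 0) * m k u = indicator {..z k} u * m k u" for u k by (auto simp: indicator_def)
      have "(\<integral>w. (\<Prod>k\<in>J. (if w k \<le> z k then 1 else 0) * m k (w k)) \<partial>PiM J (\<lambda>_. lborel))
         = (\<Prod>k\<in>J. \<integral>u. (if u \<le> z k then 1 else 0) * m k u \<partial>lborel)"
      proof (rule lborel_PiM.product_integral_prod)
        show "integrable lborel (\<lambda>u. (if u \<le> z k then 1 else 0) * m k u)" for k
          unfolding ind by (rule integrable_bounded_mult(2)[OF test_function_integrable[OF t], where B=1]) (auto simp: indicator_def)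
      qed simp
      then show "(\<integral>w. ?h w z \<partial>PiM J (\<lambda>_. lborel)) = (\<Prod>k\<in>J. M k (z k)) * G z"
        by (simp add: ind test_function_lower_integral[OF t])
    qed
    finally show ?thesis .
  qed
  have split: "(\<Prod>i\<in>UNIV. m i (merge (-J) J (y, w) i)) = (\<Prod>k\<in>-J. m k (y k)) * (\<Prod>k\<in>J. m k (w k))" for y w
  proof -
    have "(\<Prod>i\<in>UNIV. m i (merge (-J) J (y, w) i)) = (\<Prod>i\<in>-J. m i (merge (-J) J (y, w) i)) * (\<Prod>i\<in>J. m i (merge (-J) J (y, w) i))"
      by (subst prod.union_disjoint[symmetric]) (auto intro!: arg_cong2[where f=prod])
    then show ?thesis by (auto intro!: arg_cong2[where f="(*)"] prod.cong simp: merge_def)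
  qed
  have spl: "overwrite J z (vec_lambda (merge (-J) J (y, w))) = vec_lambda (merge (-J) J (y, z))" for y w z
    by (auto simp: vec_eq_iff merge_def)
  have orth: "orthant J (vec_lambda (merge (-J) J (y, w))) = orthant J (vec_lambda w)" for y w
    by (auto simp: orthant_def merge_def)
  have Gi: "integrable (PiM J (\<lambda>_. lborel)) (\<lambda>z. F (vec_lambda (merge (-J) J (y, z))))" for y
    using overwrite_integrable[OF _ wb, of J "vec_lambda (merge (-J) J (y, undefined))"] by (simp add: spl)
  have "(\<integral>x. tail J F x * (\<Prod>i\<in>UNIV. m i (x $ i)) \<partial>lborel) = 
     (\<integral>y. (\<Prod>k\<in>-J. m k (y k)) * (\<integral>w. (\<integral>z. indicator (orthant J (vec_lambda w)) z * F (vec_lambda (merge (-J) J (y, z))) \<partial>PiM J (\<lambda>_. lborel)) * (\<Prod>k\<in>J. m k (w k)) \<partial>PiM J (\<lambda>_. lborel)) \<partial>PiM (-J) (\<lambda>_. lborel))"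
    unfolding integral_lborel_split[OF i1, of J] 
    by (simp add: tail_def set_lebesgue_integral_def split orth spl integral_mult_right_zero[symmetric] mult_ac del: integral_mult_right_zero)
  also have "\<dots> = (\<integral>y. (\<Prod>k\<in>-J. m k (y k)) * (\<integral>z. (\<Prod>k\<in>J. M k (z k)) * F (vec_lambda (merge (-J) J (y, z))) \<partial>PiM J (\<lambda>_. lborel)) \<partial>PiM (-J) (\<lambda>_. lborel))"
    by (simp add: inner[OF Gi])
  also have "\<dots> = (\<integral>z. test_mix J M m z * F z \<partial>lborel)"
  proof -
    have "test_mix J M m (vec_lambda (merge (-J) J (y, z))) = (\<Prod>k\<in>-J. m k (y k)) * (\<Prod>k\<in>J. M k (z k))" for y z
      unfolding test_mix_def by (subst mult.commute) (auto intro!: arg_cong2[where f="(*)"] prod.cong simp: merge_def)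
    then show ?thesis
      unfolding integral_lborel_split[OF i2, of J]
      by (simp add: integral_mult_right_zero[symmetric] mult.assoc del: integral_mult_right_zero)
  qed
  finally show ?thesis .
qed

text \<open>A majorant that does not depend on time serves twice: it makes the spatial integral
  continuous in time, and it justifies the exchange of the integrals.\<close>

lemma fubini_time:
  fixes phi :: "real \<Rightarrow> 'a::euclidean_space \<Rightarrow> real"
  assumes c: "continuous_on ({0..t} \<times> UNIV) (\<lambda>(s, z). phi s z)"
    and bd: "\<And>s z. s \<in> {0..t} \<Longrightarrow> \<bar>phi s z\<bar> \<le> g z" and g: "integrable lborel g"
  shows "continuous_on {0..t} (\<lambda>s. \<integral>z. phi s z \<partial>lborel)"
    and "(\<integral>z. integral {0..t} (\<lambda>s. phi s z) \<partial>lborel) = integral {0..t} (\<lambda>s. \<integral>z. phi s z \<partial>lborel)"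
    and "integrable lborel (\<lambda>z. integral {0..t} (\<lambda>s. phi s z))"
proof -
  note cz = continuous_on_section[OF c]
  have cs: "continuous_on {0..t} (\<lambda>s. phi s z)" for z
  proof -
    have "continuous_on {0..t} (\<lambda>s. (s, z))" by (intro continuous_intros)
    moreover have "(\<lambda>s. (s, z)) ` {0..t} \<subseteq> {0..t} \<times> UNIV" by auto
    ultimately show ?thesis using continuous_on_compose2[OF c] by fastforce
  qed
  note [measurable] = borel_measurable_integrable[OF g]
  have iz: "integrable lborel (phi s)" if "s \<in> {0..t}" for s
    by (rule Bochner_Integration.integrable_bound[OF g])
       (use borel_measurable_continuous_onI[OF cz[OF that]] bd[OF that] in \<open>auto intro!: AE_I2 order_trans[OF _ abs_ge_self]\<close>)
  show cont: "continuous_on {0..t} (\<lambda>s. \<integral>z. phi s z \<partial>lborel)"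
    unfolding continuous_on_sequentially comp_def
  proof (intro ballI allI impI)
    fix x :: "nat \<Rightarrow> real" and l assume l: "l \<in> {0..t}" and x: "(\<forall>n. x n \<in> {0..t}) \<and> x \<longlonglongrightarrow> l"
    show "(\<lambda>n. \<integral>z. phi (x n) z \<partial>lborel) \<longlonglongrightarrow> (\<integral>z. phi l z \<partial>lborel)"
    proof (rule integral_dominated_convergence[where w=g])
      show "AE z in lborel. (\<lambda>n. phi (x n) z) \<longlonglongrightarrow> phi l z"
        using cs x l unfolding continuous_on_sequentially comp_def by auto
    qed (use iz l x bd g in auto)
  qed
  let ?f = "\<lambda>s z. indicator {0..t} s * phi s z"
  have fm: "(\<lambda>p. ?f (fst p) (snd p)) \<in> borel_measurable (lborel \<Otimes>\<^sub>M lborel)"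
  proof -
    have "(\<lambda>p. indicator ({0..t} \<times> UNIV) p *\<^sub>R (case p of (s, z) \<Rightarrow> phi s z)) \<in> borel_measurable borel"
      by (rule borel_measurable_continuous_on_indicator[OF _ c]) (intro borel_closed closed_Times, auto)
    moreover have "indicator ({0..t} \<times> UNIV) p *\<^sub>R (case p of (s, z) \<Rightarrow> phi s z) = ?f (fst p) (snd p)" for p :: "real \<times> 'a"
      by (cases p) (auto simp: indicator_def)
    ultimately show ?thesis by (simp add: lborel_prod)
  qed
  have bnd: "\<bar>?f s z\<bar> \<le> indicator {0..t} s * g z" for s z using bd by (auto simp: indicator_def)
  have fz: "integrable lborel (?f s)" for s
    using iz[of s] by (cases "s \<in> {0..t}") auto
  have int: "integrable (lborel \<Otimes>\<^sub>M lborel) (\<lambda>p. ?f (fst p) (snd p))"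
  proof (rule lborel_pair.Fubini_integrable[OF fm])
    show "integrable lborel (\<lambda>s. \<integral>z. norm (?f (fst (s, z)) (snd (s, z))) \<partial>lborel)"
    proof (rule Bochner_Integration.integrable_bound)
      show "integrable lborel (\<lambda>s. indicator {0..t} s * (\<integral>z. g z \<partial>lborel))"
        by (intro integrable_mult_left integrable_real_indicator) (auto simp: emeasure_lborel_Icc_eq)
      show "(\<lambda>s. \<integral>z. norm (?f (fst (s, z)) (snd (s, z))) \<partial>lborel) \<in> borel_measurable lborel"
        using fm by measurable
      show "AE s in lborel. norm (\<integral>z. norm (?f (fst (s, z)) (snd (s, z))) \<partial>lborel) \<le> norm (indicator {0..t} s * (\<integral>z. g z \<partial>lborel))"
      proof (rule AE_I2)
        fix s :: real
        have "(\<integral>z. norm (?f s z) \<partial>lborel) \<le> (\<integral>z. indicator {0..t} s * g z \<partial>lborel)"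
          by (intro Bochner_Integration.integral_mono integrable_norm fz integrable_mult_right g) (use bnd in auto)
        then show "norm (\<integral>z. norm (?f (fst (s, z)) (snd (s, z))) \<partial>lborel) \<le> norm (indicator {0..t} s * (\<integral>z. g z \<partial>lborel))"
          by simp
      qed
    qed
    show "AE s in lborel. integrable lborel (\<lambda>z. ?f (fst (s, z)) (snd (s, z)))" using fz by simp
  qed
  have inner: "(\<integral>s. ?f s z \<partial>lborel) = integral {0..t} (\<lambda>s. phi s z)" for z
    using set_borel_integral_eq_integral(2)[OF borel_integrable_atLeastAtMost'[OF cs[of z]]]
    by (simp add: set_lebesgue_integral_def)
  have outer: "(\<integral>s. (\<integral>z. ?f s z \<partial>lborel) \<partial>lborel) = integral {0..t} (\<lambda>s. \<integral>z. phi s z \<partial>lborel)"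
    using set_borel_integral_eq_integral(2)[OF borel_integrable_atLeastAtMost'[OF cont]]
    by (simp add: set_lebesgue_integral_def)
  have int': "integrable (lborel \<Otimes>\<^sub>M lborel) (case_prod ?f)" using int by (simp add: case_prod_unfold)
  show "(\<integral>z. integral {0..t} (\<lambda>s. phi s z) \<partial>lborel) = integral {0..t} (\<lambda>s. \<integral>z. phi s z \<partial>lborel)"
    using lborel_pair.Fubini_integral[OF int'] unfolding inner outer .
  show "integrable lborel (\<lambda>z. integral {0..t} (\<lambda>s. phi s z))"
    using lborel_pair.integrable_snd[OF int'] unfolding inner .
qed

text \<open>The dual generator expressed by the density: its value at the tail of \<open>r\<close>.
  It contains no derivative of \<open>r\<close>, so it makes sense along densities that are only
  continuous.\<close>

definition flux :: "(real^'n \<Rightarrow> real^'n) \<Rightarrow> (real^'n \<Rightarrow> real) \<Rightarrow> real^'n::finite \<Rightarrow> real" where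
  "flux b r x = (\<Sum>j\<in>UNIV. tail (-{j}) (\<lambda>y. b y $ j * r y) x)"

text \<open>The operator \<open>L\<close> applied to the product of the antiderivatives
  \<open>M k\<close>.\<close>

definition test_drift :: "(real^'n \<Rightarrow> real^'n) \<Rightarrow> ('n \<Rightarrow> real \<Rightarrow> real) \<Rightarrow> ('n \<Rightarrow> real \<Rightarrow> real) \<Rightarrow> real^'n::finite \<Rightarrow> real" where
  "test_drift b M m z = (\<Sum>j\<in>UNIV. b z $ j * test_mix (-{j}) M m z)"

definition density_path :: "(real \<Rightarrow> real^'n::finite \<Rightarrow> real) \<Rightarrow> bool" where
  "density_path r \<longleftrightarrow> continuous_on ({0..} \<times> UNIV) (\<lambda>(t, x). r t x) \<and>
     (\<forall>T\<ge>0. \<exists>a C. \<forall>t\<in>{0..T}. weight_bounded a C (r t))"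

lemma density_pathD:
  assumes "density_path r" "0 \<le> t"
  shows "continuous_on UNIV (r t)" "\<exists>a C. weight_bounded a C (r t)" "integrable lborel (r t)"
proof -
  show c: "continuous_on UNIV (r t)"
    by (rule continuous_on_section[of "{0..}"]) (use assms in \<open>auto simp: density_path_def\<close>)
  have "\<exists>a C. \<forall>s\<in>{0..t}. weight_bounded a C (r s)" using assms unfolding density_path_def by blast
  then show w: "\<exists>a C. weight_bounded a C (r t)" using assms(2) by (meson atLeastAtMost_iff order_refl)
  show "integrable lborel (r t)" using w weight_bounded_integrable[OF borel_measurable_continuous_onI[OF c]] by blast
qed

section \<open>Tent functions and the sufficiency of product tests\<close>

lemma square_max_derivative: "((\<lambda>s::real. (max 0 s)\<^sup>2) has_real_derivative 2 * max 0 s) (at s)"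
proof -
  consider "0 < s" | "s < 0" | "s = 0" by linarith
  then show ?thesis
  proof cases
    case 1
    have d: "((\<lambda>s. s\<^sup>2) has_real_derivative 2 * max 0 s) (at s)" using 1 by (auto intro!: derivative_eq_intros)
    show ?thesis by (rule has_field_derivative_transform_within_open[OF d, of "{0<..}"]) (use 1 in auto)
  next
    case 2
    have d: "((\<lambda>s. 0) has_real_derivative 2 * max 0 s) (at s)" using 2 by (auto intro!: derivative_eq_intros)
    show ?thesis by (rule has_field_derivative_transform_within_open[OF d, of "{..<0}"]) (use 2 in auto)
  next
    case 3
    have "((\<lambda>h::real. (max 0 h)\<^sup>2 / h) \<longlongrightarrow> 0) (at 0)"
    proof (rule Lim_null_comparison)
      show "\<forall>\<^sub>F h in at 0. norm ((max 0 h)\<^sup>2 / h) \<le> \<bar>h\<bar>"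
        by (intro always_eventually) (auto simp: max_def power2_eq_square)
      show "((\<lambda>h::real. \<bar>h\<bar>) \<longlongrightarrow> 0) (at 0)" using tendsto_rabs[OF tendsto_ident_at, of "0::real" UNIV] by simp
    qed
    then show ?thesis using 3 by (simp add: DERIV_def)
  qed
qed

text \<open>A tent of height 2 over the interval from 0 to 2. Writing it by truncations makes its
  antiderivative the explicit quadratic spline \<open>hat_int\<close>, which rises from 0 to
  2.\<close>

definition hat :: "real \<Rightarrow> real" where
  "hat s = 2 * max 0 s - 4 * max 0 (s - 1) + 2 * max 0 (s - 2)"

definition hat_int :: "real \<Rightarrow> real" where
  "hat_int s = (max 0 s)\<^sup>2 - 2 * (max 0 (s - 1))\<^sup>2 + (max 0 (s - 2))\<^sup>2"

lemma hat_int_derivative: "(hat_int has_real_derivative hat s) (at s)"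
proof -
  have sh: "((\<lambda>s. (max 0 (s - c))\<^sup>2) has_real_derivative 2 * max 0 (s - c) * 1) (at s)" for c
    by (rule DERIV_chain2[OF square_max_derivative]) (auto intro!: derivative_eq_intros)
  show ?thesis
    unfolding hat_int_def hat_def
    by (rule derivative_eq_intros sh square_max_derivative refl | simp)+
qed

lemma hat_nonneg: "0 \<le> hat s" by (auto simp: hat_def max_def)

lemma hat_pos_iff: "0 < hat s \<longleftrightarrow> 0 < s \<and> s < 2" by (auto simp: hat_def max_def)

lemma hat_continuous: "continuous_on UNIV hat"
  unfolding hat_def by (intro continuous_intros)

lemma hat_zero: "s \<le> 0 \<or> 2 \<le> s \<Longrightarrow> hat s = 0" by (auto simp: hat_def max_def)

lemma hat_int_left: "s \<le> 0 \<Longrightarrow> hat_int s = 0" by (auto simp: hat_int_def max_def)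

lemma hat_int_right: "2 \<le> s \<Longrightarrow> hat_int s = 2"
  by (auto simp: hat_int_def max_def power2_eq_square algebra_simps)

lemma test_function_hat: "test_function hat_int hat"
  unfolding test_function_def
  using hat_int_derivative hat_continuous by (auto intro!: exI[of _ 2] hat_zero hat_int_left)

lemma test_function_affine:
  assumes t: "test_function M m" and d: "0 < d"
  shows "test_function (\<lambda>s. M ((s - c) / d)) (\<lambda>s. m ((s - c) / d) / d)"
  unfolding test_function_def
proof (intro conjI allI)
  obtain R where R: "\<And>s. R < \<bar>s\<bar> \<Longrightarrow> m s = 0" "\<And>s. s < - R \<Longrightarrow> M s = 0"
    using t by (auto simp: test_function_def)
  show "((\<lambda>s. M ((s - c) / d)) has_real_derivative m ((s - c) / d) / d) (at s)" for s
  proof -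
    have "((\<lambda>s. M ((s - c) / d)) has_real_derivative m ((s - c) / d) * (1 / d)) (at s)"
      by (rule DERIV_chain2[OF test_functionD(1)[OF t]]) (use d in \<open>auto intro!: derivative_eq_intros\<close>)
    then show ?thesis by simp
  qed
  show "continuous_on UNIV (\<lambda>s. m ((s - c) / d) / d)"
    using d by (intro continuous_intros continuous_on_compose2[OF test_functionD(2)[OF t]]) auto
  show "\<exists>R. (\<forall>s. R < \<bar>s\<bar> \<longrightarrow> m ((s - c) / d) / d = 0) \<and> (\<forall>s. s < - R \<longrightarrow> M ((s - c) / d) = 0)"
  proof (intro exI[of _ "\<bar>c\<bar> + \<bar>R\<bar> * d"] conjI allI impI)
    fix s :: real
    show "m ((s - c) / d) / d = 0" if "\<bar>c\<bar> + \<bar>R\<bar> * d < \<bar>s\<bar>"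
    proof -
      have "\<bar>R\<bar> * d < \<bar>s - c\<bar>" using that by linarith
      then have "\<bar>R\<bar> < \<bar>(s - c) / d\<bar>" using d by (simp add: abs_divide less_divide_eq)
      then have "m ((s - c) / d) = 0" by (intro R(1)) linarith
      then show ?thesis by simp
    qed
    show "M ((s - c) / d) = 0" if "s < - (\<bar>c\<bar> + \<bar>R\<bar> * d)"
    proof (rule R(2))
      have "s - c < - \<bar>R\<bar> * d" using that by linarith
      then have "(s - c) / d < - \<bar>R\<bar>" using d by (simp add: divide_less_eq)
      then show "(s - c) / d < - R" by linarith
    qed
  qed
qed

text \<open>If \<open>c x0\<close> were nonzero, a product of narrow tents around \<open>x0\<close>
  would live where \<open>c\<close> keeps its sign, and the integral could not vanish.\<close>

lemma continuous_zero_of_test: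
  fixes c :: "real^'n::finite \<Rightarrow> real"
  assumes c: "continuous_on UNIV c"
    and z: "\<And>M m. (\<And>i. test_function (M i) (m i)) \<Longrightarrow> (\<integral>x. c x * (\<Prod>i\<in>UNIV. m i (x $ i)) \<partial>lborel) = 0"
  shows "c x0 = 0"
proof (rule ccontr)
  assume ne: "c x0 \<noteq> 0"
  have "isCont c x0" using c by (simp add: continuous_on_eq_continuous_at)
  then obtain e where e: "0 < e" "\<And>x. dist x x0 < e \<Longrightarrow> dist (c x) (c x0) < \<bar>c x0\<bar>"
    using ne unfolding continuous_at_eps_delta by (metis zero_less_abs_iff)
  have pos: "0 < c x * c x0" if "dist x x0 < e" for x
  proof -
    have "\<bar>c x - c x0\<bar> < \<bar>c x0\<bar>" using e(2)[OF that] by (simp add: dist_real_def)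
    then show ?thesis by (cases "0 < c x0") (auto simp: zero_less_mult_iff)
  qed
  \<comment> \<open>A cube of half-width \<open>d\<close> lies in the ball of radius
    \<open>e\<close>, because the norm is at most the sum of the coordinates in absolute
    value.\<close>
  define d where "d = e / (real CARD('n) + 1)"
  have d: "0 < d" using e by (simp add: d_def add_pos_pos)
  \<comment> \<open>The affine substitution carries the support of the tent, 0 to 2, to the interval
    of half-width \<open>d\<close> around \<open>x0 $ i\<close>.\<close>
  let ?M = "\<lambda>i s. hat_int ((s - (x0 $ i - d)) / d)" and ?m = "\<lambda>i s. hat ((s - (x0 $ i - d)) / d) / d"
  have t: "test_function (?M i) (?m i)" for i by (rule test_function_affine[OF test_function_hat d])
  have mp: "0 < ?m i s \<longleftrightarrow> \<bar>s - x0 $ i\<bar> < d" for i s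
    using d by (simp add: zero_less_divide_iff hat_pos_iff less_divide_eq divide_less_eq abs_less_iff) (auto simp: algebra_simps)
  have mn: "0 \<le> ?m i s" for i s using d by (simp add: hat_nonneg)
  let ?P = "\<lambda>x. \<Prod>i\<in>UNIV. ?m i (x $ i)"
  \<comment> \<open>The factor \<open>c x0\<close> makes the integrand nonnegative whatever the sign
    of \<open>c\<close> near \<open>x0\<close>.\<close>
  let ?f = "\<lambda>x. c x * ?P x * c x0"
  have P0: "?P x = 0 \<or> norm (x - x0) < e" for x
  proof (cases "\<forall>i. \<bar>x $ i - x0 $ i\<bar> < d")
    case True
    have "norm (x - x0) \<le> (\<Sum>i\<in>UNIV. \<bar>(x - x0) $ i\<bar>)" by (rule norm_le_l1_cart)
    also have "\<dots> \<le> real CARD('n) * d" using sum_bounded_above[of UNIV "\<lambda>i. \<bar>(x - x0) $ i\<bar>" d] True by (simp add: less_imp_le)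
    also have "\<dots> < e" using e by (simp add: d_def divide_less_eq add_pos_pos)
    finally show ?thesis by simp
  next
    case False
    then obtain i where "\<not> 0 < ?m i (x $ i)" using mp by blast
    then have "?m i (x $ i) = 0" using mn[where i=i and s="x $ i"] by linarith
    then show ?thesis by (auto intro!: bexI[of _ i])
  qed
  have fn: "0 \<le> ?f x" for x
    using P0[of x]
  proof
    assume "norm (x - x0) < e"
    then have "0 \<le> c x * c x0" using pos[of x] by (simp add: dist_norm)
    moreover have "0 \<le> ?P x" by (intro prod_nonneg) (use mn in auto)
    ultimately have "0 \<le> c x * c x0 * ?P x" by (rule mult_nonneg_nonneg)
    then show ?thesis by (simp add: mult_ac)
  next
    assume "?P x = 0"
    then show ?thesis by (simp only: mult_zero_right mult_zero_left order_refl)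
  qed
  have fc: "continuous_on UNIV ?f"
    by (intro continuous_intros c continuous_on_compose2[OF test_functionD(2)[OF t]]) auto
  have fi: "integrable lborel ?f"
  proof (rule compact_support_absolutely_integrable(2)[OF fc, of "norm x0 + e"])
    fix x assume "?f x \<noteq> 0"
    then have "norm (x - x0) < e" using P0[of x] by auto
    then show "norm x \<le> norm x0 + e" using norm_triangle_sub[of x x0] by linarith
  qed
  have "(\<integral>x. c x * ?P x \<partial>lborel) = 0" by (rule z) (rule t)
  then have "(\<integral>x. ?f x \<partial>lborel) = 0" by simp
  then have "AE x in lborel. ?f x = 0" using integral_nonneg_eq_0_iff_AE[OF fi] fn by simp
  then have "?f = (\<lambda>_. 0)" by (intro continuous_AE_eq fc) auto
  then have "?f x0 = 0" by metis
  moreover have "0 < ?P x0"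
  proof (intro prod_pos)
    fix i show "0 < ?m i (x0 $ i)" unfolding mp using d by simp
  qed
  ultimately show False using ne by (metis less_irrefl mult_eq_0_iff)
qed

lemma test_mix_UNIV: "test_mix UNIV M m z = (\<Prod>k\<in>UNIV. M k (z $ k))"
  by (simp add: test_mix_def)

lemma test_mix_singleton: "test_mix (- {j}) M m z = m j (z $ j) * (\<Prod>k\<in>UNIV - {j}. M k (z $ k))"
  unfolding test_mix_def double_compl by (simp add: Compl_eq_Diff_UNIV mult.commute)

context C1_flow
begin

lemma weight_bounded_b:
  assumes "weight_bounded a C r" shows "weight_bounded a (M * C) (\<lambda>y. b y $ j * r y)"
  unfolding weight_bounded_def
proof (intro conjI allI)
  fix x
  have "\<bar>b x $ j\<bar> \<le> M" using component_le_norm_cart[of "b x" j] bd[of x] by linarith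
  then show "\<bar>b x $ j * r x\<bar> \<le> M * C * (\<Prod>k\<in>UNIV. weight a (x $ k))"
    using mult_mono[OF _ weight_boundedD(3)[OF assms, of x]] M by (simp add: abs_mult mult.assoc)
qed (rule weight_boundedD(1)[OF assms])

lemma b_mult_continuous: "continuous_on UNIV r \<Longrightarrow> continuous_on UNIV (\<lambda>y. b y $ j * r y)"
  by (intro continuous_intros b_component)

text \<open>Each face leaves one coordinate untouched by integration, so that coordinate keeps
  \<open>m\<close> and all others receive antiderivatives. The sum over the faces is therefore the
  pairing of \<open>r\<close> with \<open>L\<close> of the product.\<close>

lemma flux_test:
  assumes r: "continuous_on UNIV r" "weight_bounded a C r" and t: "\<And>i. test_function (N i) (m i)"
  shows "(\<integral>x. flux b r x * (\<Prod>i\<in>UNIV. m i (x $ i)) \<partial>lborel) = (\<integral>z. test_drift b N m z * r z \<partial>lborel)"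
proof -
  note c = b_mult_continuous[OF r(1)] and w = weight_bounded_b[OF r(2)]
  have "(\<integral>x. flux b r x * (\<Prod>i\<in>UNIV. m i (x $ i)) \<partial>lborel) 
     = (\<Sum>j\<in>UNIV. \<integral>x. tail (-{j}) (\<lambda>y. b y $ j * r y) x * (\<Prod>i\<in>UNIV. m i (x $ i)) \<partial>lborel)"
    unfolding flux_def sum_distrib_right
    by (rule Bochner_Integration.integral_sum) (rule tail_test_integrable(1)[OF c w t])
  also have "\<dots> = (\<Sum>j\<in>UNIV. \<integral>z. test_mix (-{j}) N m z * (b z $ j * r z) \<partial>lborel)"
    by (simp add: tail_test[OF c w t])
  also have "\<dots> = (\<integral>z. (\<Sum>j\<in>UNIV. test_mix (-{j}) N m z * (b z $ j * r z)) \<partial>lborel)"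
    by (rule Bochner_Integration.integral_sum[symmetric]) (rule tail_test_integrable(2)[OF c w t])
  also have "\<dots> = (\<integral>z. test_drift b N m z * r z \<partial>lborel)"
    unfolding test_drift_def sum_distrib_right by (simp add: mult_ac)
  finally show ?thesis .
qed

lemma density_path_bound:
  assumes "density_path r" "0 \<le> T"
  obtains a C where "\<And>t. t \<in> {0..T} \<Longrightarrow> weight_bounded a C (r t)"
  using assms unfolding density_path_def by blast

lemma flux_joint_continuous:
  assumes r: "density_path r"
  shows "continuous_on ({0..} \<times> UNIV) (\<lambda>(t, x). flux b (r t) x)"
  unfolding continuous_on_sequentially comp_def
proof (intro ballI allI impI)
  fix u :: "nat \<Rightarrow> real \<times> (real^'n::_)" and l
  assume l: "l \<in> {0..} \<times> (UNIV :: (real^'n::_) set)" and u: "(\<forall>n. u n \<in> {0..} \<times> UNIV) \<and> u \<longlonglongrightarrow> l"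
  define t x where "t n = fst (u n)" and "x n = snd (u n)" for n
  obtain t0 x0 where l0: "l = (t0, x0)" "0 \<le> t0" using l by (cases l) auto
  have tx: "t \<longlonglongrightarrow> t0" "x \<longlonglongrightarrow> x0" "\<And>n. 0 \<le> t n"
    using u tendsto_fst[of u l] tendsto_snd[of u l] unfolding t_def[abs_def] x_def[abs_def] by (auto simp: l0 mem_Times_iff)
  \<comment> \<open>A convergent sequence of times stays bounded, and on a bounded time interval one
    weight bound serves all the densities.\<close>
  obtain T where T: "\<And>n. norm (t n) \<le> T" using convergent_imp_bounded[OF tx(1)] by (auto simp: bounded_iff)
  have T0: "0 \<le> T" using T[of 0] norm_ge_zero order_trans by blast
  obtain a C where w: "\<And>t. t \<in> {0..T} \<Longrightarrow> weight_bounded a C (r t)" using density_path_bound[OF r T0] by blast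
  have tT: "t n \<in> {0..T}" for n using T[of n] tx(3)[of n] by simp
  have "(\<lambda>n. tail (-{j}) (\<lambda>y. b y $ j * r (t n) y) (x n)) \<longlonglongrightarrow> tail (-{j}) (\<lambda>y. b y $ j * r t0 y) x0" for j
  proof (rule tail_tendsto[where C="M * C" and a=a, OF _ _ tx(2)])
    show "(\<lambda>y. b y $ j * r (t n) y) \<in> borel_measurable borel" for n
      by (intro borel_measurable_continuous_onI b_mult_continuous density_pathD(1)[OF r] tx)
    show "weight_bounded a (M * C) (\<lambda>y. b y $ j * r (t n) y)" for n
      by (rule weight_bounded_b[OF w[OF tT]])
    fix z
    let ?y = "\<lambda>n. overwrite (-{j}) z (x n)" and ?l = "overwrite (-{j}) z x0"
    have y: "?y \<longlonglongrightarrow> ?l" by (rule overwrite_tendsto[OF tx(2)])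
    have "isCont (\<lambda>y. b y $ j) ?l" using b_component(1)[of j] by (simp add: continuous_on_eq_continuous_at)
    then have 1: "(\<lambda>n. b (?y n) $ j) \<longlonglongrightarrow> b ?l $ j" by (rule isCont_tendsto_compose[OF _ y])
    have "(\<lambda>n. (t n, ?y n)) \<longlonglongrightarrow> (t0, ?l)" by (intro tendsto_Pair tx y)
    moreover have "continuous_on ({0..} \<times> UNIV) (\<lambda>(t, x). r t x)" using r by (simp add: density_path_def)
    ultimately have "(\<lambda>n. r (t n) (?y n)) \<longlonglongrightarrow> r t0 ?l"
      using l0 tx(3) unfolding continuous_on_sequentially comp_def
      by (auto dest!: bspec[of _ _ "(t0, ?l)"] spec[of _ "\<lambda>n. (t n, ?y n)"])
    then show "(\<lambda>n. b (?y n) $ j * r (t n) (?y n)) \<longlonglongrightarrow> b ?l $ j * r t0 ?l"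
      by (rule tendsto_mult[OF 1])
  qed
  then have "(\<lambda>n. flux b (r (t n)) (x n)) \<longlonglongrightarrow> flux b (r t0) x0"
    unfolding flux_def by (intro tendsto_sum)
  then show "(\<lambda>n. case u n of (t, x) \<Rightarrow> flux b (r t) x) \<longlonglongrightarrow> (case l of (t, x) \<Rightarrow> flux b (r t) x)"
    by (simp add: t_def x_def l0 case_prod_unfold)
qed

lemma flux_bounded:
  assumes r: "density_path r" and T: "0 \<le> T"
  shows "\<exists>B. \<forall>t\<in>{0..T}. \<forall>x. \<bar>flux b (r t) x\<bar> \<le> B"
proof -
  obtain a C where w: "\<And>t. t \<in> {0..T} \<Longrightarrow> weight_bounded a C (r t)" using density_path_bound[OF r T] by blast
  let ?B = "\<lambda>j::'n. M * C * (\<integral>z. (\<Prod>k\<in>-{j}. weight a (z k)) \<partial>PiM (-{j}) (\<lambda>_. lborel))"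
  have "\<bar>flux b (r t) x\<bar> \<le> (\<Sum>j\<in>UNIV. ?B j)" if t: "t \<in> {0..T}" for t x
    unfolding flux_def
  proof (rule order_trans[OF sum_abs sum_mono])
    fix j
    show "\<bar>tail (-{j}) (\<lambda>y. b y $ j * r t y) x\<bar> \<le> ?B j"
      using t by (intro tail_bounded weight_bounded_b w borel_measurable_continuous_onI b_mult_continuous density_pathD(1)[OF r]) auto
  qed
  then show ?thesis by blast
qed

lemma flux_time_continuous:
  assumes "density_path r" shows "continuous_on {0..t} (\<lambda>s. flux b (r s) x)"
proof -
  have "continuous_on {0..t} (\<lambda>s. (s, x))" by (intro continuous_intros)
  moreover have "(\<lambda>s. (s, x)) ` {0..t} \<subseteq> {0..} \<times> UNIV" by auto
  ultimately show ?thesis using continuous_on_compose2[OF flux_joint_continuous[OF assms]] by fastforce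
qed

lemma flux_time_test:
  assumes r: "density_path r" and t: "0 \<le> t" and tf: "\<And>i. test_function (N i) (m i)"
  shows "(\<integral>x. integral {0..t} (\<lambda>s. flux b (r s) x) * (\<Prod>i\<in>UNIV. m i (x $ i)) \<partial>lborel)
     = integral {0..t} (\<lambda>s. \<integral>z. test_drift b N m z * r s z \<partial>lborel)"
    and "continuous_on {0..t} (\<lambda>s. \<integral>z. test_drift b N m z * r s z \<partial>lborel)"
    and "integrable lborel (\<lambda>x. integral {0..t} (\<lambda>s. flux b (r s) x) * (\<Prod>i\<in>UNIV. m i (x $ i)))"
proof -
  let ?P = "\<lambda>x. \<Prod>i\<in>UNIV. m i (x $ i)"
  have P: "continuous_on UNIV (?P :: real^'n::_ \<Rightarrow> real)"
    by (intro continuous_intros continuous_on_compose2[OF test_functionD(2)[OF tf]]) auto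
  obtain B where B: "\<And>s x. s \<in> {0..t} \<Longrightarrow> \<bar>flux b (r s) x\<bar> \<le> B" using flux_bounded[OF r t] by blast
  have c: "continuous_on ({0..t} \<times> UNIV) (\<lambda>(s, x). flux b (r s) x * ?P x)"
  proof -
    have "continuous_on ({0..t} \<times> UNIV) (\<lambda>p. flux b (r (fst p)) (snd p))"
      by (rule continuous_on_subset[OF flux_joint_continuous[OF r, unfolded case_prod_unfold]]) auto
    moreover have "continuous_on ({0..t} \<times> (UNIV :: (real^'n::_) set)) (\<lambda>p. ?P (snd p))"
      by (rule continuous_on_compose2[OF P]) (auto intro!: continuous_intros)
    ultimately show ?thesis unfolding case_prod_unfold by (rule continuous_on_mult)
  qed
  have bnd: "\<bar>flux b (r s) x * ?P x\<bar> \<le> B * \<bar>?P x\<bar>" if "s \<in> {0..t}" for s x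
    unfolding abs_mult using B[OF that] by (intro mult_right_mono) auto
  have g: "integrable lborel (\<lambda>x::real^'n::_. B * \<bar>?P x\<bar>)"
    by (intro integrable_mult_right integrable_abs test_prod_integrable[of N m, OF tf])
  note F = fubini_time[OF c bnd g]
  have eq: "(\<integral>x. flux b (r s) x * ?P x \<partial>lborel) = (\<integral>z. test_drift b N m z * r s z \<partial>lborel)" if "s \<in> {0..t}" for s
  proof -
    have s: "0 \<le> s" using that by simp
    obtain a C where "weight_bounded a C (r s)" using density_pathD(2)[OF r s] by blast
    from flux_test[OF density_pathD(1)[OF r s] this tf] show ?thesis .
  qed
  show "(\<integral>x. integral {0..t} (\<lambda>s. flux b (r s) x) * ?P x \<partial>lborel) = integral {0..t} (\<lambda>s. \<integral>z. test_drift b N m z * r s z \<partial>lborel)"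
  proof -
    have L: "integral {0..t} (\<lambda>s. flux b (r s) x * ?P x) = integral {0..t} (\<lambda>s. flux b (r s) x) * ?P x" for x
      by simp
    have R: "integral {0..t} (\<lambda>s. \<integral>x. flux b (r s) x * ?P x \<partial>lborel) = integral {0..t} (\<lambda>s. \<integral>z. test_drift b N m z * r s z \<partial>lborel)"
      by (rule Henstock_Kurzweil_Integration.integral_cong) (rule eq)
    show ?thesis using F(2) unfolding L R .
  qed
  show "integrable lborel (\<lambda>x. integral {0..t} (\<lambda>s. flux b (r s) x) * ?P x)" using F(3) by simp
  show "continuous_on {0..t} (\<lambda>s. \<integral>z. test_drift b N m z * r s z \<partial>lborel)"
    by (rule continuous_on_eq[OF F(1) eq])
qed

lemma flow_test_derivative:
  assumes tf: "\<And>i. test_function (N i) (m i)" and s: "0 < s"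
  shows "((\<lambda>s. test_mix UNIV N m (X s z)) has_real_derivative test_drift b N m (X s z)) (at s)"
proof -
  have "((\<lambda>s. X s z $ i) has_real_derivative b (X s z) $ i) (at s)" for i
    using bounded_linear.has_vector_derivative[OF bounded_linear_vec_nth X_deriv_at[OF s]]
    by (simp add: has_real_derivative_iff_has_vector_derivative)
  then have "((\<lambda>s. N i (X s z $ i)) has_real_derivative m i (X s z $ i) * b (X s z) $ i) (at s)" for i
    by (rule DERIV_chain2[OF test_functionD(1)[OF tf]])
  then have "((\<lambda>s. \<Prod>i\<in>UNIV. N i (X s z $ i)) has_real_derivative
      (\<Sum>i\<in>UNIV. m i (X s z $ i) * b (X s z) $ i * (\<Prod>k\<in>UNIV - {i}. N k (X s z $ k)))) (at s)"
    by (rule has_field_derivative_prod)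
  then show ?thesis
    by (simp add: test_mix_UNIV test_drift_def test_mix_singleton mult_ac)
qed

lemma test_drift_continuous:
  assumes tf: "\<And>i. test_function (N i) (m i)" shows "continuous_on UNIV (test_drift b N m)"
  unfolding test_drift_def by (intro continuous_intros b_component test_mix_continuous tf)

lemma test_drift_bounded:
  assumes tf: "\<And>i. test_function (N i) (m i)" shows "\<exists>B\<ge>0. \<forall>z. \<bar>test_drift b N m z\<bar> \<le> B"
proof -
  obtain B where B: "0 \<le> B" "\<And>J z. \<bar>test_mix J N m z\<bar> \<le> B" using test_mix_bounded[of N m, OF tf] by blast
  have "\<bar>test_drift b N m z\<bar> \<le> (\<Sum>j\<in>(UNIV :: 'n set). M * B)" for z
    unfolding test_drift_def
  proof (rule order_trans[OF sum_abs sum_mono])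
    fix j
    have "\<bar>b z $ j\<bar> \<le> M" using component_le_norm_cart[of "b z" j] bd[of z] by linarith
    then show "\<bar>b z $ j * test_mix (-{j}) N m z\<bar> \<le> M * B" unfolding abs_mult by (intro mult_mono B) (use M in auto)
  qed
  moreover have "0 \<le> (\<Sum>j\<in>(UNIV :: 'n set). M * B)" using B M by (intro sum_nonneg) auto
  ultimately show ?thesis by blast
qed

lemma density_path_flow_density:
  assumes q: "continuous_on UNIV q" and p: "real CARD('n) < p" and d: "\<And>x. \<bar>q x\<bar> \<le> C * (1 + norm x) powr (- p)"
  shows "density_path (flow_density q)"
  unfolding density_path_def
proof (intro conjI allI impI)
  show "continuous_on ({0..} \<times> UNIV) (\<lambda>(t, x). flow_density q t x)" by (rule flow_density_joint_continuous[OF q])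
  fix T :: real assume T: "0 \<le> T"
  have "0 \<le> p" using p by (meson less_imp_le of_nat_0_le_iff order_le_less_trans)
  then obtain C' where "\<forall>t\<in>{0..T}. \<forall>y. \<bar>flow_density q t y\<bar> \<le> C' * (1 + norm y) powr (- p)"
    using flow_density_decay[OF T _ d] by blast
  then have "\<forall>t\<in>{0..T}. weight_bounded (p / real CARD('n)) C' (flow_density q t)"
    using powr_decay_weight_bounded[OF p] by blast
  then show "\<exists>a C. \<forall>t\<in>{0..T}. weight_bounded a C (flow_density q t)" by blast
qed

lemma flow_density_0: "flow_density q 0 = q"
  using Y_X[of 0] by (simp add: flow_density_def jac_def fun_eq_iff)

text \<open>Along a trajectory the product of antiderivatives changes by the time integral of
  \<open>L\<close> applied to it. Multiplying by the initial density, exchanging the integrals and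
  transporting at each time s gives the equation without differentiating a density.\<close>

lemma flow_density_weak:
  assumes q: "continuous_on UNIV q" and r: "density_path (flow_density q)" and t: "0 \<le> t"
    and tf: "\<And>i. test_function (N i) (m i)"
  shows "(\<integral>z. test_mix UNIV N m z * flow_density q t z \<partial>lborel) - (\<integral>z. test_mix UNIV N m z * q z \<partial>lborel)
     = integral {0..t} (\<lambda>s. \<integral>z. test_drift b N m z * flow_density q s z \<partial>lborel)"
proof -
  let ?T = "test_mix UNIV N m" and ?D = "test_drift b N m"
  have Tm: "?T \<in> borel_measurable borel" and Dm: "?D \<in> borel_measurable borel"
    by (intro borel_measurable_continuous_onI test_mix_continuous test_drift_continuous tf)+
  obtain B where B: "\<And>z. \<bar>?T z\<bar> \<le> B" using test_mix_bounded[of N m, OF tf] by blast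
  obtain B' where B': "\<And>z. \<bar>?D z\<bar> \<le> B'" using test_drift_bounded[of N m, OF tf] by blast
  have qi: "integrable lborel q" using density_pathD(3)[OF r order_refl] by (simp add: flow_density_0)
  have ftc: "integral {0..t} (\<lambda>s. ?D (X s z) * q z) = (?T (X t z) - ?T z) * q z" for z
  proof -
    have Xc: "continuous_on {0..t} (\<lambda>s. X s z)" by (rule continuous_on_subset[OF X_continuous]) auto
    have "((\<lambda>s. ?D (X s z)) has_integral (?T (X t z) - ?T (X 0 z))) {0..t}"
      by (rule fundamental_theorem_of_calculus_interior[OF t])
         (auto intro!: continuous_on_compose2[OF test_mix_continuous[of N m, OF tf] Xc] flow_test_derivative tf
           simp: has_real_derivative_iff_has_vector_derivative[symmetric])
    then have "((\<lambda>s. ?D (X s z) * q z) has_integral (?T (X t z) - ?T z) * q z) {0..t}"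
      by (intro has_integral_mult_left) simp
    then show ?thesis by (rule integral_unique)
  qed
  have c: "continuous_on ({0..t} \<times> UNIV) (\<lambda>(s, z). ?D (X s z) * q z)"
  proof -
    have "continuous_on ({0..t} \<times> UNIV) (\<lambda>p. X (fst p) (snd p))"
      by (rule continuous_on_subset[OF X_joint_continuous[unfolded case_prod_unfold]]) auto
    then have "continuous_on ({0..t} \<times> UNIV) (\<lambda>p. ?D (X (fst p) (snd p)))"
      by (rule continuous_on_compose2[OF test_drift_continuous[of N m, OF tf]]) auto
    moreover have "continuous_on ({0..t} \<times> UNIV) (\<lambda>p. q (snd p))"
      by (rule continuous_on_compose2[OF q]) (auto intro!: continuous_intros)
    ultimately show ?thesis unfolding case_prod_unfold by (rule continuous_on_mult)
  qed
  have bnd: "\<bar>?D (X s z) * q z\<bar> \<le> B' * \<bar>q z\<bar>" for s z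
    unfolding abs_mult using B' by (intro mult_right_mono) auto
  have g: "integrable lborel (\<lambda>z. B' * \<bar>q z\<bar>)" using qi by simp
  note F = fubini_time[OF c bnd g]
  have i1: "integrable lborel (\<lambda>z. ?T (X t z) * q z)" "integrable lborel (\<lambda>z. ?T z * q z)"
    using B by (auto intro!: integrable_bounded_mult(2)[OF qi, where B=B] Tm measurable_compose[OF X_measurable[OF t]])
  have "(\<integral>z. ?T z * flow_density q t z \<partial>lborel) - (\<integral>z. ?T z * q z \<partial>lborel) = (\<integral>z. (?T (X t z) - ?T z) * q z \<partial>lborel)"
    unfolding flow_transport[OF t Tm q, symmetric]
    by (subst Bochner_Integration.integral_diff[OF i1, symmetric]) (simp add: left_diff_distrib)
  also have "\<dots> = integral {0..t} (\<lambda>s. \<integral>z. ?D (X s z) * q z \<partial>lborel)"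
    using F(2) unfolding ftc .
  also have "\<dots> = integral {0..t} (\<lambda>s. \<integral>z. ?D z * flow_density q s z \<partial>lborel)"
    by (rule Henstock_Kurzweil_Integration.integral_cong) (use flow_transport[OF _ Dm q] in auto)
  finally show ?thesis .
qed

text \<open>Both sides are continuous in x, so product tests decide. Testing changes tails into
  pairings with the product of antiderivatives and fluxes into pairings with
  \<open>test_drift\<close>, where the weak equation is known.\<close>

lemma flow_density_integral_equation:
  assumes q: "continuous_on UNIV q" and r: "density_path (flow_density q)" and t: "0 \<le> t"
  shows "tail UNIV (flow_density q t) x = tail UNIV q x + integral {0..t} (\<lambda>s. flux b (flow_density q s) x)"
proof -
  let ?r = "flow_density q"
  let ?c = "\<lambda>x. tail UNIV (?r t) x - tail UNIV q x - integral {0..t} (\<lambda>s. flux b (?r s) x)"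
  obtain a C where w: "weight_bounded a C (?r t)" using density_pathD(2)[OF r t] by blast
  obtain a' C' where w': "weight_bounded a' C' q" using density_pathD(2)[OF r order_refl] by (auto simp: flow_density_0)
  note rc = density_pathD(1)[OF r t]
  have "?c x = 0"
  proof (rule continuous_zero_of_test)
    have "continuous_on (UNIV \<times> cbox 0 t) (\<lambda>(x, s). flux b (?r s) x)"
    proof -
      have "continuous_on (UNIV \<times> cbox 0 t) (\<lambda>p. (snd p, fst p))" by (intro continuous_intros)
      moreover have "(\<lambda>p. (snd p, fst p)) ` (UNIV \<times> cbox 0 t) \<subseteq> {0..} \<times> UNIV" by auto
      ultimately show ?thesis
        using continuous_on_compose2[OF flux_joint_continuous[OF r], of "UNIV \<times> cbox 0 t" "\<lambda>p. (snd p, fst p)"]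
        by (simp add: case_prod_unfold)
    qed
    from integral_continuous_on_param[OF this]
    show "continuous_on UNIV ?c"
      by (intro continuous_on_diff tail_continuous[OF rc w] tail_continuous[OF q w']) simp
  next
    fix N m :: "'n \<Rightarrow> real \<Rightarrow> real" assume tf: "\<And>i. test_function (N i) (m i)"
    let ?P = "\<lambda>x. \<Prod>i\<in>UNIV. m i (x $ i)"
    note i1 = tail_test_integrable(1)[OF rc w tf] and i2 = tail_test_integrable(1)[OF q w' tf]
      and i3 = flux_time_test(3)[OF r t tf]
    have "(\<integral>x. ?c x * ?P x \<partial>lborel) = (\<integral>x. tail UNIV (?r t) x * ?P x \<partial>lborel) - (\<integral>x. tail UNIV q x * ?P x \<partial>lborel)
       - (\<integral>x. integral {0..t} (\<lambda>s. flux b (?r s) x) * ?P x \<partial>lborel)"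
      unfolding left_diff_distrib
      by (subst Bochner_Integration.integral_diff Bochner_Integration.integrable_diff, intro Bochner_Integration.integrable_diff i1 i2 i3, rule i3)
         (subst Bochner_Integration.integral_diff[OF i1 i2], rule refl)
    also have "\<dots> = 0"
      unfolding tail_test[OF rc w tf] tail_test[OF q w' tf] flux_time_test(1)[OF r t tf]
      using flow_density_weak[OF q r t tf] by simp
    finally show "(\<integral>x. ?c x * ?P x \<partial>lborel) = 0" .
  qed
  then show ?thesis by simp
qed

end

section \<open>Mollification along trajectories and uniqueness\<close>

text \<open>The difference of two translates of the spline gives a continuously differentiable
  nonnegative function supported between 0 and 4. Being off centre is harmless: the limits use its
  mass and the moments of order 0 and 1 of its derivative.\<close>

definition bump :: "real \<Rightarrow> real" where "bump s = hat_int s - hat_int (s - 2)"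
definition dbump :: "real \<Rightarrow> real" where "dbump s = hat s - hat (s - 2)"

lemma bump_zero: "s \<le> 0 \<or> 4 \<le> s \<Longrightarrow> bump s = 0"
  by (auto simp: bump_def hat_int_left hat_int_right)

lemma dbump_zero: "s \<le> 0 \<or> 4 \<le> s \<Longrightarrow> dbump s = 0"
  by (auto simp: dbump_def hat_zero)

lemma test_function_bump: "test_function bump dbump"
  unfolding test_function_def
proof (intro conjI allI)
  show "(bump has_real_derivative dbump s) (at s)" for s
  proof -
    have "((\<lambda>s. hat_int (s - 2)) has_real_derivative hat (s - 2) * 1) (at s)"
      by (rule DERIV_chain2[OF hat_int_derivative]) (auto intro!: derivative_eq_intros)
    then show ?thesis
      unfolding bump_def[abs_def] dbump_def using DERIV_diff[OF hat_int_derivative] by simp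
  qed
  show "continuous_on UNIV dbump"
    unfolding dbump_def[abs_def]
    by (intro continuous_intros hat_continuous continuous_on_compose2[OF hat_continuous]) auto
  show "\<exists>R. (\<forall>s. R < \<bar>s\<bar> \<longrightarrow> dbump s = 0) \<and> (\<forall>s. s < - R \<longrightarrow> bump s = 0)"
  proof (intro exI[of _ 4] conjI allI impI)
    show "dbump s = 0" if "4 < \<bar>s\<bar>" for s using that by (intro dbump_zero) linarith
    show "bump s = 0" if "s < - 4" for s using that by (intro bump_zero) linarith
  qed
qed

lemma bump_continuous: "continuous_on UNIV bump" and dbump_continuous: "continuous_on UNIV dbump"
  using test_functionD[OF test_function_bump] by auto

lemma bump_support: "bump s \<noteq> 0 \<Longrightarrow> \<bar>s\<bar> \<le> 4" and dbump_support: "dbump s \<noteq> 0 \<Longrightarrow> \<bar>s\<bar> \<le> 4"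
  using bump_zero[of s] dbump_zero[of s] by (cases "s \<le> 0 \<or> 4 \<le> s"; auto)+

lemma compact_support_integrable_real:
  fixes f :: "real \<Rightarrow> real"
  assumes "continuous_on UNIV f" "\<And>s. f s \<noteq> 0 \<Longrightarrow> \<bar>s\<bar> \<le> 4"
  shows "integrable lborel f"
  by (rule compact_support_absolutely_integrable(2)[where R=4]) (use assms in auto)

lemma bump_integrable:
  "integrable lborel bump" "integrable lborel dbump" "integrable lborel (\<lambda>s. s * bump s)" "integrable lborel (\<lambda>s. s * dbump s)"
  by (rule compact_support_integrable_real;
      use bump_support dbump_support in \<open>auto intro!: continuous_intros bump_continuous dbump_continuous\<close>)+

definition bump_mass :: real where "bump_mass = (\<integral>s. bump s \<partial>lborel)"

lemma compact_support_derivative_integral: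
  fixes F f :: "real \<Rightarrow> real"
  assumes F: "\<And>s. (F has_real_derivative f s) (at s)" and f: "continuous_on UNIV f"
    and z: "F (-5) = 0" "F 5 = 0" "\<And>s. f s \<noteq> 0 \<Longrightarrow> \<bar>s\<bar> \<le> 4"
  shows "(\<integral>s. f s \<partial>lborel) = 0"
proof -
  have "(\<integral>s. f s \<partial>lborel) = (\<integral>s. indicator {-5..5} s *\<^sub>R f s \<partial>lborel)"
    using z(3) by (intro Bochner_Integration.integral_cong) (force simp: indicator_def abs_le_iff)+
  also have "\<dots> = F 5 - F (-5)"
    by (intro integral_FTC_atLeastAtMost)
       (auto simp: has_real_derivative_iff_has_vector_derivative[symmetric] intro: has_field_derivative_at_within F continuous_on_subset[OF f])
  finally show ?thesis using z by simp
qed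

lemma dbump_integral: "(\<integral>s. dbump s \<partial>lborel) = 0"
  by (rule compact_support_derivative_integral[OF test_functionD(1)[OF test_function_bump] dbump_continuous])
     (auto simp: bump_zero dest: dbump_support)

text \<open>Integration by parts: \<open>s * bump s\<close> has compact support, so its derivative
  integrates to 0.\<close>

lemma dbump_moment: "(\<integral>s. s * dbump s \<partial>lborel) = - bump_mass"
proof -
  have "(\<integral>s. s * dbump s + bump s \<partial>lborel) = 0"
  proof (rule compact_support_derivative_integral)
    show "((\<lambda>s. s * bump s) has_real_derivative s * dbump s + bump s) (at s)" for s
      by (auto intro!: derivative_eq_intros test_functionD(1)[OF test_function_bump])
    show "continuous_on UNIV (\<lambda>s. s * dbump s + bump s)"
      by (intro continuous_intros bump_continuous dbump_continuous)
    show "\<bar>s\<bar> \<le> 4" if "s * dbump s + bump s \<noteq> 0" for s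
      using that bump_support[of s] dbump_support[of s] by (cases "bump s = 0") auto
  qed (auto simp: bump_zero)
  then show ?thesis using bump_integrable by (simp add: bump_mass_def)
qed

text \<open>The bump is nonnegative because \<open>hat_int\<close> is nondecreasing. A vanishing
  integral would force the continuous bump to vanish identically, whereas its value at 2 is
  2.\<close>

lemma bump_mass_pos: "0 < bump_mass"
proof -
  have mono: "hat_int x \<le> hat_int y" if "x \<le> y" for x y
    by (rule DERIV_nonneg_imp_nondecreasing[OF that]) (use hat_int_derivative hat_nonneg in blast)
  have nn: "0 \<le> bump s" for s using mono[of "s - 2" s] by (simp add: bump_def)
  have "bump_mass \<noteq> 0"
  proof
    assume "bump_mass = 0"
    then have "AE s in lborel. bump s = 0"
      using integral_nonneg_eq_0_iff_AE[OF bump_integrable(1)] nn by (simp add: bump_mass_def)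
    then have "bump = (\<lambda>_. 0)" by (intro continuous_AE_eq bump_continuous) auto
    then have "bump 2 = 0" by metis
    then show False by (simp add: bump_def hat_int_left hat_int_right)
  qed
  moreover have "0 \<le> bump_mass" unfolding bump_mass_def using nn by (intro integral_nonneg_AE) auto
  ultimately show ?thesis by simp
qed

section \<open>The mollifier and its first moments\<close>

definition mollifier :: "real^'n::finite \<Rightarrow> real" where
  "mollifier y = (\<Prod>i\<in>UNIV. bump (y $ i))"

definition dmollifier :: "'n \<Rightarrow> real^'n::finite \<Rightarrow> real" where
  "dmollifier j y = dbump (y $ j) * (\<Prod>i\<in>UNIV - {j}. bump (y $ i))"

lemma mollifier_continuous: "continuous_on UNIV mollifier" "continuous_on UNIV (dmollifier j)"
  unfolding mollifier_def dmollifier_def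
  by (intro continuous_intros continuous_on_compose2[OF bump_continuous] continuous_on_compose2[OF dbump_continuous]; auto)+

lemma box_norm_le:
  fixes y :: "real^'n::finite"
  assumes "\<And>i. \<bar>y $ i\<bar> \<le> 4" shows "norm y \<le> real CARD('n) * 4"
  using norm_le_l1_cart[of y] sum_bounded_above[of UNIV "\<lambda>i. \<bar>y $ i\<bar>" 4] assms by simp

lemma mollifier_support:
  fixes y :: "real^'n::finite"
  shows "mollifier y \<noteq> 0 \<Longrightarrow> norm y \<le> real CARD('n) * 4" "dmollifier j y \<noteq> 0 \<Longrightarrow> norm y \<le> real CARD('n) * 4"
proof -
  show "norm y \<le> real CARD('n) * 4" if "mollifier y \<noteq> 0"
    using that bump_support by (intro box_norm_le) (auto simp: mollifier_def)
  show "norm y \<le> real CARD('n) * 4" if "dmollifier j y \<noteq> 0"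
  proof (rule box_norm_le)
    fix i show "\<bar>y $ i\<bar> \<le> 4"
      using that bump_support[of "y $ i"] dbump_support[of "y $ i"] by (cases "i = j") (auto simp: dmollifier_def)
  qed
qed

lemma mollifier_integrable:
  "integrable lborel (mollifier :: real^'n::finite \<Rightarrow> real)" "integrable lborel (\<lambda>y::real^'n::finite. y $ i * dmollifier j y)"
  "integrable lborel (\<lambda>y::real^'n::finite. norm y * dmollifier j y)"
  by (rule compact_support_absolutely_integrable(2)[where R="real CARD('n) * 4"];
      use mollifier_support in \<open>auto intro!: continuous_intros mollifier_continuous\<close>)+

lemma mollifier_integral:
  "integral\<^sup>L lborel (mollifier :: real^'n::finite \<Rightarrow> real) = bump_mass ^ CARD('n)"
proof -
  have "integral\<^sup>L lborel (mollifier :: real^'n \<Rightarrow> real) = (\<integral>z. (\<Prod>i\<in>(UNIV::'n set). bump (z i)) \<partial>PiM UNIV (\<lambda>_. lborel))"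
    by (subst integral_lborel_vec[OF borel_measurable_continuous_onI[OF mollifier_continuous(1)]]) (simp add: mollifier_def)
  also have "\<dots> = bump_mass ^ CARD('n)"
    by (subst lborel_PiM.product_integral_prod) (auto simp: bump_integrable bump_mass_def)
  finally show ?thesis .
qed

text \<open>The integral factorises over the coordinates. For distinct indices the factor at
  \<open>j\<close> is the integral of \<open>dbump\<close>, which is 0; for equal ones it is the
  first moment of \<open>dbump\<close>.\<close>

lemma dmollifier_moment:
  fixes i j :: "'n::finite"
  shows "(\<integral>y. y $ i * dmollifier j y \<partial>lborel) = (if i = j then - (bump_mass ^ CARD('n)) else 0)"
proof -
  let ?f = "\<lambda>l s. (if l = i then s else 1) * (if l = j then dbump s else bump s)"
  have eq: "y $ i * dmollifier j y = (\<Prod>l\<in>UNIV. ?f l (y $ l))" for y :: "real^'n"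
  proof -
    have "(\<Prod>l\<in>UNIV. if l = j then dbump (y $ l) else bump (y $ l)) = dmollifier j y"
      by (subst prod.remove[of _ j]) (auto simp: dmollifier_def intro!: prod.cong)
    moreover have "(\<Prod>l\<in>UNIV. if l = i then y $ l else 1) = y $ i" by simp
    ultimately show ?thesis by (simp only: prod.distrib)
  qed
  have int: "integrable lborel (?f l)" for l
    using bump_integrable by (cases "l = i"; cases "l = j") auto
  have fm: "(\<lambda>y::real^'n. \<Prod>l\<in>UNIV. ?f l (y $ l)) \<in> borel_measurable borel"
    unfolding eq[symmetric] by (intro borel_measurable_continuous_onI continuous_intros mollifier_continuous)
  have "(\<integral>y. y $ i * dmollifier j y \<partial>lborel) = (\<integral>z. (\<Prod>l\<in>UNIV. ?f l (z l)) \<partial>PiM UNIV (\<lambda>_. lborel))"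
    unfolding eq integral_lborel_vec[OF fm] by (simp only: vec_lambda_beta)
  also have "\<dots> = (\<Prod>l\<in>UNIV. \<integral>s. ?f l s \<partial>lborel)"
    by (rule lborel_PiM.product_integral_prod) (auto intro: int)
  also have "\<dots> = (if i = j then - (bump_mass ^ CARD('n)) else 0)"
  proof (cases "i = j")
    case True
    have "(\<Prod>l\<in>UNIV. \<integral>s. ?f l s \<partial>lborel) = (\<integral>s. ?f j s \<partial>lborel) * (\<Prod>l\<in>UNIV - {j}. \<integral>s. ?f l s \<partial>lborel)"
      by (rule prod.remove) auto
    also have "(\<Prod>l\<in>UNIV - {j}. \<integral>s. ?f l s \<partial>lborel) = (\<Prod>l\<in>UNIV - {j}. bump_mass)"
      using True by (intro prod.cong) (auto simp: bump_mass_def)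
    also have "(\<integral>s. ?f j s \<partial>lborel) = - bump_mass" using True dbump_moment by simp
    also have "- bump_mass * (\<Prod>l\<in>UNIV - {j}. bump_mass) = - (\<Prod>l\<in>(UNIV :: 'n set). bump_mass)"
      by (subst prod.remove[of UNIV j]) auto
    finally show ?thesis using True by simp
  next
    case False
    then have "(\<integral>s. ?f j s \<partial>lborel) = 0" using dbump_integral by simp
    then have "(\<Prod>l\<in>UNIV. \<integral>s. ?f l s \<partial>lborel) = 0"
      by (intro prod_zero bexI[of _ j]) simp_all
    then show ?thesis using False by simp
  qed
  finally show ?thesis .
qed

lemma integral_lborel_affine:
  fixes f :: "'a::euclidean_space \<Rightarrow> real"
  assumes [measurable]: "f \<in> borel_measurable borel" and e: "0 < e"
  shows "(\<integral>z. f z \<partial>lborel) = e ^ DIM('a) * (\<integral>y. f (x + e *\<^sub>R y) \<partial>lborel)"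
proof -
  have "(\<integral>z. f z \<partial>lborel) = (\<integral>z. f z \<partial>density (distr lborel borel (\<lambda>y. x + e *\<^sub>R y)) (\<lambda>_. ennreal (\<bar>e\<bar> ^ DIM('a))))"
    using lborel_affine[of e x] e by (simp add: ennreal_power)
  also have "\<dots> = (\<integral>y. \<bar>e\<bar> ^ DIM('a) * f (x + e *\<^sub>R y) \<partial>lborel)"
    by (subst integral_density) (auto simp: integral_distr)
  finally show ?thesis using e by simp
qed

context C1_flow
begin

text \<open>Two independent times, that of the density and that of the kernel. Joint continuity is
  the hypothesis under which partial derivatives in these times combine to a total one.\<close>

lemma dominated_pairing_continuous:
  fixes G :: "real \<Rightarrow> real^'n::_ \<Rightarrow> real"
  assumes r: "density_path r" and G: "continuous_on ({0..} \<times> UNIV) (\<lambda>(s, z). G s z)"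
    and B: "\<And>s z. 0 \<le> s \<Longrightarrow> \<bar>G s z\<bar> \<le> B"
  shows "continuous_on ({0..} \<times> {0..}) (\<lambda>(t, s). \<integral>z. G s z * r t z \<partial>lborel)"
  unfolding continuous_on_sequentially comp_def
proof (intro ballI allI impI)
  fix u :: "nat \<Rightarrow> real \<times> real" and l
  assume l: "l \<in> {0..} \<times> {0..}" and u: "(\<forall>n. u n \<in> {0..} \<times> {0..}) \<and> u \<longlonglongrightarrow> l"
  define t s where "t n = fst (u n)" and "s n = snd (u n)" for n
  obtain t0 s0 where l0: "l = (t0, s0)" "0 \<le> t0" "0 \<le> s0" using l by (cases l) auto
  have ts: "t \<longlonglongrightarrow> t0" "s \<longlonglongrightarrow> s0" "\<And>n. 0 \<le> t n" "\<And>n. 0 \<le> s n"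
    using u tendsto_fst[of u l] tendsto_snd[of u l] unfolding t_def[abs_def] s_def[abs_def] by (auto simp: l0 mem_Times_iff)
  obtain T where T: "\<And>n. norm (t n) \<le> T" using convergent_imp_bounded[OF ts(1)] by (auto simp: bounded_iff)
  have T0: "0 \<le> T" using T[of 0] norm_ge_zero order_trans by blast
  obtain a C where w: "\<And>t. t \<in> {0..T} \<Longrightarrow> weight_bounded a C (r t)" using density_path_bound[OF r T0] by blast
  have tT: "t n \<in> {0..T}" for n using T[of n] ts(3)[of n] by simp
  have rc: "continuous_on ({0..} \<times> UNIV) (\<lambda>(t, x). r t x)" using r by (simp add: density_path_def)
  have Gm: "G s \<in> borel_measurable borel" if "0 \<le> s" for s
    by (intro borel_measurable_continuous_onI continuous_on_section[OF G]) (use that in simp)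
  have rm: "r t \<in> borel_measurable borel" if "0 \<le> t" for t
    by (intro borel_measurable_continuous_onI density_pathD(1)[OF r that])
  have wi: "integrable lborel (\<lambda>z::real^'n::_. C * (\<Prod>k\<in>UNIV. weight a (z $ k)))"
  proof (rule weight_bounded_integrable)
    show "weight_bounded a C (\<lambda>z::real^'n::_. C * (\<Prod>k\<in>UNIV. weight a (z $ k)))"
      using weight_boundedD(1,2)[OF w[OF tT[of 0]]] by (auto simp: weight_bounded_def abs_mult abs_prod)
  qed measurable
  have "(\<lambda>n. \<integral>z. G (s n) z * r (t n) z \<partial>lborel) \<longlonglongrightarrow> (\<integral>z. G s0 z * r t0 z \<partial>lborel)"
  proof (rule integral_dominated_convergence[where w="\<lambda>z. B * (C * (\<Prod>k\<in>UNIV. weight a (z $ k)))"])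
    show "integrable lborel (\<lambda>z::real^'n::_. B * (C * (\<Prod>k\<in>UNIV. weight a (z $ k))))"
      by (rule integrable_mult_right[OF wi])
    show "AE z in lborel. (\<lambda>n. G (s n) z * r (t n) z) \<longlonglongrightarrow> G s0 z * r t0 z"
    proof (rule AE_I2)
      fix z :: "real^'n::_"
      have "(\<lambda>n. (s n, z)) \<longlonglongrightarrow> (s0, z)" "(\<lambda>n. (t n, z)) \<longlonglongrightarrow> (t0, z)" by (intro tendsto_Pair ts tendsto_const)+
      then have "(\<lambda>n. G (s n) z) \<longlonglongrightarrow> G s0 z" "(\<lambda>n. r (t n) z) \<longlonglongrightarrow> r t0 z"
        using continuous_on_tendsto_compose[OF G, of "\<lambda>n. (s n, z)" "(s0, z)"]
          continuous_on_tendsto_compose[OF rc, of "\<lambda>n. (t n, z)" "(t0, z)"] ts l0 by auto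
      then show "(\<lambda>n. G (s n) z * r (t n) z) \<longlonglongrightarrow> G s0 z * r t0 z" by (rule tendsto_mult)
    qed
    show "AE z in lborel. norm (G (s n) z * r (t n) z) \<le> B * (C * (\<Prod>k\<in>UNIV. weight a (z $ k)))" for n
      unfolding real_norm_def abs_mult
      by (intro AE_I2 mult_mono B[OF ts(4)] weight_boundedD(3)[OF w[OF tT]] order_trans[OF abs_ge_zero B[OF ts(4)]] abs_ge_zero)
  qed (use Gm rm ts l0 in auto)
  then show "(\<lambda>n. case u n of (t, s) \<Rightarrow> \<integral>z. G s z * r t z \<partial>lborel) \<longlonglongrightarrow> (case l of (t, s) \<Rightarrow> \<integral>z. G s z * r t z \<partial>lborel)"
    by (simp add: t_def s_def l0 case_prod_unfold)
qed

lemma integral_equation_derivative: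
  fixes f g :: "real \<Rightarrow> real"
  assumes f: "\<And>t. 0 \<le> t \<Longrightarrow> f t = c + integral {0..t} g" and g: "\<And>t. 0 \<le> t \<Longrightarrow> continuous_on {0..t} g" and t: "0 \<le> t"
  shows "(f has_real_derivative g t) (at t within {0..})"
proof -
  have "((\<lambda>t. integral {0..t} g) has_real_derivative g t) (at t within {0..t+1})"
    by (rule integral_has_real_derivative[OF g]) (use t in auto)
  moreover have "at t within {0..t+1} = at t within {0..}"
    by (rule at_within_nhd[of t "{..<t+1}"]) auto
  ultimately have "((\<lambda>t. integral {0..t} g) has_real_derivative g t) (at t within {0..})" by simp
  then have "((\<lambda>t. c + integral {0..t} g) has_real_derivative g t) (at t within {0..})"
    using DERIV_add[OF DERIV_const] by fastforce
  then show ?thesis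
    by (rule has_field_derivative_transform_within[where d=1]) (use t f in auto)
qed

text \<open>The passage from tails back to densities: testing the equation in x yields the weak
  continuity equation for \<open>r\<close>, against products of antiderivatives.\<close>

lemma weak_of_integral_equation:
  assumes r: "density_path r"
    and eq: "\<And>t x. 0 \<le> t \<Longrightarrow> tail UNIV (r t) x = tail UNIV (r 0) x + integral {0..t} (\<lambda>s. flux b (r s) x)"
    and t: "0 \<le> t" and tf: "\<And>i. test_function (N i) (m i)"
  shows "(\<integral>z. test_mix UNIV N m z * r t z \<partial>lborel) = (\<integral>z. test_mix UNIV N m z * r 0 z \<partial>lborel)
     + integral {0..t} (\<lambda>s. \<integral>z. test_drift b N m z * r s z \<partial>lborel)"
proof -
  let ?P = "\<lambda>x. \<Prod>i\<in>UNIV. m i (x $ i)"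
  obtain a C where w: "weight_bounded a C (r t)" using density_pathD(2)[OF r t] by blast
  obtain a' C' where w': "weight_bounded a' C' (r 0)" using density_pathD(2)[OF r order_refl] by blast
  note c = density_pathD(1)[OF r t] and c' = density_pathD(1)[OF r order_refl]
  have "(\<integral>x. tail UNIV (r t) x * ?P x \<partial>lborel)
     = (\<integral>x. tail UNIV (r 0) x * ?P x + integral {0..t} (\<lambda>s. flux b (r s) x) * ?P x \<partial>lborel)"
    by (simp add: eq[OF t] distrib_right)
  also have "\<dots> = (\<integral>x. tail UNIV (r 0) x * ?P x \<partial>lborel) + (\<integral>x. integral {0..t} (\<lambda>s. flux b (r s) x) * ?P x \<partial>lborel)"
    by (rule Bochner_Integration.integral_add[OF tail_test_integrable(1)[OF c' w' tf] flux_time_test(3)[OF r t tf]])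
  finally show ?thesis
    unfolding tail_test[OF c w tf] tail_test[OF c' w' tf] flux_time_test(1)[OF r t tf] .
qed

section \<open>The mollified density along a trajectory\<close>

definition rescale :: "real \<Rightarrow> real^'n::_ \<Rightarrow> real^'n::_ \<Rightarrow> real^'n::_" where
  "rescale e x z = (1 / e) *\<^sub>R (z - x)"

lemma rescale_nth: "rescale e x z $ i = (z $ i - x $ i) / e"
  by (simp add: rescale_def)

lemma mollifier_bound: "\<exists>B\<ge>0. \<forall>y::real^'n::_. \<bar>mollifier y\<bar> \<le> B \<and> (\<forall>j. \<bar>dmollifier j y\<bar> \<le> B)"
proof -
  obtain B where B: "0 \<le> B" "\<And>J (z :: real^'n::_). \<bar>test_mix J (\<lambda>_. bump) (\<lambda>_. dbump) z\<bar> \<le> B"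
    using test_mix_bounded[of "\<lambda>_. bump" "\<lambda>_. dbump", OF test_function_bump] by blast
  have "mollifier y = test_mix UNIV (\<lambda>_. bump) (\<lambda>_. dbump) y" "dmollifier j y = test_mix (-{j}) (\<lambda>_. bump) (\<lambda>_. dbump) y" for j and y :: "real^'n::_"
    by (simp_all add: mollifier_def dmollifier_def test_mix_UNIV test_mix_singleton)
  then show ?thesis using B by (intro exI[of _ B]) auto
qed

lemma mollifier_pairing_time:
  assumes r: "density_path r"
    and eq: "\<And>t x. 0 \<le> t \<Longrightarrow> tail UNIV (r t) x = tail UNIV (r 0) x + integral {0..t} (\<lambda>s. flux b (r s) x)"
    and t: "0 \<le> t" and e: "0 < e"
  shows "((\<lambda>t. \<integral>z. mollifier (rescale e x z) * r t z \<partial>lborel) has_real_derivative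
     (\<integral>z. (\<Sum>j\<in>UNIV. b z $ j * (dmollifier j (rescale e x z) / e)) * r t z \<partial>lborel)) (at t within {0..})"
proof -
  \<comment> \<open>The bump takes the role of the antiderivative and \<open>dbump\<close> that of
    the test function, so the weak equation applies to the rescaled mollifier itself.\<close>
  let ?N = "\<lambda>i s. bump ((s - x $ i) / e)" and ?m = "\<lambda>i s. dbump ((s - x $ i) / e) / e"
  have tf: "test_function (?N i) (?m i)" for i by (rule test_function_affine[OF test_function_bump e])
  have mix: "test_mix UNIV ?N ?m = (\<lambda>z. mollifier (rescale e x z))"
    by (simp add: fun_eq_iff test_mix_UNIV mollifier_def rescale_nth)
  have drift: "test_drift b ?N ?m = (\<lambda>z. \<Sum>j\<in>UNIV. b z $ j * (dmollifier j (rescale e x z) / e))"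
    by (simp add: fun_eq_iff test_drift_def test_mix_singleton dmollifier_def rescale_nth)
  have 1: "(\<integral>z. mollifier (rescale e x z) * r t z \<partial>lborel) = (\<integral>z. mollifier (rescale e x z) * r 0 z \<partial>lborel)
     + integral {0..t} (\<lambda>s. \<integral>z. (\<Sum>j\<in>UNIV. b z $ j * (dmollifier j (rescale e x z) / e)) * r s z \<partial>lborel)" if "0 \<le> t" for t
    using weak_of_integral_equation[where N="?N" and m="?m", OF r eq that tf] unfolding mix drift .
  have 2: "continuous_on {0..t} (\<lambda>s. \<integral>z. (\<Sum>j\<in>UNIV. b z $ j * (dmollifier j (rescale e x z) / e)) * r s z \<partial>lborel)" if "0 \<le> t" for t
    using flux_time_test(2)[where N="?N" and m="?m", OF r that tf] unfolding drift .
  show ?thesis by (rule integral_equation_derivative[OF 1 2 t])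
qed

lemma mollifier_path_derivative:
  assumes s: "0 < s" and e: "0 < e"
  shows "((\<lambda>s. mollifier (rescale e (X s w) z)) has_real_derivative
    - (\<Sum>j\<in>UNIV. b (X s w) $ j * (dmollifier j (rescale e (X s w) z) / e))) (at s)"
proof -
  have "((\<lambda>s. X s w $ i) has_real_derivative b (X s w) $ i) (at s)" for i
    using bounded_linear.has_vector_derivative[OF bounded_linear_vec_nth X_deriv_at[OF s]]
    by (simp add: has_real_derivative_iff_has_vector_derivative)
  then have "((\<lambda>s. (z $ i - X s w $ i) / e) has_real_derivative - (b (X s w) $ i) / e) (at s)" for i
    using e by (auto intro!: derivative_eq_intros)
  then have "((\<lambda>s. bump ((z $ i - X s w $ i) / e)) has_real_derivative
      dbump ((z $ i - X s w $ i) / e) * (- (b (X s w) $ i) / e)) (at s)" for i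
    by (rule DERIV_chain2[OF test_functionD(1)[OF test_function_bump]])
  then have "((\<lambda>s. \<Prod>i\<in>UNIV. bump ((z $ i - X s w $ i) / e)) has_real_derivative
      (\<Sum>i\<in>UNIV. dbump ((z $ i - X s w $ i) / e) * (- (b (X s w) $ i) / e) * (\<Prod>k\<in>UNIV - {i}. bump ((z $ k - X s w $ k) / e)))) (at s)"
    by (rule has_field_derivative_prod)
  then show ?thesis
    by (simp add: mollifier_def dmollifier_def rescale_nth sum_negf[symmetric] mult_ac)
qed

text \<open>The derivative of the mollifier in the time of its moving centre; the sign arises
  because the centre is subtracted.\<close>

definition path_drift :: "real \<Rightarrow> real^'n::_ \<Rightarrow> real \<Rightarrow> real^'n::_ \<Rightarrow> real" where
  "path_drift e w s z = - (\<Sum>j\<in>UNIV. b (X s w) $ j * (dmollifier j (rescale e (X s w) z) / e))"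

lemma path_continuous: "continuous_on ({0..} \<times> UNIV) (\<lambda>p. X (fst p) w)"
  by (rule continuous_on_compose2[OF X_continuous]) (auto intro!: continuous_intros)

lemma path_rescale_continuous:
  "continuous_on ({0..} \<times> UNIV) (\<lambda>p. rescale e (X (fst p) w) (snd p))"
  unfolding rescale_def by (intro continuous_intros path_continuous)

lemma path_drift_continuous:
  "continuous_on ({0..} \<times> UNIV) (\<lambda>(s, z). path_drift e w s z)"
  unfolding path_drift_def case_prod_unfold divide_inverse
  by (intro continuous_intros continuous_on_compose2[OF b_component(1) path_continuous]
      continuous_on_compose2[OF mollifier_continuous(2) path_rescale_continuous]) auto

lemma path_drift_bounded:
  assumes e: "0 < e" shows "\<exists>B. \<forall>s z. \<bar>path_drift e w s z\<bar> \<le> B"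
proof -
  obtain B where B: "0 \<le> B" "\<And>j (y :: real^'n::_). \<bar>dmollifier j y\<bar> \<le> B" using mollifier_bound by blast
  have "\<bar>path_drift e w s z\<bar> \<le> (\<Sum>j\<in>(UNIV :: 'n set). M * (B / e))" for s z
    unfolding path_drift_def abs_minus
  proof (rule order_trans[OF sum_abs sum_mono])
    fix j
    have "\<bar>b (X s w) $ j\<bar> \<le> M" using component_le_norm_cart[of "b (X s w)" j] bd[of "X s w"] by linarith
    then show "\<bar>b (X s w) $ j * (dmollifier j (rescale e (X s w) z) / e)\<bar> \<le> M * (B / e)"
      unfolding abs_mult abs_divide using e B M by (intro mult_mono divide_mono) auto
  qed
  then show ?thesis by blast
qed

lemma mollifier_pairing_space:
  assumes r: "density_path r" and t: "0 \<le> t" and s: "0 \<le> s" and e: "0 < e"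
  shows "((\<lambda>s. \<integral>z. mollifier (rescale e (X s w) z) * r t z \<partial>lborel) has_real_derivative
     (\<integral>z. path_drift e w s z * r t z \<partial>lborel)) (at s within {0..})"
proof -
  obtain B where B: "\<And>s z. \<bar>path_drift e w s z\<bar> \<le> B" using path_drift_bounded[OF e] by blast
  obtain D where D: "\<And>y :: real^'n::_. \<bar>mollifier y\<bar> \<le> D" using mollifier_bound by blast
  note ri = density_pathD(3)[OF r t] and rc = density_pathD(1)[OF r t]
  have mc: "continuous_on UNIV (\<lambda>z. mollifier (rescale e x z))" for x :: "real^'n::_"
    unfolding rescale_def by (intro continuous_on_compose2[OF mollifier_continuous(1)] continuous_intros) auto
  have mi: "integrable lborel (\<lambda>z. mollifier (rescale e x z) * r t z)" for x
    using D by (intro integrable_bounded_mult(2)[OF ri, where B=D]) (auto intro!: borel_measurable_continuous_onI mc)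
  have bnd: "\<bar>path_drift e w s z * r t z\<bar> \<le> B * \<bar>r t z\<bar>" for s z
    unfolding abs_mult using B by (intro mult_right_mono) auto
  have g: "integrable lborel (\<lambda>z. B * \<bar>r t z\<bar>)" using ri by simp
  have c: "continuous_on ({0..s} \<times> UNIV) (\<lambda>(s, z). path_drift e w s z * r t z)" for s
    unfolding case_prod_unfold
    by (intro continuous_on_mult continuous_on_subset[OF path_drift_continuous[unfolded case_prod_unfold]] continuous_on_compose2[OF rc])
       (auto intro!: continuous_intros)
  note F = fubini_time[OF c bnd g]
  show ?thesis
  proof (rule integral_equation_derivative[OF _ F(1) s])
    fix s :: real assume s: "0 \<le> s"
    have ftc: "integral {0..s} (\<lambda>s. path_drift e w s z * r t z) = mollifier (rescale e (X s w) z) * r t z - mollifier (rescale e (X 0 w) z) * r t z" for z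
    proof -
      have Xc: "continuous_on {0..s} (\<lambda>s. X s w)" by (rule continuous_on_subset[OF X_continuous]) auto
      have mcX: "continuous_on {0..s} (\<lambda>s. mollifier (rescale e (X s w) z))"
        unfolding rescale_def by (intro continuous_on_compose2[OF mollifier_continuous(1)] continuous_intros Xc) auto
      have "((\<lambda>s. path_drift e w s z) has_integral (mollifier (rescale e (X s w) z) - mollifier (rescale e (X 0 w) z))) {0..s}"
        by (rule fundamental_theorem_of_calculus_interior[OF s])
           (auto intro!: mcX mollifier_path_derivative e
             simp: path_drift_def has_real_derivative_iff_has_vector_derivative[symmetric] simp del: times_divide_eq_right)
      then have "((\<lambda>s. path_drift e w s z * r t z) has_integral (mollifier (rescale e (X s w) z) - mollifier (rescale e (X 0 w) z)) * r t z) {0..s}"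
        by (rule has_integral_mult_left)
      then show ?thesis by (subst (asm) left_diff_distrib) (rule integral_unique)
    qed
    show "(\<integral>z. mollifier (rescale e (X s w) z) * r t z \<partial>lborel) = (\<integral>z. mollifier (rescale e (X 0 w) z) * r t z \<partial>lborel)
      + integral {0..s} (\<lambda>s. \<integral>z. path_drift e w s z * r t z \<partial>lborel)"
      using F(2)[of s] unfolding ftc Bochner_Integration.integral_diff[OF mi mi] by simp
  qed
qed

text \<open>Time enters through the density and through the centre of the mollifier. These are
  treated as two variables, and the chain rule is applied along the diagonal; continuity of the
  partial derivative in the centre time supplies total differentiability.\<close>

lemma mollifier_pairing_diagonal:
  assumes r: "density_path r"
    and eq: "\<And>t x. 0 \<le> t \<Longrightarrow> tail UNIV (r t) x = tail UNIV (r 0) x + integral {0..t} (\<lambda>s. flux b (r s) x)"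
    and t: "0 \<le> t" and e: "0 < e"
  shows "((\<lambda>t. \<integral>z. mollifier (rescale e (X t w) z) * r t z \<partial>lborel) has_real_derivative
     (\<integral>z. (\<Sum>j\<in>UNIV. b z $ j * (dmollifier j (rescale e (X t w) z) / e)) * r t z \<partial>lborel)
      + (\<integral>z. path_drift e w t z * r t z \<partial>lborel)) (at t within {0..})"
proof -
  let ?H = "\<lambda>t s. \<integral>z. mollifier (rescale e (X s w) z) * r t z \<partial>lborel"
  let ?Ht = "\<integral>z. (\<Sum>j\<in>UNIV. b z $ j * (dmollifier j (rescale e (X t w) z) / e)) * r t z \<partial>lborel"
  let ?Hs = "\<lambda>t s. \<integral>z. path_drift e w s z * r t z \<partial>lborel"
  obtain B where B: "\<And>s z. \<bar>path_drift e w s z\<bar> \<le> B" using path_drift_bounded[OF e] by blast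
  have "((\<lambda>(t, s). ?H t s) has_derivative (\<lambda>(ht, hs). ?Ht * ht + blinfun_mult_right (?Hs t t) hs)) (at (t, t) within {0..} \<times> {0..})"
  proof (rule has_derivative_partialsI[where fy="\<lambda>t s. blinfun_mult_right (?Hs t s)"])
    show "((\<lambda>t'. ?H t' t) has_derivative (*) ?Ht) (at t within {0..})"
      using mollifier_pairing_time[OF r eq t e] by (simp add: has_field_derivative_def)
    show "((\<lambda>s. ?H t' s) has_derivative blinfun_apply (blinfun_mult_right (?Hs t' s'))) (at s' within {0..})"
      if "t' \<in> {0..}" "s' \<in> {0..}" for t' s'
      using mollifier_pairing_space[OF r _ _ e, of t' s' w] that by (simp add: has_field_derivative_eq_has_derivative_blinfun)
    have "continuous_on ({0..} \<times> {0..}) (\<lambda>(t, s). ?Hs t s)"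
      by (rule dominated_pairing_continuous[OF r path_drift_continuous B])
    then have "continuous (at (t, t) within {0..} \<times> {0..}) (\<lambda>(t, s). ?Hs t s)"
      using t by (simp add: continuous_on_eq_continuous_within)
    then show "continuous (at (t, t) within {0..} \<times> {0..}) (\<lambda>(t, s). blinfun_mult_right (?Hs t s))"
      unfolding case_prod_unfold by (rule bounded_linear.continuous[OF bounded_linear_blinfun_mult_right])
  qed (use t in auto)
  note d = this
  have img: "(\<lambda>t. (t, t)) ` {0..} \<subseteq> {0..} \<times> {0::real..}" by auto
  have "((\<lambda>t. (t, t)) has_derivative (\<lambda>h. (h, h))) (at t within {0..})"
    by (intro has_derivative_Pair has_derivative_ident)
  from has_derivative_in_compose[OF this has_derivative_subset[OF d img]]
  have "((\<lambda>t. ?H t t) has_derivative (\<lambda>h. ?Ht * h + ?Hs t t * h)) (at t within {0..})"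
    by simp
  then show ?thesis
    unfolding has_field_derivative_def by (rule has_derivative_eq_rhs) (simp add: fun_eq_iff distrib_right)
qed

lemma jac_derivative:
  assumes "0 \<le> t"
  shows "((\<lambda>t. jac t w) has_real_derivative jac t w * divergence b (X t w)) (at t within {0..})"
proof -
  have "((\<lambda>t. integral {0..t} (\<lambda>s. divergence b (X s w))) has_real_derivative divergence b (X t w)) (at t within {0..})"
    by (rule integral_equation_derivative[where c=0, OF _ continuous_on_subset[OF div_path_continuous] assms]) auto
  then show ?thesis unfolding jac_def by (rule DERIV_chain2[OF DERIV_exp])
qed

text \<open>The pairing of the density with the mollifier of width \<open>e\<close> around the
  moving point, in rescaled coordinates and without the factor \<open>e ^ d\<close>.\<close>

definition blow_up :: "(real \<Rightarrow> real^'n::_ \<Rightarrow> real) \<Rightarrow> real^'n::_ \<Rightarrow> real \<Rightarrow> real \<Rightarrow> real" where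
  "blow_up r w e t = (\<integral>y. mollifier y * r t (X t w + e *\<^sub>R y) \<partial>lborel)"

text \<open>The drift at the nearby point comes from the equation, the drift at the centre from the
  moving mollifier, and the divergence from the derivative of \<open>jac\<close>. Their combination
  is a difference quotient of \<open>b\<close> plus the divergence.\<close>

definition commutator_kernel :: "real^'n::_ \<Rightarrow> real \<Rightarrow> real^'n::_ \<Rightarrow> real" where
  "commutator_kernel x e y =
     (\<Sum>j\<in>UNIV. (b (x + e *\<^sub>R y) $ j - b x $ j) / e * dmollifier j y) + divergence b x * mollifier y"

definition commutator :: "(real \<Rightarrow> real^'n::_ \<Rightarrow> real) \<Rightarrow> real^'n::_ \<Rightarrow> real \<Rightarrow> real \<Rightarrow> real" where
  "commutator r w e t = (\<integral>y. commutator_kernel (X t w) e y * r t (X t w + e *\<^sub>R y) \<partial>lborel)"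

lemma affine_continuous: "continuous_on UNIV f \<Longrightarrow> continuous_on UNIV (\<lambda>y. f (x + e *\<^sub>R y))" for f :: "real^'n::_ \<Rightarrow> real"
  by (rule continuous_on_compose2[of UNIV f]) (auto intro!: continuous_intros)

lemma commutator_kernel_continuous: "continuous_on UNIV (commutator_kernel x e)"
  unfolding commutator_kernel_def divide_inverse
  by (intro continuous_intros affine_continuous b_component mollifier_continuous)

text \<open>The substitution of \<open>X t w + e *\<^sub>R y\<close> for z in the pairing brings the
  two drift terms together as a difference quotient at scale \<open>e\<close>; the product rule with
  \<open>jac\<close> adds the divergence.\<close>

lemma blow_up_derivative:
  assumes r: "density_path r"
    and eq: "\<And>t x. 0 \<le> t \<Longrightarrow> tail UNIV (r t) x = tail UNIV (r 0) x + integral {0..t} (\<lambda>s. flux b (r s) x)"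
    and t: "0 \<le> t" and e: "0 < e"
  shows "((\<lambda>t. blow_up r w e t * jac t w) has_real_derivative jac t w * commutator r w e t) (at t within {0..})"
proof -
  let ?d = "e ^ DIM(real^'n::_)"
  have d: "?d \<noteq> 0" using e by simp
  have resc: "rescale e x (x + e *\<^sub>R y) = y" for x y :: "real^'n::_" using e by (simp add: rescale_def)
  have mc: "continuous_on UNIV (\<lambda>z. mollifier (rescale e x z))" "continuous_on UNIV (\<lambda>z. dmollifier j (rescale e x z))" for x :: "real^'n::_" and j
    unfolding rescale_def by (intro continuous_on_compose2[OF mollifier_continuous(1)] continuous_on_compose2[OF mollifier_continuous(2)] continuous_intros; auto)+
  let ?x = "X t w"
  let ?A = "\<lambda>z. \<Sum>j\<in>UNIV. b z $ j * (dmollifier j (rescale e ?x z) / e)"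
  have H: "(\<integral>z. mollifier (rescale e (X t w) z) * r t z \<partial>lborel) / ?d = blow_up r w e t" if "0 \<le> t" for t
    using integral_lborel_affine[OF borel_measurable_continuous_onI[OF continuous_on_mult[OF mc(1) density_pathD(1)[OF r that]]] e, of "X t w" "X t w"] d
    by (simp add: resc blow_up_def)
  obtain D where D: "\<And>y :: real^'n::_. \<bar>mollifier y\<bar> \<le> D" "\<And>j (y :: real^'n::_). \<bar>dmollifier j y\<bar> \<le> D" "0 \<le> D"
    using mollifier_bound by blast
  note ri = density_pathD(3)[OF r t] and rc = density_pathD(1)[OF r t]
  have Ac: "continuous_on UNIV ?A"
    unfolding divide_inverse by (intro continuous_intros b_component mc)
  have Ab: "\<bar>?A z\<bar> \<le> (\<Sum>j\<in>(UNIV :: 'n set). M * (D / e))" for z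
  proof (rule order_trans[OF sum_abs sum_mono])
    fix j
    have "\<bar>b z $ j\<bar> \<le> M" using component_le_norm_cart[of "b z" j] bd[of z] by linarith
    then show "\<bar>b z $ j * (dmollifier j (rescale e ?x z) / e)\<bar> \<le> M * (D / e)"
      unfolding abs_mult abs_divide using e D M by (intro mult_mono divide_mono) auto
  qed
  obtain B where B: "\<And>z. \<bar>path_drift e w t z\<bar> \<le> B" using path_drift_bounded[OF e] by blast
  have pc: "continuous_on UNIV (path_drift e w t)"
    by (rule continuous_on_section[OF path_drift_continuous]) (use t in simp)
  have i1: "integrable lborel (\<lambda>z. ?A z * r t z)"
    by (rule integrable_bounded_mult(2)[OF ri _ Ab]) (use borel_measurable_continuous_onI[OF Ac] in simp)
  have i2: "integrable lborel (\<lambda>z. path_drift e w t z * r t z)"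
    by (rule integrable_bounded_mult(2)[OF ri _ B]) (use borel_measurable_continuous_onI[OF pc] in simp)
  have i3: "integrable lborel (\<lambda>z. mollifier (rescale e ?x z) * r t z)"
    by (rule integrable_bounded_mult(2)[OF ri _ D(1)]) (use borel_measurable_continuous_onI[OF mc(1)] in simp)
  have E: "((\<integral>z. ?A z * r t z \<partial>lborel) + (\<integral>z. path_drift e w t z * r t z \<partial>lborel)
     + divergence b ?x * (\<integral>z. mollifier (rescale e ?x z) * r t z \<partial>lborel)) / ?d = commutator r w e t"
  proof -
    let ?k = "\<lambda>z. (?A z + path_drift e w t z + divergence b ?x * mollifier (rescale e ?x z)) * r t z"
    have "(\<integral>z. ?A z * r t z \<partial>lborel) + (\<integral>z. path_drift e w t z * r t z \<partial>lborel)
      + divergence b ?x * (\<integral>z. mollifier (rescale e ?x z) * r t z \<partial>lborel)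
      = (\<integral>z. (?A z * r t z + path_drift e w t z * r t z) + divergence b ?x * (mollifier (rescale e ?x z) * r t z) \<partial>lborel)"
      using i1 i2 i3 by (simp add: Bochner_Integration.integral_add)
    also have "\<dots> = (\<integral>z. ?k z \<partial>lborel)" by (simp add: distrib_right mult.assoc)
    also have "\<dots> = ?d * (\<integral>y. ?k (?x + e *\<^sub>R y) \<partial>lborel)"
      by (rule integral_lborel_affine[OF borel_measurable_continuous_onI e]) (intro continuous_intros Ac pc mc rc)
    also have "(\<lambda>y. ?k (?x + e *\<^sub>R y)) = (\<lambda>y. commutator_kernel ?x e y * r t (?x + e *\<^sub>R y))"
      by (auto simp: fun_eq_iff commutator_kernel_def path_drift_def resc sum_subtractf[symmetric] left_diff_distrib diff_divide_distrib)
    finally show ?thesis using d by (simp add: commutator_def)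
  qed
  have "((\<lambda>t. (\<integral>z. mollifier (rescale e (X t w) z) * r t z \<partial>lborel) / ?d * jac t w) has_real_derivative
      (((\<integral>z. ?A z * r t z \<partial>lborel) + (\<integral>z. path_drift e w t z * r t z \<partial>lborel)) / ?d * jac t w
      + (jac t w * divergence b ?x) * ((\<integral>z. mollifier (rescale e ?x z) * r t z \<partial>lborel) / ?d))) (at t within {0..})"
    by (intro DERIV_mult DERIV_cdivide mollifier_pairing_diagonal[OF r eq t e] jac_derivative[OF t])
  moreover have "((\<integral>z. ?A z * r t z \<partial>lborel) + (\<integral>z. path_drift e w t z * r t z \<partial>lborel)) / ?d * jac t w
      + (jac t w * divergence b ?x) * ((\<integral>z. mollifier (rescale e ?x z) * r t z \<partial>lborel) / ?d) = jac t w * commutator r w e t"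
    unfolding E[symmetric] by (simp add: add_divide_distrib algebra_simps)
  ultimately have "((\<lambda>t. (\<integral>z. mollifier (rescale e (X t w) z) * r t z \<partial>lborel) / ?d * jac t w) has_real_derivative jac t w * commutator r w e t) (at t within {0..})"
    by simp
  then show ?thesis
    by (rule has_field_derivative_transform_within[where d=1]) (use t H in auto)
qed

lemma directional_derivative:
  "(\<lambda>n. (b (x + inverse (real (Suc n)) *\<^sub>R y) $ j - b x $ j) / inverse (real (Suc n))) \<longlonglongrightarrow> (jacobi_matrix b x *v y) $ j"
proof -
  have "((\<lambda>s. x + s *\<^sub>R y) has_derivative (\<lambda>s. s *\<^sub>R y)) (at 0)" by (auto intro!: derivative_eq_intros)
  moreover have "(b has_derivative (\<lambda>h. jacobi_matrix b x *v h)) (at (x + 0 *\<^sub>R y))" using b_has_derivative by simp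
  ultimately have "((\<lambda>s. b (x + s *\<^sub>R y)) has_derivative (\<lambda>s. jacobi_matrix b x *v (s *\<^sub>R y))) (at 0)"
    using has_derivative_compose[of "\<lambda>s. x + s *\<^sub>R y"] by blast
  then have "((\<lambda>s. b (x + s *\<^sub>R y) $ j) has_derivative (\<lambda>s. (jacobi_matrix b x *v (s *\<^sub>R y)) $ j)) (at 0)"
    by (rule bounded_linear.has_derivative[OF bounded_linear_vec_nth])
  then have "((\<lambda>s. b (x + s *\<^sub>R y) $ j) has_real_derivative (jacobi_matrix b x *v y) $ j) (at 0)"
    unfolding has_field_derivative_def
    by (rule has_derivative_eq_rhs) (simp add: fun_eq_iff matrix_vector_mult_scaleR mult.commute)
  then have "((\<lambda>h. (b (x + h *\<^sub>R y) $ j - b x $ j) / h) \<longlongrightarrow> (jacobi_matrix b x *v y) $ j) (at 0)"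
    by (simp add: DERIV_def)
  moreover have "filterlim (\<lambda>n. inverse (real (Suc n))) (at 0) sequentially"
    by (rule filterlim_atI[OF LIMSEQ_inverse_real_of_nat]) simp
  ultimately show ?thesis by (rule filterlim_compose)
qed

text \<open>The moments select the diagonal of the Jacobian matrix: the first sum contributes minus
  its trace times the mass, and the divergence term contributes the trace times the mass.\<close>

lemma commutator_kernel_limit_integral:
  "(\<integral>y. (\<Sum>j\<in>UNIV. (jacobi_matrix b x *v y) $ j * dmollifier j y) + divergence b x * mollifier y \<partial>lborel) = 0"
proof -
  let ?J = "jacobi_matrix b x"
  have "(\<lambda>y. (\<Sum>j\<in>UNIV. (?J *v y) $ j * dmollifier j y) + divergence b x * mollifier y)
    = (\<lambda>y. (\<Sum>j\<in>UNIV. \<Sum>i\<in>UNIV. ?J $ j $ i * (y $ i * dmollifier j y)) + divergence b x * mollifier y)"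
    by (simp add: fun_eq_iff matrix_vector_mult_def sum_distrib_right mult.assoc)
  then have "(\<integral>y. (\<Sum>j\<in>UNIV. (?J *v y) $ j * dmollifier j y) + divergence b x * mollifier y \<partial>lborel)
     = (\<Sum>j\<in>UNIV. \<Sum>i\<in>UNIV. ?J $ j $ i * (\<integral>y. y $ i * dmollifier j y \<partial>lborel)) + divergence b x * integral\<^sup>L lborel (mollifier :: real^'n::_ \<Rightarrow> real)"
  proof -
    have i: "integrable lborel (\<lambda>y. ?J $ j $ i * (y $ i * dmollifier j y))" for i j
      by (rule integrable_mult_right[OF mollifier_integrable(2)])
    have 1: "(\<integral>y. (\<Sum>i\<in>UNIV. ?J $ j $ i * (y $ i * dmollifier j y)) \<partial>lborel)
      = (\<Sum>i\<in>UNIV. ?J $ j $ i * (\<integral>y. y $ i * dmollifier j y \<partial>lborel))" for j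
      by (subst Bochner_Integration.integral_sum[OF i]) simp
    have 2: "(\<integral>y. (\<Sum>j\<in>UNIV. \<Sum>i\<in>UNIV. ?J $ j $ i * (y $ i * dmollifier j y)) \<partial>lborel)
      = (\<Sum>j\<in>UNIV. \<Sum>i\<in>UNIV. ?J $ j $ i * (\<integral>y. y $ i * dmollifier j y \<partial>lborel))"
      unfolding 1[symmetric] by (rule Bochner_Integration.integral_sum) (rule Bochner_Integration.integrable_sum[OF i])
    assume "(\<lambda>y. (\<Sum>j\<in>UNIV. (?J *v y) $ j * dmollifier j y) + divergence b x * mollifier y)
      = (\<lambda>y. (\<Sum>j\<in>UNIV. \<Sum>i\<in>UNIV. ?J $ j $ i * (y $ i * dmollifier j y)) + divergence b x * mollifier y)"
    then show ?thesis
      by (simp add: 2[symmetric] Bochner_Integration.integral_add[OF Bochner_Integration.integrable_sum[OF Bochner_Integration.integrable_sum[OF i]]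
          integrable_mult_right[OF mollifier_integrable(1)]])
  qed
  also have "\<dots> = 0"
    unfolding dmollifier_moment mollifier_integral divergence_jacobi_matrix
    by (simp add: if_distrib sum_distrib_right sum_negf cong: if_cong)
  finally show ?thesis .
qed

text \<open>The Lipschitz bound on \<open>b\<close> absorbs the division by \<open>e\<close>, so the
  majorant is integrable and independent of \<open>e\<close>.\<close>

lemma commutator_kernel_bound:
  assumes e: "0 < e" and B: "\<bar>divergence b x\<bar> \<le> B"
  shows "\<bar>commutator_kernel x e y\<bar> \<le> (\<Sum>j\<in>UNIV. K * \<bar>norm y * dmollifier j y\<bar>) + B * \<bar>mollifier y\<bar>"
proof -
  have "\<bar>(b (x + e *\<^sub>R y) $ j - b x $ j) / e * dmollifier j y\<bar> \<le> K * \<bar>norm y * dmollifier j y\<bar>" for j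
  proof -
    have "\<bar>b (x + e *\<^sub>R y) $ j - b x $ j\<bar> \<le> norm (b (x + e *\<^sub>R y) - b x)"
      using component_le_norm_cart[of "b (x + e *\<^sub>R y) - b x" j] by simp
    also have "\<dots> \<le> K * (e * norm y)" using lip[of "x + e *\<^sub>R y" x] e by simp
    finally have "\<bar>b (x + e *\<^sub>R y) $ j - b x $ j\<bar> / e \<le> K * norm y" using e by (simp add: divide_le_eq mult_ac)
    from mult_right_mono[OF this abs_ge_zero[of "dmollifier j y"]] show ?thesis
      using e by (simp add: abs_mult abs_divide mult.assoc)
  qed
  then have "\<bar>\<Sum>j\<in>UNIV. (b (x + e *\<^sub>R y) $ j - b x $ j) / e * dmollifier j y\<bar> \<le> (\<Sum>j\<in>UNIV. K * \<bar>norm y * dmollifier j y\<bar>)"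
    by (intro order_trans[OF sum_abs sum_mono])
  moreover have "\<bar>divergence b x * mollifier y\<bar> \<le> B * \<bar>mollifier y\<bar>"
    unfolding abs_mult by (rule mult_right_mono[OF B]) simp
  ultimately show ?thesis unfolding commutator_kernel_def by linarith
qed

text \<open>As \<open>e\<close> tends to 0 the blow-up tends to the mass times the density at the
  moving point, while the commutator tends to 0 boundedly on the time interval. Hence the density
  along the trajectory times \<open>jac\<close> is constant in time.\<close>

lemma density_path_unique:
  assumes r: "density_path r"
    and eq: "\<And>t x. 0 \<le> t \<Longrightarrow> tail UNIV (r t) x = tail UNIV (r 0) x + integral {0..t} (\<lambda>s. flux b (r s) x)"
    and T: "0 \<le> T"
  shows "r T (X T w) * jac T w = r 0 w"
proof -
  let ?e = "\<lambda>n. inverse (real (Suc n))"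
  have e: "0 < ?e n" for n by simp
  have e0: "?e \<longlonglongrightarrow> 0" by (rule LIMSEQ_inverse_real_of_nat)
  obtain a C where w: "\<And>t. t \<in> {0..T} \<Longrightarrow> weight_bounded a C (r t)" using density_path_bound[OF r T] by blast
  have rb: "\<bar>r t z\<bar> \<le> C" if "t \<in> {0..T}" for t z
  proof -
    have "C * (\<Prod>k\<in>UNIV. weight a (z $ k)) \<le> C * 1"
      using weight_boundedD[OF w[OF that]] by (intro mult_left_mono prod_weight_le_1) auto
    then show ?thesis using weight_boundedD(3)[OF w[OF that], of z] by simp
  qed
  have C: "0 \<le> C" using weight_boundedD(2)[OF w[of 0]] T by simp
  obtain B where B: "\<And>x. \<bar>divergence b x\<bar> \<le> B" using divergence_bound by blast
  \<comment> \<open>One majorant for all scales and times: the kernel bound times the uniform bound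
    \<open>C\<close> of the densities up to time \<open>T\<close>.\<close>
  let ?g = "\<lambda>y::real^'n::_. ((\<Sum>j\<in>UNIV. K * \<bar>norm y * dmollifier j y\<bar>) + B * \<bar>mollifier y\<bar>) * C"
  have gi: "integrable lborel (?g :: real^'n::_ \<Rightarrow> real)"
    by (intro integrable_mult_left Bochner_Integration.integrable_add Bochner_Integration.integrable_sum integrable_mult_right integrable_abs mollifier_integrable)
  have rlim: "(\<lambda>n. r t (x + ?e n *\<^sub>R y)) \<longlonglongrightarrow> r t x" if t: "t \<in> {0..T}" for t x y
  proof -
    have "(\<lambda>n. x + ?e n *\<^sub>R y) \<longlonglongrightarrow> x + 0 *\<^sub>R y" by (intro tendsto_intros e0)
    moreover have "isCont (r t) (x + 0 *\<^sub>R y)"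
      using density_pathD(1)[OF r] t by (simp add: continuous_on_eq_continuous_at)
    ultimately show ?thesis using isCont_tendsto_compose[of "x + 0 *\<^sub>R y" "r t"] by simp
  qed
  have rm: "(\<lambda>y. r t (x + h *\<^sub>R y)) \<in> borel_measurable borel" if "t \<in> {0..T}" for t x h
    by (intro borel_measurable_continuous_onI affine_continuous density_pathD(1)[OF r]) (use that in simp)
  have mm: "(mollifier :: real^'n::_ \<Rightarrow> real) \<in> borel_measurable borel" by (intro borel_measurable_continuous_onI mollifier_continuous)
  have cm: "commutator_kernel x h \<in> borel_measurable borel" for x h
    by (rule borel_measurable_continuous_onI[OF commutator_kernel_continuous])
  have bl: "(\<lambda>n. blow_up r w (?e n) t) \<longlonglongrightarrow> bump_mass ^ CARD('n) * r t (X t w)" if t: "t \<in> {0..T}" for t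
  proof -
    have "(\<lambda>n. blow_up r w (?e n) t) \<longlonglongrightarrow> (\<integral>y. mollifier (y :: real^'n::_) * r t (X t w) \<partial>lborel)"
      unfolding blow_up_def
    proof (rule integral_dominated_convergence[where w="\<lambda>y. \<bar>mollifier y\<bar> * C"])
      show "integrable lborel (\<lambda>y::real^'n::_. \<bar>mollifier y\<bar> * C)" by (intro integrable_mult_left integrable_abs mollifier_integrable)
      show "AE y in lborel. (\<lambda>n. mollifier y * r t (X t w + ?e n *\<^sub>R y)) \<longlonglongrightarrow> mollifier y * r t (X t w)"
        by (intro AE_I2 tendsto_mult_left rlim t)
      show "AE y in lborel. norm (mollifier y * r t (X t w + ?e n *\<^sub>R y)) \<le> \<bar>mollifier y\<bar> * C" for n
        unfolding real_norm_def abs_mult by (intro AE_I2 mult_left_mono rb t abs_ge_zero)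
    qed (use rm[OF t] mm in auto)
    then show ?thesis by (simp add: mollifier_integral)
  qed
  have cl: "(\<lambda>n. commutator r w (?e n) t) \<longlonglongrightarrow> 0" if t: "t \<in> {0..T}" for t
  proof -
    let ?x = "X t w"
    let ?k = "\<lambda>y. (\<Sum>j\<in>UNIV. (jacobi_matrix b ?x *v y) $ j * dmollifier j y) + divergence b ?x * mollifier y"
    have "(\<lambda>n. commutator r w (?e n) t) \<longlonglongrightarrow> (\<integral>y. ?k y * r t ?x \<partial>lborel)"
      unfolding commutator_def
    proof (rule integral_dominated_convergence[where w="?g", OF _ _ gi])
      show "AE y in lborel. (\<lambda>n. commutator_kernel ?x (?e n) y * r t (?x + ?e n *\<^sub>R y)) \<longlonglongrightarrow> ?k y * r t ?x"
        unfolding commutator_kernel_def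
        by (intro AE_I2 tendsto_mult tendsto_add tendsto_sum tendsto_const directional_derivative rlim t)
      show "AE y in lborel. norm (commutator_kernel ?x (?e n) y * r t (?x + ?e n *\<^sub>R y)) \<le> ?g y" for n
        unfolding real_norm_def abs_mult[of "commutator_kernel _ _ _"]
        by (intro AE_I2 mult_mono commutator_kernel_bound[OF e B] rb t abs_ge_zero order_trans[OF abs_ge_zero commutator_kernel_bound[OF e B]])
      have "continuous_on UNIV ?k"
        unfolding matrix_vector_mult_def by (auto intro!: continuous_intros mollifier_continuous)
      then show "(\<lambda>y. ?k y * r t ?x) \<in> borel_measurable lborel"
        using borel_measurable_continuous_onI by (intro borel_measurable_times) auto
    qed (use rm[OF t] cm in \<open>auto intro!: borel_measurable_times\<close>)
    then show ?thesis using commutator_kernel_limit_integral[of ?x] by simp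
  qed
  have cb: "\<bar>commutator r w (?e n) t\<bar> \<le> (\<integral>y. ?g y \<partial>lborel)" if t: "t \<in> {0..T}" for n t
  proof -
    have "\<bar>commutator r w (?e n) t\<bar> \<le> (\<integral>y. \<bar>commutator_kernel (X t w) (?e n) y * r t (X t w + ?e n *\<^sub>R y)\<bar> \<partial>lborel)"
      unfolding commutator_def by (rule integral_abs_bound)
    also have "\<dots> \<le> (\<integral>y. ?g y \<partial>lborel)"
    proof (rule integral_mono_AE'[OF gi])
      show "AE y in lborel. \<bar>commutator_kernel (X t w) (?e n) y * r t (X t w + ?e n *\<^sub>R y)\<bar> \<le> ?g y"
        unfolding abs_mult[of "commutator_kernel _ _ _"]
        by (intro AE_I2 mult_mono commutator_kernel_bound[OF e B] rb t abs_ge_zero order_trans[OF abs_ge_zero commutator_kernel_bound[OF e B]])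
    qed (intro AE_I2 mult_nonneg_nonneg C order_trans[OF abs_ge_zero commutator_kernel_bound[OF e[of 0] B]])
    finally show ?thesis .
  qed
  have "continuous_on {0..T} (\<lambda>t. jac t w)"
    by (rule DERIV_continuous_on[where D="\<lambda>t. jac t w * divergence b (X t w)"])
       (auto intro: has_field_derivative_subset[OF jac_derivative])
  then have "bounded ((\<lambda>t. jac t w) ` {0..T})" by (intro compact_imp_bounded compact_continuous_image) auto
  then obtain J where "\<forall>t\<in>{0..T}. \<bar>jac t w\<bar> \<le> J" unfolding bounded_iff by auto
  then have J: "\<And>t. t \<in> {0..T} \<Longrightarrow> \<bar>jac t w\<bar> \<le> J" by blast
  have HI: "((\<lambda>t. jac t w * commutator r w (?e n) t) has_integral (blow_up r w (?e n) T * jac T w - blow_up r w (?e n) 0 * jac 0 w)) {0..T}" for n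
    by (rule fundamental_theorem_of_calculus[OF T])
       (auto simp: has_real_derivative_iff_has_vector_derivative[symmetric] intro: has_field_derivative_subset[OF blow_up_derivative[OF r eq]])
  have "(\<lambda>n. integral {0..T} (\<lambda>t. jac t w * commutator r w (?e n) t)) \<longlonglongrightarrow> integral {0..T} (\<lambda>t. 0)"
  proof (rule dominated_convergence(2)[where h="\<lambda>_. J * (\<integral>y. ?g y \<partial>lborel)"])
    show "(\<lambda>t. jac t w * commutator r w (?e n) t) integrable_on {0..T}" for n using HI by blast
    show "(\<lambda>t. J * (\<integral>y. ?g y \<partial>lborel)) integrable_on {0..T}" by (rule integrable_const_ivl)
    show "norm (jac t w * commutator r w (?e n) t) \<le> J * (\<integral>y. ?g y \<partial>lborel)" if "t \<in> {0..T}" for n t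
      unfolding real_norm_def abs_mult[of "jac t w"] by (intro mult_mono J cb that order_trans[OF abs_ge_zero J[OF that]] abs_ge_zero)
    show "(\<lambda>n. jac t w * commutator r w (?e n) t) \<longlonglongrightarrow> 0" if "t \<in> {0..T}" for t
      using tendsto_mult_left[OF cl[OF that], of "jac t w"] by simp
  qed
  then have "(\<lambda>n. blow_up r w (?e n) T * jac T w - blow_up r w (?e n) 0 * jac 0 w) \<longlonglongrightarrow> 0"
    using integral_unique[OF HI] by simp
  moreover have "(\<lambda>n. blow_up r w (?e n) T * jac T w - blow_up r w (?e n) 0 * jac 0 w)
     \<longlonglongrightarrow> bump_mass ^ CARD('n) * r T (X T w) * jac T w - bump_mass ^ CARD('n) * r 0 (X 0 w) * jac 0 w"
    by (intro tendsto_intros bl) (use T in auto)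
  ultimately have "bump_mass ^ CARD('n) * r T (X T w) * jac T w - bump_mass ^ CARD('n) * r 0 (X 0 w) * jac 0 w = 0"
    using LIMSEQ_unique by blast
  then have "bump_mass ^ CARD('n) * (r T (X T w) * jac T w - r 0 w) = 0"
    by (simp add: jac_def algebra_simps)
  then show ?thesis using bump_mass_pos by simp
qed

end

section \<open>The Cauchy problem\<close>

lemma C1_flow_exists:
  fixes b :: "real^'n::{finite,wellorder} \<Rightarrow> real^'n::_"
  assumes b: "\<And>j. C1_bounded (\<lambda>x. b x $ j)" and flow: "flow_of b X"
  obtains K M where "C1_flow b X K M"
proof -
  have "\<forall>j. \<exists>B. 0 \<le> B \<and> (\<forall>x y. \<bar>b x $ j - b y $ j\<bar> \<le> B * norm (x - y))"
    using lipschitz_of_partials[OF b] by blast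
  then obtain B where B: "\<And>j. 0 \<le> B j" "\<And>j x y. \<bar>b x $ j - b y $ j\<bar> \<le> B j * norm (x - y)"
    unfolding choice_iff by blast
  have "\<forall>j. \<exists>B. \<forall>x. \<bar>b x $ j\<bar> \<le> B" using b unfolding C1_bounded_def bounded_iff by auto
  then obtain P where P: "\<And>j x. \<bar>b x $ j\<bar> \<le> P j" unfolding choice_iff by blast
  have "C1_flow b X (\<Sum>j\<in>UNIV. B j) (\<Sum>j\<in>UNIV. P j)"
  proof
    fix x y
    have "norm (b x - b y) \<le> (\<Sum>j\<in>UNIV. \<bar>(b x - b y) $ j\<bar>)" by (rule norm_le_l1_cart)
    also have "\<dots> \<le> (\<Sum>j\<in>UNIV. B j * norm (x - y))" by (intro sum_mono) (simp add: B)
    finally show "norm (b x - b y) \<le> (\<Sum>j\<in>UNIV. B j) * norm (x - y)" by (simp add: sum_distrib_right)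
    show "norm (b x) \<le> (\<Sum>j\<in>UNIV. P j)"
      by (rule order_trans[OF norm_le_l1_cart sum_mono]) (rule P)
  qed (use B b flow in \<open>auto intro: sum_nonneg\<close>)
  then show ?thesis by (rule that)
qed

lemma differentiable_partially:
  fixes f :: "real^'n::finite \<Rightarrow> real"
  assumes "\<And>x. f differentiable (at x)"
  shows "partially_differentiable j f" "continuous_on UNIV f"
proof -
  show "partially_differentiable j f"
    unfolding partially_differentiable_def field_differentiable_def
  proof
    fix x
    obtain f' where f': "(f has_derivative f') (at (x + 0 *\<^sub>R axis j 1))"
      using assms[of x] by (auto simp: differentiable_def)
    have "((\<lambda>s. x + s *\<^sub>R axis j 1) has_derivative (\<lambda>s. s *\<^sub>R axis j 1)) (at 0)"
      by (auto intro!: derivative_eq_intros)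
    from has_derivative_compose[OF this f']
    have "((\<lambda>s. f (x + s *\<^sub>R axis j 1)) has_derivative (\<lambda>s. f' (s *\<^sub>R axis j 1))) (at 0)" .
    then have "((\<lambda>s. f (x + s *\<^sub>R axis j 1)) has_real_derivative f' (axis j 1)) (at 0)"
      unfolding has_field_derivative_def
      by (rule has_derivative_eq_rhs)
         (use has_derivative_bounded_linear[OF f'] in \<open>auto simp: fun_eq_iff linear_simps mult.commute\<close>)
    then show "\<exists>D. ((\<lambda>s. f (x + s *\<^sub>R axis j 1)) has_real_derivative D) (at 0)" ..
  qed
  show "continuous_on UNIV f"
    using assms by (intro continuous_at_imp_continuous_on ballI differentiable_imp_continuous_within)
qed

lemma partial_deriv_cmult:
  assumes "partially_differentiable j f"
  shows "partially_differentiable j (\<lambda>x. c * f x)" "partial_deriv j (\<lambda>x. c * f x) = (\<lambda>x. c * partial_deriv j f x)"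
proof -
  have *: "((\<lambda>s. c * f (upd x j s)) has_real_derivative c * partial_deriv j f x) (at (x $ j))" for x
    using DERIV_cmult[OF partially_differentiableD[OF assms, of x "x $ j"], of c] by simp
  show "partially_differentiable j (\<lambda>x. c * f x)" by (rule partially_differentiableI) (rule *)
  show "partial_deriv j (\<lambda>x. c * f x) = (\<lambda>x. c * partial_deriv j f x)" by (rule ext partial_derivI *)+
qed

section \<open>Densities recovered from mixed derivatives\<close>

definition pareto_density :: "(real^'n::{finite,wellorder} \<Rightarrow> real) \<Rightarrow> real^'n::_ \<Rightarrow> real" where
  "pareto_density g x = (-1) ^ CARD('n) * mixed_deriv g x"

lemma abs_pareto_density: "\<bar>pareto_density g x\<bar> = \<bar>mixed_deriv g x\<bar>"
  by (simp add: pareto_density_def abs_mult power_abs)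

lemma pareto_density_tail:
  fixes q :: "real^'n::{finite,wellorder} \<Rightarrow> real"
  assumes "continuous_on UNIV q" "weight_bounded a C q"
  shows "pareto_density (tail UNIV q) = q"
  by (simp add: fun_eq_iff pareto_density_def mixed_deriv_tail[OF assms] mult.assoc[symmetric] power_mult_distrib[symmetric])

lemma tail_pareto_density:
  fixes g :: "real^'n::{finite,wellorder} \<Rightarrow> real"
  assumes "vanishing_boundary_terms g" "continuous_on UNIV (mixed_deriv g)" "weight_bounded a C (mixed_deriv g)"
  shows "g = tail UNIV (pareto_density g)"
  using eq_tail_mixed_deriv[OF assms] by (simp add: pareto_density_def[abs_def])

lemma quickly_decaying_density:
  fixes g :: "real^'n::{finite,wellorder} \<Rightarrow> real"
  assumes g: "quickly_decaying g"
  obtains C p where "real CARD('n) < p" "\<And>x. \<bar>pareto_density g x\<bar> \<le> C * (1 + norm x) powr (- p)"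
    "\<And>x j. \<bar>partial_deriv j (pareto_density g) x\<bar> \<le> C * (1 + norm x) powr (- p)"
    "continuous_on UNIV (pareto_density g)" "\<And>j. partially_differentiable j (pareto_density g)"
    "\<And>j. continuous_on UNIV (partial_deriv j (pareto_density g))" "g = tail UNIV (pareto_density g)"
proof -
  let ?l = "sorted_list_of_set (UNIV :: 'n set)"
  have sm: "\<And>js x. iter_partial js g differentiable (at x)" and v: "vanishing_boundary_terms g"
    using g by (auto simp: quickly_decaying_def smooth_fun_def)
  obtain C p where p: "real CARD('n) < p" and d: "\<And>x. \<bar>mixed_deriv g x\<bar> \<le> C * (1 + norm x) powr (- p)"
    "\<And>x j. \<bar>partial_deriv j (mixed_deriv g) x\<bar> \<le> C * (1 + norm x) powr (- p)"
    using g by (auto simp: quickly_decaying_def)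
  note m = differentiable_partially[OF sm[of ?l], folded mixed_deriv_def]
  have m': "continuous_on UNIV (partial_deriv j (mixed_deriv g))" for j
    using differentiable_partially(2)[OF sm[of "j # ?l"]] by (simp add: mixed_deriv_def)
  have pd: "partial_deriv j (pareto_density g) = (\<lambda>x. (-1) ^ CARD('n) * partial_deriv j (mixed_deriv g) x)"
    "partially_differentiable j (pareto_density g)" for j
    using partial_deriv_cmult[OF m(1)[of j], of "(-1) ^ CARD('n)"] unfolding pareto_density_def[abs_def] by auto
  show ?thesis
  proof (rule that[OF p])
    show "\<bar>pareto_density g x\<bar> \<le> C * (1 + norm x) powr (- p)" for x using d by (simp add: abs_pareto_density)
    show "\<bar>partial_deriv j (pareto_density g) x\<bar> \<le> C * (1 + norm x) powr (- p)" for x j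
      using d(2) by (simp add: pd abs_mult power_abs)
    show "continuous_on UNIV (pareto_density g)" unfolding pareto_density_def[abs_def] by (intro continuous_intros m)
    show "partially_differentiable j (pareto_density g)" for j by (rule pd)
    show "continuous_on UNIV (partial_deriv j (pareto_density g))" for j unfolding pd by (intro continuous_intros m')
    show "g = tail UNIV (pareto_density g)"
      by (rule tail_pareto_density[OF v m(2) powr_decay_weight_bounded[OF p d(1)]])
  qed
qed

lemma dual_integral_operator_flux: "dual_integral_operator b g x = flux b (pareto_density g) x"
  by (simp add: dual_integral_operator_eq flux_def pareto_density_def[abs_def])

lemma pareto_dual_generator_flux:
  fixes b :: "real^'n::{finite,wellorder} \<Rightarrow> real^'n::_"
  assumes b: "\<And>j. C1_bounded (\<lambda>x. b x $ j)" and g: "quickly_decaying g"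
  shows "pareto_dual_generator b g x = flux b (pareto_density g) x"
proof -
  obtain C p where p: "real CARD('n) < p" and d: "\<And>x. \<bar>pareto_density g x\<bar> \<le> C * (1 + norm x) powr (- p)"
    "\<And>x j. \<bar>partial_deriv j (pareto_density g) x\<bar> \<le> C * (1 + norm x) powr (- p)"
    and c: "continuous_on UNIV (pareto_density g)" "\<And>j. partially_differentiable j (pareto_density g)"
    "\<And>j. continuous_on UNIV (partial_deriv j (pareto_density g))" and t: "g = tail UNIV (pareto_density g)"
    using quickly_decaying_density[OF g] by metis
  have "pareto_dual_generator b (tail UNIV (pareto_density g)) x = flux b (pareto_density g) x"
    unfolding flux_def
    by (rule pareto_dual_generator_tail[OF b c(1) powr_decay_weight_bounded[OF p d(1)] c(2,3) powr_decay_weight_bounded[OF p d(2)]])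
  then show ?thesis using t by simp
qed

context C1_flow
begin

lemma pareto_dual_semigroup_flow:
  assumes t: "0 \<le> t" and q: "continuous_on UNIV q" and wb: "weight_bounded a C q"
  shows "pareto_dual_semigroup X t (tail UNIV q) = tail UNIV (flow_density q t)"
proof
  fix x
  have "pareto_dual_semigroup X t (tail UNIV q) x = (\<integral>z. indicator {y. x \<le> y} (X t z) * q z \<partial>lborel)"
    unfolding pareto_dual_semigroup_tail[where X=X and t=t, OF borel_measurable_continuous_onI[OF q] wb X_measurable[OF t]] set_lebesgue_integral_def
    by (intro Bochner_Integration.integral_cong) (auto simp: indicator_def)
  also have "\<dots> = (\<integral>y. indicator {y. x \<le> y} y * flow_density q t y \<partial>lborel)"
    by (rule flow_transport[OF t _ q]) simp
  also have "\<dots> = tail UNIV (flow_density q t) x"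
    unfolding tail_UNIV[OF borel_measurable_continuous_onI[OF flow_density_continuous[OF q t]]] set_lebesgue_integral_def by simp
  finally show "pareto_dual_semigroup X t (tail UNIV q) x = tail UNIV (flow_density q t) x" .
qed

text \<open>The decay conditions persist because transport keeps the exponent of the initial
  density, and each transported density gives a tail with vanishing boundary terms. The time
  derivative is read off from the integral equation, whose integrand is continuous.\<close>

lemma semigroup_solves:
  assumes g: "quickly_decaying g"
  shows "dual_cauchy_solution b g (\<lambda>t. pareto_dual_semigroup X t g)"
proof -
  let ?q = "pareto_density g"
  obtain C p where p: "real CARD('n) < p" and d: "\<And>x. \<bar>?q x\<bar> \<le> C * (1 + norm x) powr (- p)"
    and c: "continuous_on UNIV ?q" and t: "g = tail UNIV ?q"
    using quickly_decaying_density[OF g] by metis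
  have p0: "0 \<le> p" using p by (meson less_imp_le of_nat_0_le_iff order_le_less_trans)
  note wb = powr_decay_weight_bounded[OF p d]
  note dp = density_path_flow_density[OF c p d]
  have u: "pareto_dual_semigroup X t g = tail UNIV (flow_density ?q t)" if "0 \<le> t" for t
    using pareto_dual_semigroup_flow[OF that c wb] t by simp
  have w: "\<exists>a C. weight_bounded a C (flow_density ?q t)" if "0 \<le> t" for t by (rule density_pathD(2)[OF dp that])
  have dens: "pareto_density (pareto_dual_semigroup X t g) = flow_density ?q t" if "0 \<le> t" for t
    using w[OF that] pareto_density_tail[OF density_pathD(1)[OF dp that]] unfolding u[OF that] by blast
  have mix: "mixed_deriv (pareto_dual_semigroup X t g) x = (-1) ^ CARD('n) * flow_density ?q t x" if "0 \<le> t" for t x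
    unfolding dens[OF that, symmetric] pareto_density_def by (simp add: mult.assoc[symmetric] power_mult_distrib[symmetric])
  show ?thesis
    unfolding dual_cauchy_solution_def
  proof (intro conjI allI impI)
    show "pareto_dual_semigroup X 0 g = g" using u[of 0] t by (simp add: flow_density_0)
    show "vanishing_boundary_terms (pareto_dual_semigroup X t g)" if "0 \<le> t" for t
      unfolding u[OF that] using w[OF that] vanishing_boundary_terms_tail[OF density_pathD(1)[OF dp that]] by blast
    have "continuous_on ({0..} \<times> UNIV) (\<lambda>(t, x). (-1) ^ CARD('n) * flow_density ?q t x)"
      using continuous_on_mult_left[OF flow_density_joint_continuous[OF c], of "(-1) ^ CARD('n)"] by (simp add: case_prod_unfold)
    then show "continuous_on ({0..} \<times> UNIV) (\<lambda>(t, x). mixed_deriv (pareto_dual_semigroup X t g) x)"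
      by (rule continuous_on_eq) (auto simp: mix)
    fix T :: real assume T: "0 \<le> T"
    obtain C' where "\<And>t y. t \<in> {0..T} \<Longrightarrow> \<bar>flow_density ?q t y\<bar> \<le> C' * (1 + norm y) powr (- p)"
      using flow_density_decay[OF T p0 d] by blast
    then show "\<exists>C. \<exists>p > real CARD('n). \<forall>t\<in>{0..T}. \<forall>x. \<bar>mixed_deriv (pareto_dual_semigroup X t g) x\<bar> \<le> C * (1 + norm x) powr (- p)"
      using p by (intro exI[of _ C'] exI[of _ p]) (auto simp: mix abs_mult power_abs)
  next
    fix t :: real and x assume t: "0 \<le> t"
    show "((\<lambda>s. pareto_dual_semigroup X s g x) has_real_derivative dual_integral_operator b (pareto_dual_semigroup X t g) x) (at t within {0..})"
      unfolding dual_integral_operator_flux dens[OF t]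
    proof (rule integral_equation_derivative[OF _ flux_time_continuous[OF dp] t])
      show "pareto_dual_semigroup X s g x = tail UNIV ?q x + integral {0..s} (\<lambda>s. flux b (flow_density ?q s) x)" if "0 \<le> s" for s
        unfolding u[OF that] by (rule flow_density_integral_equation[OF c dp that])
    qed
  qed
qed

text \<open>Vanishing boundary terms make a solution the tail of its own density at each time.
  Integrating the equation in time at fixed x gives the integral equation, and that determines the
  density.\<close>

lemma solution_unique:
  assumes g: "quickly_decaying g" and u: "dual_cauchy_solution b g u" and t: "0 \<le> t"
  shows "u t = pareto_dual_semigroup X t g"
proof -
  let ?q = "pareto_density g"
  obtain C p where p: "real CARD('n) < p" and d: "\<And>x. \<bar>?q x\<bar> \<le> C * (1 + norm x) powr (- p)"
    and c: "continuous_on UNIV ?q" and tg: "g = tail UNIV ?q"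
    using quickly_decaying_density[OF g] by metis
  define r where "r t = pareto_density (u t)" for t
  have u0: "u 0 = g" and v: "\<And>t. 0 \<le> t \<Longrightarrow> vanishing_boundary_terms (u t)"
    and mc: "continuous_on ({0..} \<times> UNIV) (\<lambda>(t, x). mixed_deriv (u t) x)"
    and dec: "\<And>T. 0 \<le> T \<Longrightarrow> \<exists>C. \<exists>p > real CARD('n). \<forall>t\<in>{0..T}. \<forall>x. \<bar>mixed_deriv (u t) x\<bar> \<le> C * (1 + norm x) powr (- p)"
    and der: "\<And>t x. 0 \<le> t \<Longrightarrow> ((\<lambda>s. u s x) has_real_derivative dual_integral_operator b (u t) x) (at t within {0..})"
    using u unfolding dual_cauchy_solution_def by blast+
  have wm: "\<exists>a C. \<forall>t\<in>{0..T}. weight_bounded a C (mixed_deriv (u t)) \<and> weight_bounded a C (r t)" if T: "0 \<le> T" for T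
  proof -
    obtain C p where "real CARD('n) < p" "\<forall>t\<in>{0..T}. \<forall>x. \<bar>mixed_deriv (u t) x\<bar> \<le> C * (1 + norm x) powr (- p)"
      using dec[OF T] by blast
    then show ?thesis
      by (intro exI[of _ "p / real CARD('n)"] exI[of _ C]) (auto intro!: powr_decay_weight_bounded simp: r_def abs_pareto_density)
  qed
  have rp: "density_path r"
    unfolding density_path_def
  proof (intro conjI allI impI)
    show "continuous_on ({0..} \<times> UNIV) (\<lambda>(t, x). r t x)"
      using continuous_on_mult_left[OF mc, of "(-1) ^ CARD('n)"] by (simp add: r_def pareto_density_def case_prod_unfold)
    show "\<exists>a C. \<forall>t\<in>{0..T}. weight_bounded a C (r t)" if "0 \<le> T" for T using wm[OF that] by blast
  qed
  have ut: "u t = tail UNIV (r t)" if t: "0 \<le> t" for t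
  proof -
    obtain a C where "weight_bounded a C (mixed_deriv (u t))" using wm[OF t] t by (meson atLeastAtMost_iff order_refl)
    moreover have "continuous_on UNIV (mixed_deriv (u t))" by (rule continuous_on_section[OF mc]) (use t in simp)
    ultimately show ?thesis unfolding r_def using v[OF t] by (intro tail_pareto_density)
  qed
  have eq: "tail UNIV (r t) x = tail UNIV (r 0) x + integral {0..t} (\<lambda>s. flux b (r s) x)" if t: "0 \<le> t" for t x
  proof -
    have "((\<lambda>s. flux b (r s) x) has_integral (u t x - u 0 x)) {0..t}"
    proof (rule fundamental_theorem_of_calculus[OF t])
      show "((\<lambda>s. u s x) has_vector_derivative flux b (r s) x) (at s within {0..t})" if "s \<in> {0..t}" for s
        using has_field_derivative_subset[OF der[of s x], of "{0..t}"] that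
        by (auto simp: has_real_derivative_iff_has_vector_derivative dual_integral_operator_flux r_def)
    qed
    then show ?thesis using ut[OF t] ut[of 0] by (simp add: integral_unique)
  qed
  have r0: "r 0 = ?q" by (simp add: r_def u0)
  have "r t = flow_density ?q t"
  proof
    fix y
    have "r t y * jac t (Y t y) = ?q (Y t y)"
      using density_path_unique[OF rp eq t, of "Y t y"] t by (simp add: r0)
    then show "r t y = flow_density ?q t y" by (simp add: flow_density_def field_simps)
  qed
  then have "u t = tail UNIV (flow_density ?q t)" using ut[OF t] by simp
  also have "\<dots> = pareto_dual_semigroup X t g"
    using pareto_dual_semigroup_flow[OF t c powr_decay_weight_bounded[OF p d]] tg by simp
  finally show ?thesis .
qed

end

section \<open>Autonomous coordinates\<close>

lemma flux_autonomous:
  fixes b :: "real^'n::finite \<Rightarrow> real^'n"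
  assumes aut: "\<forall>j x y. x $ j = y $ j \<longrightarrow> b x $ j = b y $ j"
    and q: "continuous_on UNIV q" "weight_bounded a C q"
  shows "flux b q x = - (\<Sum>j\<in>UNIV. b x $ j * partial_deriv j (tail UNIV q) x)"
proof -
  have "tail (-{j}) (\<lambda>y. b y $ j * q y) x = b x $ j * tail (-{j}) q x" for j
  proof -
    have "b (overwrite (-{j}) z x) $ j = b x $ j" for z using aut by (metis ComplD insertI1 overwrite_nth)
    then show ?thesis by (simp add: tail_def set_lebesgue_integral_def mult.left_commute)
  qed
  moreover have "partial_deriv j (tail UNIV q) x = - tail (-{j}) q x" for j
    using fun_cong[OF iter_partial_tail[OF q, of "[j]"], of x] by simp
  ultimately show ?thesis by (simp add: flux_def sum_negf)
qed

text \<open>A reversal of the order would force the projections to agree at some earlier time. From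
  then on Gronwall for the squared difference keeps them equal, since the projected motions obey a
  scalar Lipschitz estimate.\<close>

lemma (in lipschitz_flow) flow_mono_component:
  fixes proj :: "'a \<Rightarrow> real"
  assumes proj: "bounded_linear proj" and lipp: "\<And>x y. \<bar>proj (b x) - proj (b y)\<bar> \<le> K * \<bar>proj x - proj y\<bar>"
    and t: "0 \<le> t" and le: "proj x \<le> proj y"
  shows "proj (X t x) \<le> proj (X t y)"
proof (rule ccontr)
  let ?f = "\<lambda>s. proj (X s y) - proj (X s x)"
  assume "\<not> proj (X t x) \<le> proj (X t y)"
  then have neg: "?f t < 0" by simp
  have cX: "continuous_on {0..t} (\<lambda>s. proj (X s z))" for z
    by (rule bounded_linear.continuous_on[OF proj continuous_on_subset[OF X_continuous]]) auto
  have fc: "continuous_on {0..t} ?f" by (intro continuous_on_diff cX)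
  obtain s where s: "0 \<le> s" "s \<le> t" "?f s = 0"
    using IVT2'[of ?f t 0 0] neg le t fc by auto
  have dX: "((\<lambda>s. proj (X s z)) has_real_derivative proj (b (X s z))) (at s)" if "0 < s" for s z
    using bounded_linear.has_vector_derivative[OF proj X_deriv_at[OF that]]
    by (simp add: has_real_derivative_iff_has_vector_derivative)
  have "(?f t)\<^sup>2 \<le> exp (2 * K * (t - s)) * (?f s)\<^sup>2"
  proof (rule gronwall[OF s(2)])
    show "continuous_on {s..t} (\<lambda>s. (?f s)\<^sup>2)"
      using s by (intro continuous_intros continuous_on_subset[OF cX]) auto
    fix r assume r: "s < r" "r < t"
    have r0: "0 < r" using r s by simp
    let ?D = "proj (b (X r y)) - proj (b (X r x))"
    show "((\<lambda>s. (?f s)\<^sup>2) has_real_derivative 2 * ?f r * ?D) (at r)"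
      by (auto intro!: derivative_eq_intros dX[OF r0])
    have "?f r * ?D \<le> \<bar>?f r\<bar> * (K * \<bar>?f r\<bar>)"
      using mult_left_mono[OF lipp[of "X r y" "X r x"] abs_ge_zero[of "?f r"]] by (simp add: abs_mult[symmetric])
    also have "\<dots> = K * (?f r)\<^sup>2" by (simp add: power2_eq_square)
    finally have "?f r * ?D \<le> K * (?f r)\<^sup>2" .
    from mult_left_mono[OF this, of 2] show "2 * ?f r * ?D \<le> 2 * K * (?f r)\<^sup>2"
      by (simp only: mult.assoc zero_le_numeral)
  qed
  then have "?f t = 0" using s(3) by simp
  then show False using neg by simp
qed

context C1_flow
begin

lemma autonomous_mono:
  assumes aut: "\<forall>j x y. x $ j = y $ j \<longrightarrow> b x $ j = b y $ j" and t: "0 \<le> t" and le: "x \<le> y"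
  shows "X t x \<le> X t y" "Y t x \<le> Y t y"
proof -
  have lipj: "\<bar>b x $ j - b y $ j\<bar> \<le> K * \<bar>x $ j - y $ j\<bar>" for x y j
  proof -
    \<comment> \<open>Exchanging all coordinates other than \<open>j\<close> for those of
      \<open>y\<close> leaves \<open>b x $ j\<close> unchanged, so the Lipschitz bound involves the
      difference in the coordinate \<open>j\<close> only.\<close>
    have "b x $ j = b (upd y j (x $ j)) $ j" using aut by (metis upd_nth)
    then have "\<bar>b x $ j - b y $ j\<bar> \<le> norm (b (upd y j (x $ j)) - b y)"
      using component_le_norm_cart[of "b (upd y j (x $ j)) - b y" j] by simp
    also have "\<dots> \<le> K * norm (upd y j (x $ j) - y)" by (rule lip)
    also have "upd y j (x $ j) - y = (x $ j - y $ j) *\<^sub>R axis j 1" by (auto simp: vec_eq_iff axis_def)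
    finally show ?thesis by simp
  qed
  show "X t x \<le> X t y"
    unfolding less_eq_vec_def
    by (intro allI flow_mono_component[OF bounded_linear_vec_nth lipj t]) (use le in \<open>simp add: less_eq_vec_def\<close>)
  have lipj': "\<bar>(- b x) $ j - (- b y) $ j\<bar> \<le> K * \<bar>x $ j - y $ j\<bar>" for x y j
    using lipj[of x j y] by (simp add: abs_minus_commute)
  show "Y t x \<le> Y t y"
    unfolding less_eq_vec_def
    by (intro allI lipschitz_flow.flow_mono_component[OF lipschitz_flow_Y bounded_linear_vec_nth lipj' t]) (use le in \<open>simp add: less_eq_vec_def\<close>)
qed

lemma Y_measurable: "0 \<le> t \<Longrightarrow> Y t \<in> borel_measurable borel"
  by (rule lipschitz_flow.X_measurable[OF lipschitz_flow_Y])

lemma markov_Y: "markov_transition (deterministic_process Y)"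
  unfolding markov_transition_def
proof (intro conjI allI impI)
  show "deterministic_process Y t \<in> borel \<rightarrow>\<^sub>M prob_algebra borel" if "0 \<le> t" for t
    unfolding deterministic_process_def
    by (rule measurable_compose[OF Y_measurable[OF that] measurable_return_prob_space])
  show "deterministic_process Y 0 x = return borel x" for x
    using Y_X[of 0 x] by (simp add: deterministic_process_def)
  show "deterministic_process Y (s + t) x = deterministic_process Y s x \<bind> deterministic_process Y t"
    if st: "0 \<le> s" "0 \<le> t" for s t x
  proof -
    have "(\<lambda>y. return borel (Y t y)) \<in> borel \<rightarrow>\<^sub>M subprob_algebra borel"
      by (rule measurable_compose[OF Y_measurable[OF st(2)] return_measurable])
    from bind_return[OF this, of "Y s x"]
    have "return borel (Y s x) \<bind> (\<lambda>y. return borel (Y t y)) = return borel (Y t (Y s x))" by simp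
    moreover have "Y (s + t) x = Y t (Y s x)"
      using lipschitz_flow.X_add[OF lipschitz_flow_Y st(2,1), of x] by (simp add: add.commute)
    ultimately show ?thesis by (simp add: deterministic_process_def[abs_def])
  qed
qed

lemma autonomous_dual:
  assumes aut: "\<forall>j x y. x $ j = y $ j \<longrightarrow> b x $ j = b y $ j" and t: "0 \<le> t"
  shows "y \<le> X t x \<longleftrightarrow> Y t y \<le> x"
  using autonomous_mono(2)[OF aut t, of y "X t x"] autonomous_mono(1)[OF aut t, of "Y t y" x] t by auto

end

section \<open>Point masses identified by lower orthants\<close>

lemma prob_eq_return:
  fixes P :: "(real^'n::finite) measure"
  assumes P: "prob_space P" "sets P = sets borel"
    and eq: "\<And>x. measure P {z. z \<le> x} = indicator {z. z \<le> x} y"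
  shows "P = return borel y"
proof -
  interpret P: prob_space P by fact
  have sets: "sets (borel :: (real^'n) measure) = sigma_sets UNIV (range atMost)"
    by (subst borel_eq_atMost) simp
  have E: "emeasure P {..x} = emeasure (return borel y) {..x}" for x
    using eq[of x] by (simp add: P.emeasure_eq_measure atMost_def indicator_def)
  show ?thesis
  proof (rule measure_eqI_generator_eq[where E="range atMost" and \<Omega>=UNIV and A="\<lambda>k::nat. {..(\<chi> i. real k)}"])
    show "Int_stable (range (atMost :: real^'n \<Rightarrow> _))"
    proof (rule Int_stableI_image)
      fix x y :: "real^'n"
      show "\<exists>z\<in>UNIV. {..x} \<inter> {..y} = {..z}" by (intro bexI[of _ "inf x y"]) auto
    qed
    show "(\<Union>k::nat. {..(\<chi> i. real k) :: real^'n}) = UNIV"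
    proof -
      have "x \<in> (\<Union>k::nat. {..(\<chi> i. real k)})" for x :: "real^'n"
      proof -
        obtain k where k: "norm x \<le> real k" using real_arch_simple by blast
        have "x $ n \<le> real k" for n using component_le_norm_cart[of x n] k by linarith
        then show ?thesis by (auto simp: less_eq_vec_def)
      qed
      then show ?thesis by blast
    qed
  qed (use P sets E in \<open>auto simp: indicator_def split: if_splits\<close>)
qed

theorem proposition2p2:
  fixes b :: "real^'n::{finite,wellorder} \<Rightarrow> real^'n::_"
    and X :: "real \<Rightarrow> real^'n::_ \<Rightarrow> real^'n::_"
  assumes "\<And>j. C1_bounded (\<lambda>x. b x $ j)"
    and "flow_of b X"
  shows "(\<forall>g. quickly_decaying g \<longrightarrow>
            (\<forall>x. pareto_dual_generator b g x =
              (-1) ^ CARD('n) *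
              (\<Sum>j\<in>UNIV. LINT z : {z. \<forall>k\<in>-{j}. x $ k \<le> z k} | PiM (-{j}) (\<lambda>_. lborel).
                 b (glue j z x) $ j * mixed_deriv g (glue j z x))) \<and>
            dual_cauchy_solution b g (\<lambda>t. pareto_dual_semigroup X t g) \<and>
            (\<forall>u. dual_cauchy_solution b g u \<longrightarrow> (\<forall>t\<ge>0. u t = pareto_dual_semigroup X t g))) \<and>
         ((\<forall>j x y. x $ j = y $ j \<longrightarrow> b x $ j = b y $ j) \<longrightarrow>
            (\<forall>g. quickly_decaying g \<longrightarrow>
              (\<forall>x. pareto_dual_generator b g x = - (\<Sum>j\<in>UNIV. b x $ j * partial_deriv j g x) \<and>
                   pareto_dual_generator b g x = - drift_operator b g x)) \<and>
            (\<exists>Y. flow_of (\<lambda>x. - b x) Y \<and>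
              markov_transition (deterministic_process Y) \<and>
              pareto_dual_processes (deterministic_process X) (deterministic_process Y) \<and>
              (\<forall>R. markov_transition R \<and> pareto_dual_processes (deterministic_process X) R \<longrightarrow>
                 (\<forall>t\<ge>0. \<forall>y. R t y = deterministic_process Y t y))))"
proof -
  obtain K M where "C1_flow b X K M" by (rule C1_flow_exists[OF assms])
  then interpret C1_flow b X K M .
  have gen: "pareto_dual_generator b g x = - (\<Sum>j\<in>UNIV. b x $ j * partial_deriv j g x)"
    if aut: "\<forall>j x y. x $ j = y $ j \<longrightarrow> b x $ j = b y $ j" and g: "quickly_decaying g" for g x
  proof -
    obtain C p where p: "real CARD('n) < p" and d: "\<And>x. \<bar>pareto_density g x\<bar> \<le> C * (1 + norm x) powr (- p)"
      and c: "continuous_on UNIV (pareto_density g)" and t: "g = tail UNIV (pareto_density g)"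
      using quickly_decaying_density[OF g] by metis
    show ?thesis
      using flux_autonomous[OF aut c powr_decay_weight_bounded[OF p d], of x] pareto_dual_generator_flux[OF assms(1) g, of x] t by simp
  qed
  have dual: "pareto_dual_processes (deterministic_process X) (deterministic_process Y)"
    if "\<forall>j x y. x $ j = y $ j \<longrightarrow> b x $ j = b y $ j"
    unfolding pareto_dual_processes_def deterministic_process_def
    using autonomous_dual[OF that] by (auto simp: measure_return indicator_def)
  have uniq: "R t y = deterministic_process Y t y"
    if aut: "\<forall>j x y. x $ j = y $ j \<longrightarrow> b x $ j = b y $ j"
      and R: "markov_transition R" "pareto_dual_processes (deterministic_process X) R" and t: "0 \<le> t" for R t y
    unfolding deterministic_process_def
  proof (rule prob_eq_return)
    have "R t y \<in> space (prob_algebra borel)"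
      using R(1) t unfolding markov_transition_def by (auto intro: measurable_space)
    then show "prob_space (R t y)" "sets (R t y) = sets borel" by (auto simp: space_prob_algebra)
    show "measure (R t y) {z. z \<le> x} = indicator {z. z \<le> x} (Y t y)" for x
    proof -
      have "measure (R t y) {z. z \<le> x} = measure (return borel (X t x)) {z. y \<le> z}"
        using R(2) t unfolding pareto_dual_processes_def deterministic_process_def by auto
      also have "\<dots> = indicator {z. z \<le> x} (Y t y)"
        using autonomous_dual[OF aut t, of y x] by (simp add: measure_return indicator_def)
      finally show ?thesis .
    qed
  qed
  show ?thesis
    using pareto_dual_generator_flux[OF assms(1)] semigroup_solves solution_unique gen flow_of_Y markov_Y dual uniq
    unfolding dual_integral_operator_flux[symmetric] dual_integral_operator_def drift_operator_def
    by (intro conjI allI impI exI[of _ Y]) blast+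
qed

end
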